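(* In $\mathbf{CZF}$, the set generated axiom SGA and finitary NID are equivalent.
   Context: A set is finite if it is the image of a surjection $\{1,\dots,n\}\to a$ for some $n\in\mathbb N$; $\mathrm{Finpow}(S)$ is the set of finite subsets of $S$ and $\mathrm{Pow}(S)$ the class of all subsets. A class $X$ of subsets of a set $S$ is set-generated if there is a set $G\subseteq X$ with $\forall\alpha\in X\,\forall s\in\alpha\,\exists\beta\in G\,s\in\beta\subseteq\alpha$, and strongly set-generated if there is a set $G\subseteq X$ with $\forall\alpha\in X\,\forall\sigma\in\mathrm{Finpow}(\alpha)\,\exists\beta\in G\,\sigma\subseteq\beta\subseteq\alpha$. SGA: for each set $S$ and each set $Z\subseteq\mathrm{Finpow}(S)\times\mathrm{Pow}(\mathrm{Pow}(S))$, the class $\mathcal M(Z)=\{\alpha\in\mathrm{Pow}(S):\forall(\sigma,\Gamma)\in Z\,(\sigma\subseteq\alpha\to\exists U\in\Gamma\,U\subseteq\alpha)\}$ is strongly set-generated. A finitary rule on a set $X$ is a pair $(a,b)$ of subsets of $X$ with $a$ finite; $Y\subseteq X$ is closed under it if $a\subseteq Y$ implies $b\cap Y$ inhabited. Finitary NID: for every set $X$ and every set $\mathcal R$ of finitary rules on $X$, the class of subsets of $X$ closed under all rules in $\mathcal R$ is set-generated. *)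

theory Defs
  imports Main
begin

section \<open>Intuitionistic first-order logic with equality over the language of set theory\<close>

text \<open>
  Provability in CZF is the derivability of a formula in an intuitionistic calculus, so formulas
  and derivations are represented as objects; the classical logic of HOL is only the metalogic.
  Variables are de Bruijn indices and are the only terms.
\<close>

datatype fm =
    Mem nat nat
  | Eq nat nat
  | Falsum
  | Conj fm fm
  | Disj fm fm
  | Imp fm fm
  | All fm
  | Ex fm

primrec rename :: "(nat \<Rightarrow> nat) \<Rightarrow> fm \<Rightarrow> fm" where
  "rename r (Mem x y) = Mem (r x) (r y)"
| "rename r (Eq x y) = Eq (r x) (r y)"
| "rename r Falsum = Falsum"
| "rename r (Conj \<phi> \<psi>) = Conj (rename r \<phi>) (rename r \<psi>)"
| "rename r (Disj \<phi> \<psi>) = Disj (rename r \<phi>) (rename r \<psi>)"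
| "rename r (Imp \<phi> \<psi>) = Imp (rename r \<phi>) (rename r \<psi>)"
| "rename r (All \<phi>) = All (rename (case_nat 0 (\<lambda>k. Suc (r k))) \<phi>)"
| "rename r (Ex \<phi>) = Ex (rename (case_nat 0 (\<lambda>k. Suc (r k))) \<phi>)"

primrec free_vars :: "fm \<Rightarrow> nat set" where
  "free_vars (Mem x y) = {x, y}"
| "free_vars (Eq x y) = {x, y}"
| "free_vars Falsum = {}"
| "free_vars (Conj \<phi> \<psi>) = free_vars \<phi> \<union> free_vars \<psi>"
| "free_vars (Disj \<phi> \<psi>) = free_vars \<phi> \<union> free_vars \<psi>"
| "free_vars (Imp \<phi> \<psi>) = free_vars \<phi> \<union> free_vars \<psi>"
| "free_vars (All \<phi>) = {k. Suc k \<in> free_vars \<phi>}"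
| "free_vars (Ex \<phi>) = {k. Suc k \<in> free_vars \<phi>}"

text \<open>\<open>inst t \<phi>\<close> is the result of removing the outermost binder in front of \<open>\<phi>\<close>,
  replacing the variable it bound by \<open>t\<close>.\<close>

definition inst :: "nat \<Rightarrow> fm \<Rightarrow> fm" where
  "inst t = rename (case_nat t (\<lambda>k. k))"

text \<open>Natural deduction. Renaming by \<open>Suc\<close> makes the variable \<open>0\<close> fresh, which is how the
  eigenvariable conditions of \<open>AllI\<close> and \<open>ExE\<close> are expressed.\<close>

inductive derives :: "fm set \<Rightarrow> fm \<Rightarrow> bool" (infix "\<turnstile>" 50) where
  Assm: "\<phi> \<in> \<Gamma> \<Longrightarrow> \<Gamma> \<turnstile> \<phi>"
| FalsumE: "\<Gamma> \<turnstile> Falsum \<Longrightarrow> \<Gamma> \<turnstile> \<phi>"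
| ConjI: "\<Gamma> \<turnstile> \<phi> \<Longrightarrow> \<Gamma> \<turnstile> \<psi> \<Longrightarrow> \<Gamma> \<turnstile> Conj \<phi> \<psi>"
| ConjE1: "\<Gamma> \<turnstile> Conj \<phi> \<psi> \<Longrightarrow> \<Gamma> \<turnstile> \<phi>"
| ConjE2: "\<Gamma> \<turnstile> Conj \<phi> \<psi> \<Longrightarrow> \<Gamma> \<turnstile> \<psi>"
| DisjI1: "\<Gamma> \<turnstile> \<phi> \<Longrightarrow> \<Gamma> \<turnstile> Disj \<phi> \<psi>"
| DisjI2: "\<Gamma> \<turnstile> \<psi> \<Longrightarrow> \<Gamma> \<turnstile> Disj \<phi> \<psi>"
| DisjE: "\<Gamma> \<turnstile> Disj \<phi> \<psi> \<Longrightarrow> insert \<phi> \<Gamma> \<turnstile> \<chi> \<Longrightarrow> insert \<psi> \<Gamma> \<turnstile> \<chi> \<Longrightarrow> \<Gamma> \<turnstile> \<chi>"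
| ImpI: "insert \<phi> \<Gamma> \<turnstile> \<psi> \<Longrightarrow> \<Gamma> \<turnstile> Imp \<phi> \<psi>"
| ImpE: "\<Gamma> \<turnstile> Imp \<phi> \<psi> \<Longrightarrow> \<Gamma> \<turnstile> \<phi> \<Longrightarrow> \<Gamma> \<turnstile> \<psi>"
| AllI: "rename Suc ` \<Gamma> \<turnstile> \<phi> \<Longrightarrow> \<Gamma> \<turnstile> All \<phi>"
| AllE: "\<Gamma> \<turnstile> All \<phi> \<Longrightarrow> \<Gamma> \<turnstile> inst t \<phi>"
| ExI: "\<Gamma> \<turnstile> inst t \<phi> \<Longrightarrow> \<Gamma> \<turnstile> Ex \<phi>"
| ExE: "\<Gamma> \<turnstile> Ex \<phi> \<Longrightarrow> insert \<phi> (rename Suc ` \<Gamma>) \<turnstile> rename Suc \<psi> \<Longrightarrow> \<Gamma> \<turnstile> \<psi>"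
| EqI: "\<Gamma> \<turnstile> Eq t t"
| EqE: "\<Gamma> \<turnstile> Eq s t \<Longrightarrow> \<Gamma> \<turnstile> inst s \<phi> \<Longrightarrow> \<Gamma> \<turnstile> inst t \<phi>"


section \<open>Writing formulas with named bound variables\<close>

text \<open>
  To avoid explicit indices, formulas are written as functions of the number \<open>n\<close> of binders they
  are placed under (their depth), with variables given as de Bruijn levels: the variable bound by
  the \<open>i\<close>-th enclosing binder, counted from the outside and starting with \<open>0\<close>, is \<open>i\<close>, and its
  index at depth \<open>n\<close> is \<open>n - Suc i\<close>. A quantifier at depth \<open>n\<close> thus passes the level \<open>n\<close> to its
  body. The formula denoted by a closed expression is its value at depth \<open>0\<close>.
\<close>

type_synonym dfm = "nat \<Rightarrow> fm"

definition dMem :: "nat \<Rightarrow> nat \<Rightarrow> dfm" (infix "\<^bold>\<in>" 55) where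
  "(x \<^bold>\<in> y) = (\<lambda>n. Mem (n - Suc x) (n - Suc y))"

definition dEq :: "nat \<Rightarrow> nat \<Rightarrow> dfm" (infix "\<^bold>=" 55) where
  "(x \<^bold>= y) = (\<lambda>n. Eq (n - Suc x) (n - Suc y))"

definition dNot :: "dfm \<Rightarrow> dfm" ("\<^bold>\<not> _" [50] 50) where
  "(\<^bold>\<not> P) = (\<lambda>n. Imp (P n) Falsum)"

definition dConj :: "dfm \<Rightarrow> dfm \<Rightarrow> dfm" (infixr "\<^bold>\<and>" 45) where
  "(P \<^bold>\<and> Q) = (\<lambda>n. Conj (P n) (Q n))"

definition dDisj :: "dfm \<Rightarrow> dfm \<Rightarrow> dfm" (infixr "\<^bold>\<or>" 40) where
  "(P \<^bold>\<or> Q) = (\<lambda>n. Disj (P n) (Q n))"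

definition dImp :: "dfm \<Rightarrow> dfm \<Rightarrow> dfm" (infixr "\<^bold>\<longrightarrow>" 35) where
  "(P \<^bold>\<longrightarrow> Q) = (\<lambda>n. Imp (P n) (Q n))"

definition dIff :: "dfm \<Rightarrow> dfm \<Rightarrow> dfm" (infixr "\<^bold>\<longleftrightarrow>" 35) where
  "(P \<^bold>\<longleftrightarrow> Q) = ((P \<^bold>\<longrightarrow> Q) \<^bold>\<and> (Q \<^bold>\<longrightarrow> P))"

definition dAll :: "(nat \<Rightarrow> dfm) \<Rightarrow> dfm" (binder "\<^bold>\<forall>" 30) where
  "dAll F = (\<lambda>n. All (F n (Suc n)))"

definition dEx :: "(nat \<Rightarrow> dfm) \<Rightarrow> dfm" (binder "\<^bold>\<exists>" 30) where
  "dEx F = (\<lambda>n. Ex (F n (Suc n)))"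

text \<open>
  For axiom schemata: \<open>\<phi>\<langle>x\<^sub>0, \<dots>, x\<^sub>m\<rangle>\<close> is the formula \<open>\<phi>\<close> with its free
  variables \<open>0, \<dots>, m\<close> replaced by \<open>x\<^sub>0, \<dots>, x\<^sub>m\<close>. Its remaining free variables are parameters and
  refer to variables outside all binders of the expression, so none of them can be captured.
\<close>

definition app :: "fm \<Rightarrow> nat list \<Rightarrow> dfm" where
  "app \<phi> xs = (\<lambda>n. rename
     (\<lambda>k. if k < length xs then n - Suc (xs ! k) else n + (k - length xs)) \<phi>)"

abbreviation app1 :: "fm \<Rightarrow> nat \<Rightarrow> dfm" ("_\<langle>_\<rangle>" [100, 0] 100) where
  "\<phi>\<langle>x\<rangle> \<equiv> app \<phi> [x]"

abbreviation app2 :: "fm \<Rightarrow> nat \<Rightarrow> nat \<Rightarrow> dfm" ("_\<langle>_,/ _\<rangle>" [100, 0, 0] 100) where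
  "\<phi>\<langle>x, y\<rangle> \<equiv> app \<phi> [x, y]"

abbreviation app3 :: "fm \<Rightarrow> nat \<Rightarrow> nat \<Rightarrow> nat \<Rightarrow> dfm" ("_\<langle>_,/ _,/ _\<rangle>" [100, 0, 0, 0] 100) where
  "\<phi>\<langle>x, y, z\<rangle> \<equiv> app \<phi> [x, y, z]"


section \<open>Basic set-theoretic notions\<close>

definition is_subset :: "nat \<Rightarrow> nat \<Rightarrow> dfm" (infix "\<^bold>\<subseteq>" 55) where
  "(x \<^bold>\<subseteq> y) = (\<^bold>\<forall>z. z \<^bold>\<in> x \<^bold>\<longrightarrow> z \<^bold>\<in> y)"

definition is_empty :: "nat \<Rightarrow> dfm" where
  "is_empty x = (\<^bold>\<forall>z. \<^bold>\<not> z \<^bold>\<in> x)"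

text \<open>\<open>y = x \<union> {x}\<close>\<close>

definition is_succ :: "nat \<Rightarrow> nat \<Rightarrow> dfm" where
  "is_succ y x = (\<^bold>\<forall>z. z \<^bold>\<in> y \<^bold>\<longleftrightarrow> z \<^bold>\<in> x \<^bold>\<or> z \<^bold>= x)"

text \<open>\<open>q = {x, y}\<close>\<close>

definition is_upair :: "nat \<Rightarrow> nat \<Rightarrow> nat \<Rightarrow> dfm" where
  "is_upair q x y = (\<^bold>\<forall>z. z \<^bold>\<in> q \<^bold>\<longleftrightarrow> z \<^bold>= x \<^bold>\<or> z \<^bold>= y)"

text \<open>\<open>p = (x, y) = {{x}, {x, y}}\<close>\<close>

definition is_pair :: "nat \<Rightarrow> nat \<Rightarrow> nat \<Rightarrow> dfm" where
  "is_pair p x y = (\<^bold>\<forall>q. q \<^bold>\<in> p \<^bold>\<longleftrightarrow> is_upair q x x \<^bold>\<or> is_upair q x y)"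

text \<open>\<open>(x, y) \<in> r\<close>\<close>

definition pair_in :: "nat \<Rightarrow> nat \<Rightarrow> nat \<Rightarrow> dfm" where
  "pair_in x y r = (\<^bold>\<exists>p. is_pair p x y \<^bold>\<and> p \<^bold>\<in> r)"

definition is_inductive :: "nat \<Rightarrow> dfm" where
  "is_inductive a =
     ((\<^bold>\<exists>e. is_empty e \<^bold>\<and> e \<^bold>\<in> a) \<^bold>\<and>
      (\<^bold>\<forall>x. x \<^bold>\<in> a \<^bold>\<longrightarrow> (\<^bold>\<exists>y. is_succ y x \<^bold>\<and> y \<^bold>\<in> a)))"

definition is_omega :: "nat \<Rightarrow> dfm" where
  "is_omega w = (is_inductive w \<^bold>\<and> (\<^bold>\<forall>b. is_inductive b \<^bold>\<longrightarrow> w \<^bold>\<subseteq> b))"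

definition is_nat :: "nat \<Rightarrow> dfm" where
  "is_nat m = (\<^bold>\<exists>w. is_omega w \<^bold>\<and> m \<^bold>\<in> w)"

text \<open>\<open>d = {1, \<dots>, m}\<close>, for a von Neumann numeral \<open>m\<close>\<close>

definition is_segment :: "nat \<Rightarrow> nat \<Rightarrow> dfm" where
  "is_segment d m = (\<^bold>\<forall>k. k \<^bold>\<in> d \<^bold>\<longleftrightarrow> (k \<^bold>\<in> m \<^bold>\<or> k \<^bold>= m) \<^bold>\<and> (\<^bold>\<not> is_empty k))"

definition is_function :: "nat \<Rightarrow> nat \<Rightarrow> nat \<Rightarrow> dfm" where
  "is_function f d a =
     ((\<^bold>\<forall>p. p \<^bold>\<in> f \<^bold>\<longrightarrow> (\<^bold>\<exists>x. \<^bold>\<exists>y. is_pair p x y \<^bold>\<and> x \<^bold>\<in> d \<^bold>\<and> y \<^bold>\<in> a)) \<^bold>\<and>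
      (\<^bold>\<forall>x. x \<^bold>\<in> d \<^bold>\<longrightarrow>
         (\<^bold>\<exists>y. pair_in x y f \<^bold>\<and> (\<^bold>\<forall>z. pair_in x z f \<^bold>\<longrightarrow> z \<^bold>= y))))"

definition is_surjection :: "nat \<Rightarrow> nat \<Rightarrow> nat \<Rightarrow> dfm" where
  "is_surjection f d a =
     (is_function f d a \<^bold>\<and> (\<^bold>\<forall>y. y \<^bold>\<in> a \<^bold>\<longrightarrow> (\<^bold>\<exists>x. x \<^bold>\<in> d \<^bold>\<and> pair_in x y f)))"

definition is_finite :: "nat \<Rightarrow> dfm" where
  "is_finite a =
     (\<^bold>\<exists>m. \<^bold>\<exists>d. \<^bold>\<exists>f. is_nat m \<^bold>\<and> is_segment d m \<^bold>\<and> is_surjection f d a)"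


section \<open>Constructive Zermelo--Fraenkel set theory\<close>

text \<open>Bounded (\<open>\<Delta>\<^sub>0\<close>) formulas: all quantifiers are of the form \<open>\<forall>x\<in>y\<close> or \<open>\<exists>x\<in>y\<close>, where \<open>y\<close> is a
  variable different from \<open>x\<close>.\<close>

inductive bounded :: "fm \<Rightarrow> bool" where
  "bounded (Mem x y)"
| "bounded (Eq x y)"
| "bounded Falsum"
| "bounded \<phi> \<Longrightarrow> bounded \<psi> \<Longrightarrow> bounded (Conj \<phi> \<psi>)"
| "bounded \<phi> \<Longrightarrow> bounded \<psi> \<Longrightarrow> bounded (Disj \<phi> \<psi>)"
| "bounded \<phi> \<Longrightarrow> bounded \<psi> \<Longrightarrow> bounded (Imp \<phi> \<psi>)"
| "bounded \<phi> \<Longrightarrow> bounded (All (Imp (Mem 0 (Suc y)) \<phi>))"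
| "bounded \<phi> \<Longrightarrow> bounded (Ex (Conj (Mem 0 (Suc y)) \<phi>))"

definition extensionality :: dfm where
  "extensionality =
     (\<^bold>\<forall>a. \<^bold>\<forall>b. (\<^bold>\<forall>x. x \<^bold>\<in> a \<^bold>\<longleftrightarrow> x \<^bold>\<in> b) \<^bold>\<longrightarrow> a \<^bold>= b)"

definition pairing :: dfm where
  "pairing = (\<^bold>\<forall>a. \<^bold>\<forall>b. \<^bold>\<exists>c. \<^bold>\<forall>x. x \<^bold>\<in> c \<^bold>\<longleftrightarrow> x \<^bold>= a \<^bold>\<or> x \<^bold>= b)"

definition union_axiom :: dfm where
  "union_axiom = (\<^bold>\<forall>a. \<^bold>\<exists>b. \<^bold>\<forall>x. x \<^bold>\<in> b \<^bold>\<longleftrightarrow> (\<^bold>\<exists>y. y \<^bold>\<in> a \<^bold>\<and> x \<^bold>\<in> y))"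

definition infinity :: dfm where
  "infinity = (\<^bold>\<exists>w. is_omega w)"

definition set_induction :: "fm \<Rightarrow> dfm" where
  "set_induction \<phi> =
     ((\<^bold>\<forall>a. (\<^bold>\<forall>x. x \<^bold>\<in> a \<^bold>\<longrightarrow> \<phi>\<langle>x\<rangle>) \<^bold>\<longrightarrow> \<phi>\<langle>a\<rangle>) \<^bold>\<longrightarrow> (\<^bold>\<forall>a. \<phi>\<langle>a\<rangle>))"

definition separation :: "fm \<Rightarrow> dfm" where
  "separation \<phi> = (\<^bold>\<forall>a. \<^bold>\<exists>b. \<^bold>\<forall>x. x \<^bold>\<in> b \<^bold>\<longleftrightarrow> x \<^bold>\<in> a \<^bold>\<and> \<phi>\<langle>x\<rangle>)"

definition strong_collection :: "fm \<Rightarrow> dfm" where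
  "strong_collection \<phi> =
     (\<^bold>\<forall>a. (\<^bold>\<forall>x. x \<^bold>\<in> a \<^bold>\<longrightarrow> (\<^bold>\<exists>y. \<phi>\<langle>x, y\<rangle>)) \<^bold>\<longrightarrow>
        (\<^bold>\<exists>b. (\<^bold>\<forall>x. x \<^bold>\<in> a \<^bold>\<longrightarrow> (\<^bold>\<exists>y. y \<^bold>\<in> b \<^bold>\<and> \<phi>\<langle>x, y\<rangle>)) \<^bold>\<and>
             (\<^bold>\<forall>y. y \<^bold>\<in> b \<^bold>\<longrightarrow> (\<^bold>\<exists>x. x \<^bold>\<in> a \<^bold>\<and> \<phi>\<langle>x, y\<rangle>))))"

definition subset_collection :: "fm \<Rightarrow> dfm" where
  "subset_collection \<phi> =
     (\<^bold>\<forall>a. \<^bold>\<forall>b. \<^bold>\<exists>c. \<^bold>\<forall>u.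
        (\<^bold>\<forall>x. x \<^bold>\<in> a \<^bold>\<longrightarrow> (\<^bold>\<exists>y. y \<^bold>\<in> b \<^bold>\<and> \<phi>\<langle>x, y, u\<rangle>)) \<^bold>\<longrightarrow>
        (\<^bold>\<exists>d. d \<^bold>\<in> c \<^bold>\<and>
             (\<^bold>\<forall>x. x \<^bold>\<in> a \<^bold>\<longrightarrow> (\<^bold>\<exists>y. y \<^bold>\<in> d \<^bold>\<and> \<phi>\<langle>x, y, u\<rangle>)) \<^bold>\<and>
             (\<^bold>\<forall>y. y \<^bold>\<in> d \<^bold>\<longrightarrow> (\<^bold>\<exists>x. x \<^bold>\<in> a \<^bold>\<and> \<phi>\<langle>x, y, u\<rangle>))))"

definition czf_axioms :: "fm set" where
  "czf_axioms =
     {extensionality 0, pairing 0, union_axiom 0, infinity 0} \<union>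
     {set_induction \<phi> 0 | \<phi>. True} \<union>
     {separation \<phi> 0 | \<phi>. bounded \<phi>} \<union>
     {strong_collection \<phi> 0 | \<phi>. True} \<union>
     {subset_collection \<phi> 0 | \<phi>. True}"

text \<open>The sentences obtained from the axioms by universally quantifying the parameters.\<close>

definition CZF :: "fm set" where
  "CZF = {(All ^^ k) \<phi> | k \<phi>. \<phi> \<in> czf_axioms \<and> free_vars ((All ^^ k) \<phi>) = {}}"


section \<open>Set-generated classes, SGA and finitary NID\<close>

text \<open>A class is given by a formula with a distinguished variable, represented as a function of this
  variable.\<close>

definition set_generated :: "(nat \<Rightarrow> dfm) \<Rightarrow> dfm" where
  "set_generated X =
     (\<^bold>\<exists>G. (\<^bold>\<forall>\<beta>. \<beta> \<^bold>\<in> G \<^bold>\<longrightarrow> X \<beta>) \<^bold>\<and>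
        (\<^bold>\<forall>\<alpha>. X \<alpha> \<^bold>\<longrightarrow> (\<^bold>\<forall>s. s \<^bold>\<in> \<alpha> \<^bold>\<longrightarrow>
           (\<^bold>\<exists>\<beta>. \<beta> \<^bold>\<in> G \<^bold>\<and> s \<^bold>\<in> \<beta> \<^bold>\<and> \<beta> \<^bold>\<subseteq> \<alpha>))))"

definition strongly_set_generated :: "(nat \<Rightarrow> dfm) \<Rightarrow> dfm" where
  "strongly_set_generated X =
     (\<^bold>\<exists>G. (\<^bold>\<forall>\<beta>. \<beta> \<^bold>\<in> G \<^bold>\<longrightarrow> X \<beta>) \<^bold>\<and>
        (\<^bold>\<forall>\<alpha>. X \<alpha> \<^bold>\<longrightarrow> (\<^bold>\<forall>\<sigma>. is_finite \<sigma> \<^bold>\<and> \<sigma> \<^bold>\<subseteq> \<alpha> \<^bold>\<longrightarrow>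
           (\<^bold>\<exists>\<beta>. \<beta> \<^bold>\<in> G \<^bold>\<and> \<sigma> \<^bold>\<subseteq> \<beta> \<^bold>\<and> \<beta> \<^bold>\<subseteq> \<alpha>))))"

text \<open>\<open>\<alpha> \<in> M(Z)\<close>\<close>

definition in_M :: "nat \<Rightarrow> nat \<Rightarrow> nat \<Rightarrow> dfm" where
  "in_M S Z \<alpha> =
     (\<alpha> \<^bold>\<subseteq> S \<^bold>\<and>
      (\<^bold>\<forall>\<sigma>. \<^bold>\<forall>\<Gamma>. pair_in \<sigma> \<Gamma> Z \<^bold>\<longrightarrow>
         \<sigma> \<^bold>\<subseteq> \<alpha> \<^bold>\<longrightarrow> (\<^bold>\<exists>U. U \<^bold>\<in> \<Gamma> \<^bold>\<and> U \<^bold>\<subseteq> \<alpha>)))"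

definition SGA :: dfm where
  "SGA =
     (\<^bold>\<forall>S. \<^bold>\<forall>Z.
        (\<^bold>\<forall>p. p \<^bold>\<in> Z \<^bold>\<longrightarrow> (\<^bold>\<exists>\<sigma>. \<^bold>\<exists>\<Gamma>. is_pair p \<sigma> \<Gamma> \<^bold>\<and>
           is_finite \<sigma> \<^bold>\<and> \<sigma> \<^bold>\<subseteq> S \<^bold>\<and> (\<^bold>\<forall>U. U \<^bold>\<in> \<Gamma> \<^bold>\<longrightarrow> U \<^bold>\<subseteq> S))) \<^bold>\<longrightarrow>
        strongly_set_generated (in_M S Z))"

definition is_finitary_rule :: "nat \<Rightarrow> nat \<Rightarrow> dfm" where
  "is_finitary_rule X r =
     (\<^bold>\<exists>a. \<^bold>\<exists>b. is_pair r a b \<^bold>\<and> is_finite a \<^bold>\<and> a \<^bold>\<subseteq> X \<^bold>\<and> b \<^bold>\<subseteq> X)"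

definition closed_under :: "nat \<Rightarrow> nat \<Rightarrow> dfm" where
  "closed_under Y r =
     (\<^bold>\<forall>a. \<^bold>\<forall>b. is_pair r a b \<^bold>\<longrightarrow> a \<^bold>\<subseteq> Y \<^bold>\<longrightarrow> (\<^bold>\<exists>z. z \<^bold>\<in> b \<^bold>\<and> z \<^bold>\<in> Y))"

definition finitary_NID :: dfm where
  "finitary_NID =
     (\<^bold>\<forall>X. \<^bold>\<forall>R. (\<^bold>\<forall>r. r \<^bold>\<in> R \<^bold>\<longrightarrow> is_finitary_rule X r) \<^bold>\<longrightarrow>
        set_generated (\<lambda>Y. Y \<^bold>\<subseteq> X \<^bold>\<and> (\<^bold>\<forall>r. r \<^bold>\<in> R \<^bold>\<longrightarrow> closed_under Y r)))"

end

theory Submission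
  imports Defs "HOL-Library.Countable" "HOL-Library.Nat_Bijection"
begin

text \<open>
  Working inside Kripke models replaces derivations by semantic arguments: the prime Henkin theories
  containing CZF form a Kripke model in which only theorems of CZF are forced everywhere. In a
  world, existential quantifiers and disjunctions can be read classically; implications, negations
  and universal quantifiers refer to all later worlds.

  A class closed under finitary rules \<open>(a, b)\<close> is \<open>M(Z)\<close> for the set \<open>Z\<close> of the pairs
  \<open>(a, {{y} | y \<in> b})\<close>, so SGA implies finitary NID. Conversely, let \<open>C\<close> be a set of subsets of
  \<open>S\<close> containing all finite ones and all \<open>U \<in> \<Gamma>\<close> for \<open>(\<sigma>, \<Gamma>) \<in> Z\<close>. Add to \<open>S\<close> a tag \<open>t\<^sub>U\<close>
  for every \<open>U \<in> C\<close> and consider the rules \<open>(\<sigma>, {t\<^sub>U | U \<in> \<Gamma>})\<close> for \<open>(\<sigma>, \<Gamma>) \<in> Z\<close> and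
  \<open>({t\<^sub>U}, {s})\<close> for \<open>s \<in> U\<close>. If \<open>\<beta>\<close> is closed, then \<open>\<beta> \<inter> S \<in> M(Z)\<close>; if \<open>\<alpha> \<in> M(Z)\<close>, then
  \<open>\<alpha> \<union> {t\<^sub>U | U \<subseteq> \<alpha>}\<close> is closed. A closed \<open>\<beta>\<close> below the latter with \<open>t\<^sub>\<sigma> \<in> \<beta>\<close> contains all of
  \<open>\<sigma>\<close>, and so generation at the single point \<open>t\<^sub>\<sigma>\<close> becomes strong generation at \<open>\<sigma>\<close>.
\<close>

text \<open>The tags settle a mismatch: a finitary rule asks for one point of \<open>b\<close>,
  whereas a member of \<open>Z\<close> asks for inclusion of a whole \<open>U\<close>. A tag makes
  \<open>U\<close> a single point, and the rules \<open>({t}, {s})\<close> unfold this point into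
  \<open>U\<close> again. The enlarged carrier has to be a set although CZF has no power set axiom,
  so only the subsets that matter are tagged: the members of the \<Gamma>, which strong collection
  and union gather, and the finite subsets of \<open>S\<close>, which subset collection provides.
  Two properties of tags carry the argument: no tag is an element of \<open>S\<close>, and a tag
  determines its \<open>U\<close>. The unordered pair \<open>{S, U}\<close> has both without coding
  a disjoint sum, the first one by foundation, which comes from set induction. Since \<alpha>
  extended by tags is cut out of this set by an inclusion, bounded separation is enough to form it.
  A strong generating family for M(Z) is obtained by dropping the tags again.

  Equality of the object theory is a congruence of the model and not identity, and pairing is a
  relation. Hence two decompositions of one pair agree only up to \<open>eq\<close>, and many steps
  below move between such decompositions.\<close>

instance fm :: countable
  by countable_datatype

section \<open>Renaming and structural properties of derivations\<close>

lemma rename_cong: "(\<And>k. k \<in> free_vars \<phi> \<Longrightarrow> r k = s k) \<Longrightarrow> rename r \<phi> = rename s \<phi>"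
proof (induction \<phi> arbitrary: r s)
  case (All \<phi>)
  show ?case
    using All.prems by (auto intro!: All.IH split: nat.split)
next
  case (Ex \<phi>)
  show ?case
    using Ex.prems by (auto intro!: Ex.IH split: nat.split)
next
  case (Conj \<phi> \<psi>)
  then show ?case by (metis UnCI free_vars.simps(4) rename.simps(4))
next
  case (Disj \<phi> \<psi>)
  then show ?case by (metis UnCI free_vars.simps(5) rename.simps(5))
next
  case (Imp \<phi> \<psi>)
  then show ?case by (metis UnCI free_vars.simps(6) rename.simps(6))
qed auto

lemma lift_comp:
  "case_nat 0 (\<lambda>k. Suc (r k)) \<circ> case_nat 0 (\<lambda>k. Suc (s k)) = case_nat 0 (\<lambda>k. Suc ((r \<circ> s) k))"
  by (auto split: nat.split)

lemma rename_rename: "rename r (rename s \<phi>) = rename (r \<circ> s) \<phi>"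
  by (induction \<phi> arbitrary: r s) (simp_all only: rename.simps lift_comp o_apply)

lemma rename_id: "rename (\<lambda>k. k) \<phi> = \<phi>"
proof (induction \<phi>)
  case (All \<phi>)
  have "case_nat 0 Suc = (\<lambda>k. k)" by (auto split: nat.split)
  with All show ?case by simp
next
  case (Ex \<phi>)
  have "case_nat 0 Suc = (\<lambda>k. k)" by (auto split: nat.split)
  with Ex show ?case by simp
qed auto

lemma free_vars_lift_image:
  "{k. Suc k \<in> case_nat 0 (\<lambda>k. Suc (r k)) ` A} = r ` {k. Suc k \<in> A}"
proof -
  have "Suc k \<in> case_nat 0 (\<lambda>k. Suc (r k)) ` A \<longleftrightarrow> (\<exists>j. Suc j \<in> A \<and> k = r j)" for k
  proof
    assume "Suc k \<in> case_nat 0 (\<lambda>k. Suc (r k)) ` A"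
    then obtain i where "i \<in> A" "Suc k = case_nat 0 (\<lambda>k. Suc (r k)) i" by blast
    then show "\<exists>j. Suc j \<in> A \<and> k = r j" by (cases i) auto
  next
    assume "\<exists>j. Suc j \<in> A \<and> k = r j"
    then obtain j where "Suc j \<in> A" "k = r j" by blast
    then show "Suc k \<in> case_nat 0 (\<lambda>k. Suc (r k)) ` A"
      by (intro image_eqI[of _ _ "Suc j"]) auto
  qed
  then show ?thesis by blast
qed

lemma free_vars_rename: "free_vars (rename r \<phi>) = r ` free_vars \<phi>"
  by (induction \<phi> arbitrary: r) (simp_all only: free_vars.simps rename.simps free_vars_lift_image image_Un, simp_all)

lemma finite_free_vars: "finite (free_vars \<phi>)"
proof (induction \<phi>)
  case (All \<phi>)
  then show ?case using finite_vimageI[of "free_vars \<phi>" Suc] by (simp add: vimage_def)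
next
  case (Ex \<phi>)
  then show ?case using finite_vimageI[of "free_vars \<phi>" Suc] by (simp add: vimage_def)
qed auto

lemma rename_inst: "rename r (inst t \<phi>) = inst (r t) (rename (case_nat 0 (\<lambda>k. Suc (r k))) \<phi>)"
  unfolding inst_def rename_rename by (rule rename_cong) (auto split: nat.split)

lemma inst_rename_lift: "inst t (rename (case_nat 0 (\<lambda>k. Suc (r k))) \<phi>) = rename (case_nat t r) \<phi>"
  unfolding inst_def rename_rename by (rule rename_cong) (auto split: nat.split)

lemma rename_lift_Suc:
  "rename (case_nat 0 (\<lambda>k. Suc (r k))) (rename Suc \<phi>) = rename Suc (rename r \<phi>)"
  unfolding rename_rename by (rule rename_cong) auto

lemma rename_lift_Suc_image:
  "rename (case_nat 0 (\<lambda>k. Suc (r k))) ` rename Suc ` \<Gamma> = rename Suc ` rename r ` \<Gamma>"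
  by (simp add: image_image rename_lift_Suc)

lemma derives_mono: "\<Gamma> \<turnstile> \<phi> \<Longrightarrow> \<Gamma> \<subseteq> \<Delta> \<Longrightarrow> \<Delta> \<turnstile> \<phi>"
proof (induction arbitrary: \<Delta> rule: derives.induct)
  case (Assm \<phi> \<Gamma>) then show ?case by (auto intro: derives.Assm)
next
  case (FalsumE \<Gamma> \<phi>) then show ?case by (auto intro: derives.FalsumE)
next
  case (DisjE \<Gamma> \<phi> \<psi> \<chi>)
  then show ?case by (meson derives.DisjE insert_mono)
next
  case (ImpI \<phi> \<Gamma> \<psi>)
  then show ?case by (meson derives.ImpI insert_mono)
next
  case (AllI \<Gamma> \<phi>)
  then show ?case by (meson derives.AllI image_mono)
next
  case (ExE \<Gamma> \<phi> \<psi>)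
  then show ?case by (meson derives.ExE image_mono insert_mono)
next
  case (ExI \<Gamma> t \<phi>)
  then show ?case by (meson derives.ExI)
next
  case (AllE \<Gamma> \<phi> t)
  then show ?case by (meson derives.AllE)
next
  case (EqE \<Gamma> s t \<phi>)
  then show ?case by (meson derives.EqE)
next
  case (ImpE \<Gamma> \<phi> \<psi>)
  then show ?case by (meson derives.ImpE)
next
  case (ConjE1 \<Gamma> \<phi> \<psi>)
  then show ?case by (meson derives.ConjE1)
next
  case (ConjE2 \<Gamma> \<phi> \<psi>)
  then show ?case by (meson derives.ConjE2)
qed (simp_all add: derives.ConjI derives.DisjI1 derives.DisjI2 derives.EqI)

lemma derives_rename: "\<Gamma> \<turnstile> \<phi> \<Longrightarrow> rename r ` \<Gamma> \<turnstile> rename r \<phi>"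
proof (induction arbitrary: r rule: derives.induct)
  case (Assm \<phi> \<Gamma>) then show ?case by (auto intro: derives.Assm)
next
  case (FalsumE \<Gamma> \<phi>) then show ?case by (auto intro: derives.FalsumE)
next
  case (ConjI \<Gamma> \<phi> \<psi>) then show ?case by (auto intro: derives.ConjI)
next
  case (ConjE1 \<Gamma> \<phi> \<psi>) then show ?case by (metis derives.ConjE1 rename.simps(4))
next
  case (ConjE2 \<Gamma> \<phi> \<psi>) then show ?case by (metis derives.ConjE2 rename.simps(4))
next
  case (DisjI1 \<Gamma> \<phi> \<psi>) then show ?case by (auto intro: derives.DisjI1)
next
  case (DisjI2 \<Gamma> \<psi> \<phi>) then show ?case by (auto intro: derives.DisjI2)
next
  case (DisjE \<Gamma> \<phi> \<psi> \<chi>)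
  show ?case
    using DisjE.IH[of r] unfolding rename.simps image_insert by (rule derives.DisjE)
next
  case (ImpI \<phi> \<Gamma> \<psi>)
  then show ?case by (metis derives.ImpI image_insert rename.simps(6))
next
  case (ImpE \<Gamma> \<phi> \<psi>)
  then show ?case by (metis derives.ImpE rename.simps(6))
next
  case (AllI \<Gamma> \<phi>)
  show ?case
    using AllI.IH[of "case_nat 0 (\<lambda>k. Suc (r k))"]
    by (auto intro!: derives.AllI simp: rename_lift_Suc_image)
next
  case (AllE \<Gamma> \<phi> t)
  then show ?case by (metis derives.AllE rename.simps(7) rename_inst)
next
  case (ExI \<Gamma> t \<phi>)
  then show ?case by (metis derives.ExI rename.simps(8) rename_inst)
next
  case (ExE \<Gamma> \<phi> \<psi>)
  have "rename r ` \<Gamma> \<turnstile> Ex (rename (case_nat 0 (\<lambda>k. Suc (r k))) \<phi>)"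
    using ExE.IH(1)[of r] by simp
  moreover have "insert (rename (case_nat 0 (\<lambda>k. Suc (r k))) \<phi>) (rename Suc ` rename r ` \<Gamma>)
      \<turnstile> rename Suc (rename r \<psi>)"
    using ExE.IH(2)[of "case_nat 0 (\<lambda>k. Suc (r k))"]
    by (simp only: image_insert rename_lift_Suc_image rename_lift_Suc)
  ultimately show ?case by (rule derives.ExE)
next
  case (EqI \<Gamma> t) then show ?case by (auto intro: derives.EqI)
next
  case (EqE \<Gamma> s t \<phi>)
  then show ?case by (metis derives.EqE rename.simps(2) rename_inst)
qed

text \<open>A derivation uses finitely many assumptions; under \<open>AllI\<close> and
  \<open>ExE\<close> a finite set of shifted assumptions is pulled back along
  \<open>rename Suc\<close>. This is what lets underivability pass to the union of a chain of
  theories.\<close>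

lemma derives_compact: "\<Gamma> \<turnstile> \<phi> \<Longrightarrow> \<exists>F\<subseteq>\<Gamma>. finite F \<and> F \<turnstile> \<phi>"
proof (induction rule: derives.induct)
  case (Assm \<phi> \<Gamma>)
  then show ?case by (intro exI[of _ "{\<phi>}"]) (auto intro: derives.Assm)
next
  case (FalsumE \<Gamma> \<phi>) then show ?case by (meson derives.FalsumE)
next
  case (ConjI \<Gamma> \<phi> \<psi>)
  then obtain F G where "F \<subseteq> \<Gamma>" "finite F" "F \<turnstile> \<phi>" "G \<subseteq> \<Gamma>" "finite G" "G \<turnstile> \<psi>" by blast
  then show ?case
    by (intro exI[of _ "F \<union> G"]) (auto intro!: derives.ConjI intro: derives_mono)
next
  case (ConjE1 \<Gamma> \<phi> \<psi>) then show ?case by (meson derives.ConjE1)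
next
  case (ConjE2 \<Gamma> \<phi> \<psi>) then show ?case by (meson derives.ConjE2)
next
  case (DisjI1 \<Gamma> \<phi> \<psi>) then show ?case by (meson derives.DisjI1)
next
  case (DisjI2 \<Gamma> \<psi> \<phi>) then show ?case by (meson derives.DisjI2)
next
  case (DisjE \<Gamma> \<phi> \<psi> \<chi>)
  then obtain F G H where *: "F \<subseteq> \<Gamma>" "finite F" "F \<turnstile> Disj \<phi> \<psi>"
      "G \<subseteq> insert \<phi> \<Gamma>" "finite G" "G \<turnstile> \<chi>" "H \<subseteq> insert \<psi> \<Gamma>" "finite H" "H \<turnstile> \<chi>"
    by blast
  let ?K = "F \<union> (G - {\<phi>}) \<union> (H - {\<psi>})"
  have "?K \<turnstile> \<chi>"
  proof (rule derives.DisjE)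
    show "?K \<turnstile> Disj \<phi> \<psi>" by (rule derives_mono[OF *(3)]) auto
    show "insert \<phi> ?K \<turnstile> \<chi>" by (rule derives_mono[OF *(6)]) auto
    show "insert \<psi> ?K \<turnstile> \<chi>" by (rule derives_mono[OF *(9)]) auto
  qed
  with * show ?case by (intro exI[of _ ?K]) auto
next
  case (ImpI \<phi> \<Gamma> \<psi>)
  then obtain F where *: "F \<subseteq> insert \<phi> \<Gamma>" "finite F" "F \<turnstile> \<psi>" by blast
  have "F - {\<phi>} \<turnstile> Imp \<phi> \<psi>"
    by (rule derives.ImpI, rule derives_mono[OF *(3)]) auto
  with * show ?case by (intro exI[of _ "F - {\<phi>}"]) auto
next
  case (ImpE \<Gamma> \<phi> \<psi>)
  then obtain F G where *: "F \<subseteq> \<Gamma>" "finite F" "F \<turnstile> Imp \<phi> \<psi>" "G \<subseteq> \<Gamma>" "finite G" "G \<turnstile> \<phi>" by blast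
  have "F \<union> G \<turnstile> \<psi>"
    by (rule derives.ImpE[of _ \<phi>]; rule derives_mono) (use * in auto)
  with * show ?case by (intro exI[of _ "F \<union> G"]) auto
next
  case (AllI \<Gamma> \<phi>)
  then obtain F where *: "F \<subseteq> rename Suc ` \<Gamma>" "finite F" "F \<turnstile> \<phi>" by blast
  then obtain G where "G \<subseteq> \<Gamma>" "finite G" "F = rename Suc ` G" by (meson finite_subset_image)
  with * show ?case by (intro exI[of _ G]) (auto intro: derives.AllI)
next
  case (AllE \<Gamma> \<phi> t) then show ?case by (meson derives.AllE)
next
  case (ExI \<Gamma> t \<phi>) then show ?case by (meson derives.ExI)
next
  case (ExE \<Gamma> \<phi> \<psi>)
  then obtain F G where *: "F \<subseteq> \<Gamma>" "finite F" "F \<turnstile> Ex \<phi>"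
      "G \<subseteq> insert \<phi> (rename Suc ` \<Gamma>)" "finite G" "G \<turnstile> rename Suc \<psi>"
    by blast
  then have "G - {\<phi>} \<subseteq> rename Suc ` \<Gamma>" "finite (G - {\<phi>})" by auto
  then obtain H where H: "H \<subseteq> \<Gamma>" "finite H" "G - {\<phi>} = rename Suc ` H" by (meson finite_subset_image)
  have "F \<union> H \<turnstile> \<psi>"
    by (rule derives.ExE[of _ \<phi>]; rule derives_mono) (use * H in auto)
  with * H show ?case by (intro exI[of _ "F \<union> H"]) auto
next
  case (EqI \<Gamma> t) then show ?case by (meson derives.EqI empty_subsetI finite.emptyI)
next
  case (EqE \<Gamma> s t \<phi>)
  then obtain F G where *: "F \<subseteq> \<Gamma>" "finite F" "F \<turnstile> Eq s t" "G \<subseteq> \<Gamma>" "finite G" "G \<turnstile> inst s \<phi>" by blast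
  have "F \<union> G \<turnstile> inst t \<phi>"
    by (rule derives.EqE[of _ s]; rule derives_mono) (use * in auto)
  with * show ?case by (intro exI[of _ "F \<union> G"]) auto
qed

lemma derives_cut: "\<Gamma> \<turnstile> \<psi> \<Longrightarrow> insert \<psi> \<Gamma> \<turnstile> \<phi> \<Longrightarrow> \<Gamma> \<turnstile> \<phi>"
  by (meson derives.ImpI derives.ImpE)

text \<open>The renaming sends \<open>c\<close> to \<open>0\<close> and shifts everything else. It
  turns a named constant \<open>c\<close> that is fresh for a formula into the variable
  \<open>0\<close> that \<open>AllI\<close> and \<open>ExE\<close> treat as the
  eigenvariable.\<close>

lemma rename_fresh_Suc:
  "c \<notin> free_vars \<phi> \<Longrightarrow> rename (\<lambda>k. if k = c then 0 else Suc k) \<phi> = rename Suc \<phi>"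
  by (rule rename_cong) auto

lemma rename_fresh_inst:
  "c \<notin> free_vars (All \<chi>) \<Longrightarrow> rename (\<lambda>k. if k = c then 0 else Suc k) (inst c \<chi>) = \<chi>"
  unfolding inst_def rename_rename
  by (subst (2) rename_id[symmetric], rule rename_cong) (auto split: nat.split)

lemma rename_fresh_image:
  "c \<notin> \<Union>(free_vars ` \<Gamma>) \<Longrightarrow> rename (\<lambda>k. if k = c then 0 else Suc k) ` \<Gamma> = rename Suc ` \<Gamma>"
  by (rule image_cong) (auto intro: rename_fresh_Suc)

lemma derives_AllI_fresh:
  assumes "\<Gamma> \<turnstile> inst c \<phi>" "c \<notin> \<Union>(free_vars ` \<Gamma>)" "c \<notin> free_vars (All \<phi>)"
  shows "\<Gamma> \<turnstile> All \<phi>"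
  using derives_rename[OF assms(1), of "\<lambda>k. if k = c then 0 else Suc k"]
  unfolding rename_fresh_inst[OF assms(3)] rename_fresh_image[OF assms(2)] by (rule derives.AllI)

lemma derives_ExE_fresh:
  assumes "\<Gamma> \<turnstile> Ex \<chi>" "insert (inst c \<chi>) \<Gamma> \<turnstile> \<phi>"
    and "c \<notin> \<Union>(free_vars ` \<Gamma>)" "c \<notin> free_vars (Ex \<chi>)" "c \<notin> free_vars \<phi>"
  shows "\<Gamma> \<turnstile> \<phi>"
proof (rule derives.ExE[OF assms(1)])
  show "insert \<chi> (rename Suc ` \<Gamma>) \<turnstile> rename Suc \<phi>"
    using derives_rename[OF assms(2), of "\<lambda>k. if k = c then 0 else Suc k"] assms(3-5)
    by (simp add: rename_fresh_image rename_fresh_inst rename_fresh_Suc)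
qed

text \<open>Truth in the structure with one element and empty membership, where quantifiers are
  vacuous. It gives the consistency of pure logic, and with it a world even if \<open>CZF\<close> is
  inconsistent.\<close>

primrec truth_value :: "fm \<Rightarrow> bool" where
  "truth_value (Mem x y) = False"
| "truth_value (Eq x y) = True"
| "truth_value Falsum = False"
| "truth_value (Conj \<phi> \<psi>) = (truth_value \<phi> \<and> truth_value \<psi>)"
| "truth_value (Disj \<phi> \<psi>) = (truth_value \<phi> \<or> truth_value \<psi>)"
| "truth_value (Imp \<phi> \<psi>) = (truth_value \<phi> \<longrightarrow> truth_value \<psi>)"
| "truth_value (All \<phi>) = truth_value \<phi>"
| "truth_value (Ex \<phi>) = truth_value \<phi>"

lemma truth_value_rename [simp]: "truth_value (rename r \<phi>) = truth_value \<phi>"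
  by (induction \<phi> arbitrary: r) auto

lemma derives_consistent: "\<not> {} \<turnstile> Falsum"
proof -
  have "\<Gamma> \<turnstile> \<phi> \<Longrightarrow> \<forall>\<psi>\<in>\<Gamma>. truth_value \<psi> \<Longrightarrow> truth_value \<phi>" for \<Gamma> \<phi>
    by (induction rule: derives.induct) (auto simp: inst_def)
  then show ?thesis by fastforce
qed


section \<open>The canonical Kripke model\<close>

text \<open>Every level adds infinitely many variables, which serve as Henkin constants.\<close>

definition vars :: "nat \<Rightarrow> nat set" where
  "vars n = {k. fst (prod_decode k) \<le> n}"

definition fms :: "nat \<Rightarrow> fm set" where
  "fms n = {\<phi>. free_vars \<phi> \<subseteq> vars n}"

lemma vars_mono: "m \<le> n \<Longrightarrow> vars m \<subseteq> vars n"
  by (auto simp: vars_def)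

lemma fms_mono: "m \<le> n \<Longrightarrow> fms m \<subseteq> fms n"
  using vars_mono by (fastforce simp: fms_def)

lemma infinite_new_vars: "infinite (vars (Suc n) - vars n)"
proof -
  have "range (\<lambda>i. prod_encode (Suc n, i)) \<subseteq> vars (Suc n) - vars n"
    by (auto simp: vars_def)
  moreover have "inj (\<lambda>i. prod_encode (Suc n, i))"
    by (auto intro!: injI simp: prod_encode_eq)
  ultimately show ?thesis
    by (meson finite_subset finite_imageD infinite_UNIV_nat)
qed

section \<open>Prime theories and the Lindenbaum construction\<close>

definition prime_theory :: "nat \<Rightarrow> fm set \<Rightarrow> bool" where
  "prime_theory n T \<longleftrightarrow> T \<subseteq> fms n \<and> Falsum \<notin> T \<and>
     (\<forall>\<psi>\<in>fms n. T \<turnstile> \<psi> \<longrightarrow> \<psi> \<in> T) \<and>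
     (\<forall>\<phi> \<psi>. Disj \<phi> \<psi> \<in> T \<longrightarrow> \<phi> \<in> T \<or> \<psi> \<in> T) \<and>
     (\<forall>\<chi>. Ex \<chi> \<in> T \<longrightarrow> (\<exists>c\<in>vars n. inst c \<chi> \<in> T))"

lemma inst_fms: "c \<in> vars n \<Longrightarrow> Ex \<chi> \<in> fms n \<or> All \<chi> \<in> fms n \<Longrightarrow> inst c \<chi> \<in> fms n"
  by (auto simp: fms_def inst_def free_vars_rename subset_iff split: nat.splits)

text \<open>A single stage: \<psi> is added unless \<phi> would become derivable, and an existential
  formula is added together with a witness. The invariant that only finitely many variables outside
  \<open>vars n\<close> occur leaves a fresh one for the witness at every stage.\<close>

lemma prime_extension_step:
  assumes "T \<subseteq> fms (Suc n)" "\<not> T \<turnstile> \<phi>" "finite (\<Union>(free_vars ` T) - vars n)"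
  shows "\<exists>T'. (T' \<subseteq> fms (Suc n) \<and> \<not> T' \<turnstile> \<phi> \<and> finite (\<Union>(free_vars ` T') - vars n)) \<and>
    T \<subseteq> T' \<and> (\<psi> \<in> fms (Suc n) \<longrightarrow> insert \<psi> T \<turnstile> \<phi> \<or>
      \<psi> \<in> T' \<and> (\<forall>\<chi>. \<psi> = Ex \<chi> \<longrightarrow> (\<exists>c\<in>vars (Suc n). inst c \<chi> \<in> T')))"
proof (cases "\<psi> \<notin> fms (Suc n) \<or> insert \<psi> T \<turnstile> \<phi>")
  case True
  with assms show ?thesis by (intro exI[of _ T]) auto
next
  case False
  have fin: "finite (free_vars \<xi> - vars n)" for \<xi>
    using finite_free_vars by blast
  show ?thesis
  proof (cases "\<exists>\<chi>. \<psi> = Ex \<chi>")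
    case ex: True
    then obtain \<chi> where \<chi>: "\<psi> = Ex \<chi>" by blast
    let ?T = "insert \<psi> T"
    have "finite ((\<Union>(free_vars ` ?T) - vars n) \<union> free_vars \<phi>)"
      using assms(3) fin finite_free_vars by (simp add: Un_Diff)
    then have "\<exists>c\<in>vars (Suc n) - vars n. c \<notin> (\<Union>(free_vars ` ?T) - vars n) \<union> free_vars \<phi>"
      using infinite_new_vars[of n] by (meson finite_subset subsetI)
    then obtain c where c: "c \<in> vars (Suc n)" "c \<notin> \<Union>(free_vars ` ?T)" "c \<notin> free_vars \<phi>"
      by blast
    have "\<not> insert (inst c \<chi>) ?T \<turnstile> \<phi>"
      using derives_ExE_fresh[of ?T \<chi> c \<phi>] c False \<chi> by (auto intro: derives.Assm)
    moreover have "inst c \<chi> \<in> fms (Suc n)"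
      using c False \<chi> inst_fms by blast
    moreover have "finite (\<Union>(free_vars ` insert (inst c \<chi>) ?T) - vars n)"
      using assms(3) fin by (simp add: Un_Diff)
    ultimately show ?thesis
      using assms False \<chi> c by (intro exI[of _ "insert (inst c \<chi>) ?T"]) auto
  next
    case nex: False
    have "finite (\<Union>(free_vars ` insert \<psi> T) - vars n)"
      using assms(3) fin by (simp add: Un_Diff)
    with assms False nex show ?thesis
      by (intro exI[of _ "insert \<psi> T"]) auto
  qed
qed

lemma derives_Union_chain:
  fixes T :: "nat \<Rightarrow> fm set"
  assumes "\<And>i. T i \<subseteq> T (Suc i)" "(\<Union>i. T i) \<turnstile> \<phi>"
  shows "\<exists>i. T i \<turnstile> \<phi>"
proof -
  obtain F where F: "F \<subseteq> (\<Union>i. T i)" "finite F" "F \<turnstile> \<phi>"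
    using derives_compact[OF assms(2)] by blast
  have mono: "i \<le> j \<Longrightarrow> T i \<subseteq> T j" for i j
    using assms(1) by (rule lift_Suc_mono_le)
  have "\<exists>i. F \<subseteq> T i"
    using F(2,1)
  proof (induction rule: finite_induct)
    case (insert x F)
    then obtain i j where "F \<subseteq> T i" "x \<in> T j" by blast
    then have "insert x F \<subseteq> T (max i j)"
      using mono[of i "max i j"] mono[of j "max i j"] by auto
    then show ?case ..
  qed auto
  with F(3) show ?thesis by (meson derives_mono)
qed

text \<open>The theory is made maximal among those not deriving \<phi>, instead of maximal
  consistent. Primeness follows: if both disjuncts were missing, each would derive \<phi> together
  with the theory, and then so would the disjunction. The level rises by one to supply the
  witnesses.\<close>

lemma prime_extension:
  assumes "\<Gamma> \<subseteq> fms n" "\<not> \<Gamma> \<turnstile> \<phi>" "\<phi> \<in> fms n"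
  shows "\<exists>T. prime_theory (Suc n) T \<and> \<Gamma> \<subseteq> T \<and> \<phi> \<notin> T"
proof -
  define P where "P T \<longleftrightarrow> T \<subseteq> fms (Suc n) \<and> \<not> T \<turnstile> \<phi> \<and> finite (\<Union>(free_vars ` T) - vars n)" for T
  define Q where "Q i T T' \<longleftrightarrow> T \<subseteq> T' \<and> (from_nat i \<in> fms (Suc n) \<longrightarrow> insert (from_nat i) T \<turnstile> \<phi> \<or>
      from_nat i \<in> T' \<and> (\<forall>\<chi>. from_nat i = Ex \<chi> \<longrightarrow> (\<exists>c\<in>vars (Suc n). inst c \<chi> \<in> T')))"
    for i :: nat and T T'
  have "\<Union>(free_vars ` \<Gamma>) - vars n = {}"
    using assms(1) by (auto simp: fms_def)
  moreover have "\<Gamma> \<subseteq> fms (Suc n)"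
    using assms(1) fms_mono[of n "Suc n"] by auto
  ultimately have P\<Gamma>: "P \<Gamma>"
    using assms(2) unfolding P_def by (simp only: finite.emptyI simp_thms)
  \<comment> \<open>Stage \<open>i\<close> treats the formula with code \<open>i\<close>; the
    conjunct about \<open>i = 0\<close> fixes the start of the chain.\<close>
  have "\<exists>T. \<forall>i. (P (T i) \<and> (i = 0 \<longrightarrow> T i = \<Gamma>)) \<and> Q i (T i) (T (Suc i))"
  proof (rule dependent_nat_choice[of "\<lambda>i T. P T \<and> (i = 0 \<longrightarrow> T = \<Gamma>)" Q])
    fix T and i :: nat
    assume "P T \<and> (i = 0 \<longrightarrow> T = \<Gamma>)"
    then show "\<exists>T'. (P T' \<and> (Suc i = 0 \<longrightarrow> T' = \<Gamma>)) \<and> Q i T T'"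
      using prime_extension_step[of T n \<phi> "from_nat i"] unfolding P_def Q_def by simp
  qed (use P\<Gamma> in auto)
  then obtain T where T: "\<And>i. P (T i)" "T 0 = \<Gamma>" "\<And>i. Q i (T i) (T (Suc i))" by blast
  let ?T = "\<Union>i. T i"
  have not\<phi>: "\<not> ?T \<turnstile> \<phi>"
    using derives_Union_chain[of T \<phi>] T unfolding P_def Q_def by blast
  have max: "\<psi> \<in> ?T \<and> (\<forall>\<chi>. \<psi> = Ex \<chi> \<longrightarrow> (\<exists>c\<in>vars (Suc n). inst c \<chi> \<in> ?T))"
    if "\<psi> \<in> fms (Suc n)" "\<not> insert \<psi> ?T \<turnstile> \<phi>" for \<psi>
  proof -
    \<comment> \<open>The stage that treats \<psi> has fewer assumptions than the union, so \<psi>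
      was accepted there.\<close>
    have "\<not> insert \<psi> (T (to_nat \<psi>)) \<turnstile> \<phi>"
      using that(2) derives_mono[of "insert \<psi> (T (to_nat \<psi>))" \<phi> "insert \<psi> ?T"] by blast
    then show ?thesis
      using T(3)[of "to_nat \<psi>"] that(1) unfolding Q_def from_nat_to_nat by blast
  qed
  have sub: "?T \<subseteq> fms (Suc n)"
    using T(1) unfolding P_def by blast
  have closed: "\<psi> \<in> ?T" if "\<psi> \<in> fms (Suc n)" "?T \<turnstile> \<psi>" for \<psi>
    using max that not\<phi> derives_cut by blast
  have disj: "\<xi> \<in> ?T \<or> \<psi> \<in> ?T" if "Disj \<xi> \<psi> \<in> ?T" for \<xi> \<psi>
  proof (rule ccontr)
    assume "\<not> (\<xi> \<in> ?T \<or> \<psi> \<in> ?T)"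
    moreover have "Disj \<xi> \<psi> \<in> fms (Suc n)"
      using that sub by blast
    then have "\<xi> \<in> fms (Suc n)" "\<psi> \<in> fms (Suc n)"
      by (auto simp: fms_def)
    ultimately have "insert \<xi> ?T \<turnstile> \<phi>" "insert \<psi> ?T \<turnstile> \<phi>" using max by blast+
    then show False using that not\<phi> derives.DisjE derives.Assm by blast
  qed
  have ex: "\<exists>c\<in>vars (Suc n). inst c \<chi> \<in> ?T" if "Ex \<chi> \<in> ?T" for \<chi>
  proof -
    have "Ex \<chi> \<in> fms (Suc n)" "\<not> insert (Ex \<chi>) ?T \<turnstile> \<phi>"
      using that sub not\<phi> by (blast, simp add: insert_absorb)
    then show ?thesis using max by blast
  qed
  have "Falsum \<notin> ?T"
    using not\<phi> derives.FalsumE[OF derives.Assm] by blast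
  then have "prime_theory (Suc n) ?T"
    unfolding prime_theory_def using sub closed disj ex by (intro conjI ballI allI impI)
  moreover have "\<Gamma> \<subseteq> ?T" using T(2) by blast
  moreover have "\<phi> \<notin> ?T" using not\<phi> derives.Assm by blast
  ultimately show ?thesis by blast
qed

lemma CZF_fms: "CZF \<subseteq> fms n"
  by (auto simp: CZF_def fms_def)

text \<open>All worlds contain \<open>CZF\<close>. The case that \<open>CZF\<close> is inconsistent, where the theorem is trivial, is only
  included because a type must not be empty.\<close>

typedef world = "{(n, T). prime_theory n T \<and> (\<not> CZF \<turnstile> Falsum \<longrightarrow> CZF \<subseteq> T)}"
proof (cases "CZF \<turnstile> Falsum")
  case True
  then show ?thesis
    using prime_extension[of "{}" 0 Falsum] derives_consistent by (auto simp: fms_def)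
next
  case False
  then show ?thesis
    using prime_extension[of CZF 0 Falsum] CZF_fms False by (auto simp: fms_def)
qed

definition level :: "world \<Rightarrow> nat" where
  "level w = fst (Rep_world w)"

definition theory_of :: "world \<Rightarrow> fm set" where
  "theory_of w = snd (Rep_world w)"

lemma prime_theory_of: "prime_theory (level w) (theory_of w)"
  using Rep_world[of w] by (auto simp: level_def theory_of_def)

lemma CZF_theory_of: "\<not> CZF \<turnstile> Falsum \<Longrightarrow> CZF \<subseteq> theory_of w"
  using Rep_world[of w] by (auto simp: theory_of_def)

lemma world_exists:
  assumes "prime_theory n T" "CZF \<subseteq> T \<or> CZF \<turnstile> Falsum"
  shows "\<exists>w. level w = n \<and> theory_of w = T"
proof -
  have "Rep_world (Abs_world (n, T)) = (n, T)"
    using assms by (intro Abs_world_inverse) auto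
  then show ?thesis
    by (intro exI[of _ "Abs_world (n, T)"]) (simp add: level_def theory_of_def)
qed

lemma world_extends:
  assumes "prime_theory n T" "theory_of w \<subseteq> T"
  shows "\<exists>v. level v = n \<and> theory_of v = T"
  using world_exists[OF assms(1)] CZF_theory_of assms(2) by blast

definition world_le :: "world \<Rightarrow> world \<Rightarrow> bool" where
  "world_le w v \<longleftrightarrow> level w \<le> level v \<and> theory_of w \<subseteq> theory_of v"


section \<open>Logical connectives in the worlds\<close>

lemma theory_of_fms: "\<phi> \<in> theory_of w \<Longrightarrow> \<phi> \<in> fms (level w)"
  using prime_theory_of[of w] by (auto simp: prime_theory_def)

lemma theory_of_closed: "theory_of w \<turnstile> \<psi> \<Longrightarrow> \<psi> \<in> fms (level w) \<Longrightarrow> \<psi> \<in> theory_of w"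
  using prime_theory_of[of w] by (auto simp: prime_theory_def)

lemma fms_simps [simp]:
  "Mem x y \<in> fms n \<longleftrightarrow> x \<in> vars n \<and> y \<in> vars n"
  "Eq x y \<in> fms n \<longleftrightarrow> x \<in> vars n \<and> y \<in> vars n"
  "Falsum \<in> fms n"
  "Conj \<phi> \<psi> \<in> fms n \<longleftrightarrow> \<phi> \<in> fms n \<and> \<psi> \<in> fms n"
  "Disj \<phi> \<psi> \<in> fms n \<longleftrightarrow> \<phi> \<in> fms n \<and> \<psi> \<in> fms n"
  "Imp \<phi> \<psi> \<in> fms n \<longleftrightarrow> \<phi> \<in> fms n \<and> \<psi> \<in> fms n"
  by (auto simp: fms_def)

lemma theory_of_Conj:
  "Conj \<phi> \<psi> \<in> theory_of w \<longleftrightarrow> \<phi> \<in> theory_of w \<and> \<psi> \<in> theory_of w"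
proof
  assume a: "Conj \<phi> \<psi> \<in> theory_of w"
  then have "\<phi> \<in> fms (level w)" "\<psi> \<in> fms (level w)" using theory_of_fms by fastforce+
  with a show "\<phi> \<in> theory_of w \<and> \<psi> \<in> theory_of w"
    by (meson derives.Assm derives.ConjE1 derives.ConjE2 theory_of_closed)
next
  assume a: "\<phi> \<in> theory_of w \<and> \<psi> \<in> theory_of w"
  then have "Conj \<phi> \<psi> \<in> fms (level w)" using theory_of_fms by auto
  with a show "Conj \<phi> \<psi> \<in> theory_of w"
    by (meson derives.Assm derives.ConjI theory_of_closed)
qed

lemma theory_of_Disj:
  assumes "Disj \<phi> \<psi> \<in> fms (level w)"
  shows "Disj \<phi> \<psi> \<in> theory_of w \<longleftrightarrow> \<phi> \<in> theory_of w \<or> \<psi> \<in> theory_of w"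
  using prime_theory_of[of w] assms derives.Assm derives.DisjI1 derives.DisjI2
  unfolding prime_theory_def by meson

text \<open>If the implication is missing, the theory with \<phi> added does not derive \<psi>, and
  \<open>prime_extension\<close> yields a later world that contains \<phi> but not \<psi>.\<close>

lemma theory_of_Imp:
  assumes "Imp \<phi> \<psi> \<in> fms (level w)"
  shows "Imp \<phi> \<psi> \<in> theory_of w \<longleftrightarrow>
    (\<forall>v. world_le w v \<longrightarrow> \<phi> \<in> theory_of v \<longrightarrow> \<psi> \<in> theory_of v)"
proof (intro iffI allI impI)
  fix v assume a: "Imp \<phi> \<psi> \<in> theory_of w" "world_le w v" "\<phi> \<in> theory_of v"
  then have "Imp \<phi> \<psi> \<in> theory_of v" by (auto simp: world_le_def)
  with a show "\<psi> \<in> theory_of v"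
    by (metis derives.Assm derives.ImpE fms_simps(6) theory_of_closed theory_of_fms)
next
  assume a: "\<forall>v. world_le w v \<longrightarrow> \<phi> \<in> theory_of v \<longrightarrow> \<psi> \<in> theory_of v"
  show "Imp \<phi> \<psi> \<in> theory_of w"
  proof (rule ccontr)
    assume "Imp \<phi> \<psi> \<notin> theory_of w"
    then have "\<not> insert \<phi> (theory_of w) \<turnstile> \<psi>"
      using assms derives.ImpI theory_of_closed by blast
    moreover have "insert \<phi> (theory_of w) \<subseteq> fms (level w)"
      using assms theory_of_fms by auto
    ultimately obtain T where T: "prime_theory (Suc (level w)) T"
        "insert \<phi> (theory_of w) \<subseteq> T" "\<psi> \<notin> T"
      using prime_extension[of "insert \<phi> (theory_of w)" "level w" \<psi>] assms by auto
    obtain v where "level v = Suc (level w)" "theory_of v = T"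
      using world_extends[OF T(1)] T(2) by blast
    with a T(2,3) show False by (force simp: world_le_def)
  qed
qed

lemma theory_of_Ex:
  assumes "Ex \<phi> \<in> fms (level w)"
  shows "Ex \<phi> \<in> theory_of w \<longleftrightarrow> (\<exists>d\<in>vars (level w). inst d \<phi> \<in> theory_of w)"
  using prime_theory_of[of w] assms derives.Assm derives.ExI
  unfolding prime_theory_def by meson

text \<open>A missing universal formula has an underivable instance at a variable \<open>c\<close>
  that is new to the level of \<open>w\<close>. This instance belongs to the language of the next
  level, and \<open>prime_extension\<close> adds one more level, so the refuting world lies two
  levels up.\<close>

lemma theory_of_All:
  assumes "All \<phi> \<in> fms (level w)"
  shows "All \<phi> \<in> theory_of w \<longleftrightarrow>
    (\<forall>v. world_le w v \<longrightarrow> (\<forall>d\<in>vars (level v). inst d \<phi> \<in> theory_of v))"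
proof (intro iffI allI impI ballI)
  fix v d assume a: "All \<phi> \<in> theory_of w" "world_le w v" "d \<in> vars (level v)"
  then have "All \<phi> \<in> theory_of v" by (auto simp: world_le_def)
  with a show "inst d \<phi> \<in> theory_of v"
    by (meson derives.Assm derives.AllE inst_fms theory_of_closed theory_of_fms)
next
  assume a: "\<forall>v. world_le w v \<longrightarrow> (\<forall>d\<in>vars (level v). inst d \<phi> \<in> theory_of v)"
  let ?n = "level w"
  show "All \<phi> \<in> theory_of w"
  proof (rule ccontr)
    assume notin: "All \<phi> \<notin> theory_of w"
    have "vars (Suc ?n) - vars ?n \<noteq> {}"
      using infinite_new_vars[of ?n] by fastforce
    then obtain c where c: "c \<in> vars (Suc ?n)" "c \<notin> vars ?n"
      by blast
    have sub: "theory_of w \<subseteq> fms ?n" using theory_of_fms by blast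
    have fresh: "c \<notin> \<Union>(free_vars ` theory_of w)" "c \<notin> free_vars (All \<phi>)"
      using c sub assms by (auto simp: fms_def)
    then have "\<not> theory_of w \<turnstile> inst c \<phi>"
      using notin assms derives_AllI_fresh[OF _ fresh] theory_of_closed[of w "All \<phi>"] by blast
    moreover have "theory_of w \<subseteq> fms (Suc ?n)"
      using sub fms_mono[of ?n "Suc ?n"] by auto
    moreover have "inst c \<phi> \<in> fms (Suc ?n)"
      using assms c fms_mono[of ?n "Suc ?n"] by (meson inst_fms le_SucI order_refl subsetD)
    ultimately obtain T where T: "prime_theory (Suc (Suc ?n)) T" "theory_of w \<subseteq> T" "inst c \<phi> \<notin> T"
      using prime_extension by blast
    obtain v where "level v = Suc (Suc ?n)" "theory_of v = T"
      using world_extends[OF T(1,2)] by blast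
    moreover have "c \<in> vars (Suc (Suc ?n))"
      using c vars_mono[of "Suc ?n" "Suc (Suc ?n)"] by auto
    ultimately show False
      using a T(2,3) by (force simp: world_le_def)
  qed
qed

text \<open>Equality is only a congruence: in the canonical model, distinct variables can be equal
  in a theory, and later worlds may add equations. Atoms relate only elements that already exist in
  the world.\<close>

locale kripke =
  fixes le :: "'w \<Rightarrow> 'w \<Rightarrow> bool" (infix "\<sqsubseteq>" 50)
    and D :: "'w \<Rightarrow> 'e \<Rightarrow> bool"
    and mem eq :: "'w \<Rightarrow> 'e \<Rightarrow> 'e \<Rightarrow> bool"
  assumes le_refl [simp, intro]: "w \<sqsubseteq> w"
    and le_trans: "u \<sqsubseteq> v \<Longrightarrow> v \<sqsubseteq> w \<Longrightarrow> u \<sqsubseteq> w"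
    and D_mono: "D w x \<Longrightarrow> w \<sqsubseteq> v \<Longrightarrow> D v x"
    and mem_mono: "mem w x y \<Longrightarrow> w \<sqsubseteq> v \<Longrightarrow> mem v x y"
    and eq_mono: "eq w x y \<Longrightarrow> w \<sqsubseteq> v \<Longrightarrow> eq v x y"
    and mem_D: "mem w x y \<Longrightarrow> D w x \<and> D w y"
    and eq_D: "eq w x y \<Longrightarrow> D w x \<and> D w y"
    and eq_refl: "D w x \<Longrightarrow> eq w x x"
    and eq_sym: "eq w x y \<Longrightarrow> eq w y x"
    and eq_trans: "eq w x y \<Longrightarrow> eq w y z \<Longrightarrow> eq w x z"
    and mem_cong: "eq w x x' \<Longrightarrow> eq w y y' \<Longrightarrow> mem w x y \<Longrightarrow> mem w x' y'"
begin

primrec forces :: "'w \<Rightarrow> (nat \<Rightarrow> 'e) \<Rightarrow> fm \<Rightarrow> bool" where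
  "forces w e (Mem x y) = mem w (e x) (e y)"
| "forces w e (Eq x y) = eq w (e x) (e y)"
| "forces w e Falsum = False"
| "forces w e (Conj \<phi> \<psi>) = (forces w e \<phi> \<and> forces w e \<psi>)"
| "forces w e (Disj \<phi> \<psi>) = (forces w e \<phi> \<or> forces w e \<psi>)"
| "forces w e (Imp \<phi> \<psi>) = (\<forall>v. w \<sqsubseteq> v \<longrightarrow> forces v e \<phi> \<longrightarrow> forces v e \<psi>)"
| "forces w e (All \<phi>) = (\<forall>v. w \<sqsubseteq> v \<longrightarrow> (\<forall>d. D v d \<longrightarrow> forces v (case_nat d e) \<phi>))"
| "forces w e (Ex \<phi>) = (\<exists>d. D w d \<and> forces w (case_nat d e) \<phi>)"

end

section \<open>The canonical model and the truth lemma\<close>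

interpretation canonical: kripke world_le "\<lambda>w x. x \<in> vars (level w)"
  "\<lambda>w x y. Mem x y \<in> theory_of w" "\<lambda>w x y. Eq x y \<in> theory_of w"
proof
  show "world_le w w" for w by (simp add: world_le_def)
  show "world_le u v \<Longrightarrow> world_le v w \<Longrightarrow> world_le u w" for u v w
    unfolding world_le_def by (meson le_trans subset_trans)
  show "x \<in> vars (level w) \<Longrightarrow> world_le w v \<Longrightarrow> x \<in> vars (level v)" for w v x
    unfolding world_le_def using vars_mono by blast
  show "Mem x y \<in> theory_of w \<Longrightarrow> world_le w v \<Longrightarrow> Mem x y \<in> theory_of v"
    and "Eq x y \<in> theory_of w \<Longrightarrow> world_le w v \<Longrightarrow> Eq x y \<in> theory_of v" for w v x y
    unfolding world_le_def by blast+
  show "Mem x y \<in> theory_of w \<Longrightarrow> x \<in> vars (level w) \<and> y \<in> vars (level w)"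
    and eqD: "Eq x y \<in> theory_of w \<Longrightarrow> x \<in> vars (level w) \<and> y \<in> vars (level w)" for w x y
    using theory_of_fms[of "Mem x y" w] theory_of_fms[of "Eq x y" w] by simp_all
  show refl: "x \<in> vars (level w) \<Longrightarrow> Eq x x \<in> theory_of w" for w x
    by (auto intro: theory_of_closed derives.EqI)
  \<comment> \<open>Apart from reflexivity, the calculus offers only substitution for equality.
    Symmetry, transitivity and congruence for \<open>Mem\<close> come from formulas in which the
    variable \<open>0\<close> marks the place to be replaced.\<close>
  have subst: "inst y \<phi> \<in> theory_of w"
    if "Eq x y \<in> theory_of w" "inst x \<phi> \<in> theory_of w" "inst y \<phi> \<in> fms (level w)" for w x y \<phi>
    using that by (meson derives.Assm derives.EqE theory_of_closed)
  show sym: "Eq y x \<in> theory_of w" if "Eq x y \<in> theory_of w" for w x y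
    using subst[of x y w "Eq 0 (Suc x)"] that eqD refl by (auto simp: inst_def)
  show "Eq x z \<in> theory_of w" if "Eq x y \<in> theory_of w" "Eq y z \<in> theory_of w" for w x y z
    using subst[of y z w "Eq (Suc x) 0"] that eqD by (auto simp: inst_def)
  show "Mem x' y' \<in> theory_of w"
    if "Eq x x' \<in> theory_of w" "Eq y y' \<in> theory_of w" "Mem x y \<in> theory_of w" for w x x' y y'
    using subst[of x x' w "Mem 0 (Suc y)"] subst[of y y' w "Mem (Suc x') 0"] that eqD[of _ _ w]
    by (auto simp: inst_def)
qed

text \<open>Induction on the formula with the clauses for \<open>theory_of\<close>. The hypothesis
  says that the free variables are interpreted by elements present in the world, so that
  \<open>rename e \<phi>\<close> belongs to its language.\<close>

lemma canonical_forces: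
  "e ` free_vars \<phi> \<subseteq> vars (level w) \<Longrightarrow>
    canonical.forces w e \<phi> \<longleftrightarrow> rename e \<phi> \<in> theory_of w"
proof (induction \<phi> arbitrary: w e)
  case Falsum
  then show ?case using prime_theory_of[of w] by (simp add: prime_theory_def)
next
  case (Conj \<phi> \<psi>)
  then show ?case by (simp add: theory_of_Conj image_Un)
next
  case (Disj \<phi> \<psi>)
  then have "rename e (Disj \<phi> \<psi>) \<in> fms (level w)" by (simp add: fms_def free_vars_rename image_Un)
  with Disj show ?case by (simp add: theory_of_Disj image_Un)
next
  case (Imp \<phi> \<psi>)
  then have "rename e (Imp \<phi> \<psi>) \<in> fms (level w)" by (simp add: fms_def free_vars_rename image_Un)
  moreover have "e ` free_vars \<phi> \<subseteq> vars (level v)" "e ` free_vars \<psi> \<subseteq> vars (level v)"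
    if "world_le w v" for v
    using Imp.prems vars_mono that by (fastforce simp: world_le_def)+
  ultimately show ?case using Imp.IH by (simp add: theory_of_Imp)
next
  case (All \<phi>)
  then have "rename e (All \<phi>) \<in> fms (level w)" by (auto simp: fms_def free_vars_rename simp del: rename.simps)
  moreover have "case_nat d e ` free_vars \<phi> \<subseteq> vars (level v)"
    if "world_le w v" "d \<in> vars (level v)" for v d
    using All.prems vars_mono that by (fastforce simp: world_le_def split: nat.splits)
  ultimately show ?case using All.IH by (simp add: theory_of_All inst_rename_lift Ball_def)
next
  case (Ex \<phi>)
  then have "rename e (Ex \<phi>) \<in> fms (level w)" by (auto simp: fms_def free_vars_rename simp del: rename.simps)
  moreover have "case_nat d e ` free_vars \<phi> \<subseteq> vars (level w)"
    if "d \<in> vars (level w)" for d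
    using Ex.prems that by (fastforce split: nat.splits)
  ultimately show ?case using Ex.IH by (auto simp add: theory_of_Ex inst_rename_lift)
qed auto

lemma canonical_forces_sentence:
  assumes "free_vars \<phi> = {}"
  shows "canonical.forces w e \<phi> \<longleftrightarrow> \<phi> \<in> theory_of w"
proof -
  have "rename e \<phi> = rename (\<lambda>k. k) \<phi>" using assms by (intro rename_cong) auto
  then show ?thesis using canonical_forces[of e \<phi> w] assms by (simp add: rename_id)
qed

lemma canonical_forces_CZF:
  "\<not> CZF \<turnstile> Falsum \<Longrightarrow> \<phi> \<in> CZF \<Longrightarrow> canonical.forces w e \<phi>"
  using CZF_theory_of by (subst canonical_forces_sentence) (auto simp: CZF_def)

lemma canonical_completeness:
  assumes "free_vars \<phi> = {}" "\<And>w. canonical.forces w e \<phi>"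
  shows "CZF \<turnstile> \<phi>"
proof (rule ccontr)
  assume "\<not> CZF \<turnstile> \<phi>"
  then obtain T where T: "prime_theory (Suc 0) T" "CZF \<subseteq> T" "\<phi> \<notin> T"
    using prime_extension[of CZF 0 \<phi>] CZF_fms assms(1) by (auto simp: fms_def)
  obtain w where "theory_of w = T"
    using world_exists[OF T(1)] T(2) by blast
  then show False
    using assms T(3) canonical_forces_sentence by blast
qed

section \<open>Evaluation of formulas written with levels\<close>

context kripke
begin

lemma forces_cong_env:
  "(\<And>k. k \<in> free_vars \<phi> \<Longrightarrow> e k = e' k) \<Longrightarrow> forces w e \<phi> \<longleftrightarrow> forces w e' \<phi>"
proof (induction \<phi> arbitrary: w e e')
  case (Imp \<phi> \<psi>)
  have "forces v e \<phi> = forces v e' \<phi>" "forces v e \<psi> = forces v e' \<psi>" for v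
    using Imp.prems by (auto intro!: Imp.IH)
  then show ?case by simp
next
  case (All \<phi>)
  have "forces v (case_nat d e) \<phi> = forces v (case_nat d e') \<phi>" for v d
    using All.prems by (intro All.IH) (auto split: nat.split)
  then show ?case by simp
next
  case (Ex \<phi>)
  have "forces v (case_nat d e) \<phi> = forces v (case_nat d e') \<phi>" for v d
    using Ex.prems by (intro Ex.IH) (auto split: nat.split)
  then show ?case by simp
next
  case (Conj \<phi> \<psi>)
  have "forces v e \<phi> = forces v e' \<phi>" "forces v e \<psi> = forces v e' \<psi>" for v
    using Conj.prems by (auto intro!: Conj.IH)
  then show ?case by simp
next
  case (Disj \<phi> \<psi>)
  have "forces v e \<phi> = forces v e' \<phi>" "forces v e \<psi> = forces v e' \<psi>" for v
    using Disj.prems by (auto intro!: Disj.IH)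
  then show ?case by simp
qed auto

lemma forces_rename: "forces w e (rename r \<phi>) \<longleftrightarrow> forces w (e \<circ> r) \<phi>"
proof -
  have lift: "case_nat d e \<circ> case_nat 0 (\<lambda>k. Suc (r k)) = case_nat d (e \<circ> r)" for d and e :: "nat \<Rightarrow> 'e" and r
    by (auto split: nat.split)
  show ?thesis
    by (induction \<phi> arbitrary: w e r) (simp_all add: lift[unfolded comp_def] comp_def)
qed

lemma forces_All_iterate:
  assumes "forces w e ((All ^^ k) \<phi>)" "\<forall>i<k. D w (d i)"
  shows "forces w (\<lambda>i. if i < k then d i else e (i - k)) \<phi>"
  using assms
proof (induction k arbitrary: \<phi> d)
  case (Suc k)
  note IH = Suc.IH[of _ "\<lambda>i. d (Suc i)"]
  \<comment> \<open>The innermost quantifier is split off. It binds the variable \<open>0\<close>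
    and receives \<open>d 0\<close>, so the outer ones receive the values of \<open>d\<close>
    shifted by one.\<close>
  have "forces w e ((All ^^ k) (All \<phi>))"
    using Suc.prems(1) by (simp add: funpow_swap1)
  then have "forces w (\<lambda>i. if i < k then d (Suc i) else e (i - k)) (All \<phi>)"
    using Suc.prems(2) by (intro IH) auto
  then have "forces w (case_nat (d 0) (\<lambda>i. if i < k then d (Suc i) else e (i - k))) \<phi>"
    using Suc.prems(2) by auto
  moreover have "case_nat (d 0) (\<lambda>i. if i < k then d (Suc i) else e (i - k)) =
      (\<lambda>i. if i < Suc k then d i else e (i - Suc k))"
    by (auto split: nat.split)
  ultimately show ?case by simp
qed simp

text \<open>The list gives the values of the levels, the function those of the parameters.\<close>

definition assign :: "'e list \<Rightarrow> (nat \<Rightarrow> 'e) \<Rightarrow> nat \<Rightarrow> 'e" where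
  "assign xs e k = (if k < length xs then xs ! (length xs - Suc k) else e (k - length xs))"

lemma assign_level: "x < length xs \<Longrightarrow> assign xs e (length xs - Suc x) = xs ! x"
  by (auto simp: assign_def Suc_diff_Suc)

lemma assign_param: "assign xs e (length xs + k) = e k"
  by (simp add: assign_def)

lemma assign_Nil: "assign [] e = e"
  by (auto simp: assign_def)

lemma assign_snoc: "case_nat d (assign xs e) = assign (xs @ [d]) e"
proof
  fix k
  show "case_nat d (assign xs e) k = assign (xs @ [d]) e k"
    by (cases k) (auto simp: assign_def nth_append)
qed

text \<open>The depth is the length of \<open>xs\<close>, so a level is a position in
  \<open>xs\<close> and a quantifier appends its value. The simplification rules below then evaluate
  the named notation with no index arithmetic left.\<close>

definition sat :: "'w \<Rightarrow> (nat \<Rightarrow> 'e) \<Rightarrow> 'e list \<Rightarrow> dfm \<Rightarrow> bool" where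
  "sat w e xs F = forces w (assign xs e) (F (length xs))"

lemma sat_dMem [simp]:
  "x < length xs \<Longrightarrow> y < length xs \<Longrightarrow> sat w e xs (x \<^bold>\<in> y) \<longleftrightarrow> mem w (xs ! x) (xs ! y)"
  by (simp add: sat_def dMem_def assign_level)

lemma sat_dEq [simp]:
  "x < length xs \<Longrightarrow> y < length xs \<Longrightarrow> sat w e xs (x \<^bold>= y) \<longleftrightarrow> eq w (xs ! x) (xs ! y)"
  by (simp add: sat_def dEq_def assign_level)

lemma sat_dNot [simp]: "sat w e xs (\<^bold>\<not> P) \<longleftrightarrow> (\<forall>v. w \<sqsubseteq> v \<longrightarrow> \<not> sat v e xs P)"
  by (simp add: sat_def dNot_def)

lemma sat_dConj [simp]: "sat w e xs (P \<^bold>\<and> Q) \<longleftrightarrow> sat w e xs P \<and> sat w e xs Q"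
  by (simp add: sat_def dConj_def)

lemma sat_dDisj [simp]: "sat w e xs (P \<^bold>\<or> Q) \<longleftrightarrow> sat w e xs P \<or> sat w e xs Q"
  by (simp add: sat_def dDisj_def)

lemma sat_dImp [simp]:
  "sat w e xs (P \<^bold>\<longrightarrow> Q) \<longleftrightarrow> (\<forall>v. w \<sqsubseteq> v \<longrightarrow> sat v e xs P \<longrightarrow> sat v e xs Q)"
  by (simp add: sat_def dImp_def)

lemma sat_dIff [simp]:
  "sat w e xs (P \<^bold>\<longleftrightarrow> Q) \<longleftrightarrow> (\<forall>v. w \<sqsubseteq> v \<longrightarrow> (sat v e xs P \<longleftrightarrow> sat v e xs Q))"
  unfolding dIff_def by auto

lemma sat_dAll [simp]:
  "sat w e xs (dAll F) \<longleftrightarrow> (\<forall>v. w \<sqsubseteq> v \<longrightarrow> (\<forall>d. D v d \<longrightarrow> sat v e (xs @ [d]) (F (length xs))))"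
  unfolding sat_def dAll_def forces.simps assign_snoc by simp

lemma sat_dEx [simp]:
  "sat w e xs (dEx F) \<longleftrightarrow> (\<exists>d. D w d \<and> sat w e (xs @ [d]) (F (length xs)))"
  unfolding sat_def dEx_def forces.simps assign_snoc by simp

text \<open>Instances of schemata: the formula \<open>F\<close> has the values of \<open>xs\<close> as its parameters.\<close>

lemma sat_app:
  assumes "\<forall>y\<in>set ys. y < length zs" "n = length xs + length ys"
  shows "sat w (assign xs e) zs (app (F n) ys) \<longleftrightarrow> sat w e (xs @ rev (map ((!) zs) ys)) F"
proof -
  have "forces w (assign zs (assign xs e) \<circ>
      (\<lambda>k. if k < length ys then length zs - Suc (ys ! k) else length zs + (k - length ys))) (F n)
    \<longleftrightarrow> forces w (assign (xs @ rev (map ((!) zs) ys)) e) (F n)"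
  proof (rule forces_cong_env)
    fix k
    show "(assign zs (assign xs e) \<circ>
        (\<lambda>k. if k < length ys then length zs - Suc (ys ! k) else length zs + (k - length ys))) k
      = assign (xs @ rev (map ((!) zs) ys)) e k"
    proof (cases "k < length ys")
      case True
      with assms(1) show ?thesis
        by (auto simp: assign_level) (auto simp: assign_def nth_append rev_nth)
    next
      case False
      have "assign zs (assign xs e) (length zs + (k - length ys)) = assign xs e (k - length ys)"
        by (rule assign_param)
      with False show ?thesis
        by (auto simp: assign_def nth_append add.commute)
    qed
  qed
  then show ?thesis
    unfolding sat_def app_def forces_rename using assms(2) by simp
qed

section \<open>Set-theoretic notions in a Kripke model\<close>

text \<open>Comprehension as seen from \<open>w\<close>: \<open>b\<close> acts as the set of all
  \<open>x\<close> with \<open>P\<close>, now and later. Since successors, pairs, segments and the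
  sets given by the axioms all have this form, one extensionality lemma and one congruence lemma
  serve them all.\<close>

definition ext :: "'w \<Rightarrow> 'e \<Rightarrow> ('w \<Rightarrow> 'e \<Rightarrow> bool) \<Rightarrow> bool" where
  "ext w b P \<longleftrightarrow> (\<forall>v. w \<sqsubseteq> v \<longrightarrow> (\<forall>x. D v x \<longrightarrow> (mem v x b \<longleftrightarrow> P v x)))"

definition sub :: "'w \<Rightarrow> 'e \<Rightarrow> 'e \<Rightarrow> bool" where
  "sub w a b \<longleftrightarrow> (\<forall>v. w \<sqsubseteq> v \<longrightarrow> (\<forall>x. mem v x a \<longrightarrow> mem v x b))"

definition emp :: "'w \<Rightarrow> 'e \<Rightarrow> bool" where
  "emp w a \<longleftrightarrow> (\<forall>v. w \<sqsubseteq> v \<longrightarrow> (\<forall>x. \<not> mem v x a))"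

definition suc :: "'w \<Rightarrow> 'e \<Rightarrow> 'e \<Rightarrow> bool" where
  "suc w y x \<longleftrightarrow> ext w y (\<lambda>v z. mem v z x \<or> eq v z x)"

definition upr :: "'w \<Rightarrow> 'e \<Rightarrow> 'e \<Rightarrow> 'e \<Rightarrow> bool" where
  "upr w q x y \<longleftrightarrow> ext w q (\<lambda>v z. eq v z x \<or> eq v z y)"

definition pr :: "'w \<Rightarrow> 'e \<Rightarrow> 'e \<Rightarrow> 'e \<Rightarrow> bool" where
  "pr w p x y \<longleftrightarrow> ext w p (\<lambda>v q. upr v q x x \<or> upr v q x y)"

definition pin :: "'w \<Rightarrow> 'e \<Rightarrow> 'e \<Rightarrow> 'e \<Rightarrow> bool" where
  "pin w x y r \<longleftrightarrow> (\<exists>p. pr w p x y \<and> mem w p r)"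

definition ind :: "'w \<Rightarrow> 'e \<Rightarrow> bool" where
  "ind w a \<longleftrightarrow> (\<exists>z. emp w z \<and> mem w z a) \<and>
     (\<forall>v. w \<sqsubseteq> v \<longrightarrow> (\<forall>x. mem v x a \<longrightarrow> (\<exists>y. suc v y x \<and> mem v y a)))"

definition omega :: "'w \<Rightarrow> 'e \<Rightarrow> bool" where
  "omega w a \<longleftrightarrow> ind w a \<and> (\<forall>v. w \<sqsubseteq> v \<longrightarrow> (\<forall>b. D v b \<longrightarrow> ind v b \<longrightarrow> sub v a b))"

definition nat_in :: "'w \<Rightarrow> 'e \<Rightarrow> bool" where
  "nat_in w m \<longleftrightarrow> (\<exists>a. omega w a \<and> mem w m a)"

definition seg :: "'w \<Rightarrow> 'e \<Rightarrow> 'e \<Rightarrow> bool" where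
  "seg w d m \<longleftrightarrow> ext w d (\<lambda>v k. (mem v k m \<or> eq v k m) \<and> (\<forall>u. v \<sqsubseteq> u \<longrightarrow> \<not> emp u k))"

definition func :: "'w \<Rightarrow> 'e \<Rightarrow> 'e \<Rightarrow> 'e \<Rightarrow> bool" where
  "func w f d a \<longleftrightarrow>
     (\<forall>v. w \<sqsubseteq> v \<longrightarrow> (\<forall>p. mem v p f \<longrightarrow> (\<exists>x y. pr v p x y \<and> mem v x d \<and> mem v y a))) \<and>
     (\<forall>v. w \<sqsubseteq> v \<longrightarrow> (\<forall>x. mem v x d \<longrightarrow> (\<exists>y. D v y \<and> pin v x y f \<and>
        (\<forall>u. v \<sqsubseteq> u \<longrightarrow> (\<forall>z. D u z \<longrightarrow> pin u x z f \<longrightarrow> eq u z y)))))"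

definition surjection :: "'w \<Rightarrow> 'e \<Rightarrow> 'e \<Rightarrow> 'e \<Rightarrow> bool" where
  "surjection w f d a \<longleftrightarrow> func w f d a \<and>
     (\<forall>v. w \<sqsubseteq> v \<longrightarrow> (\<forall>y. mem v y a \<longrightarrow> (\<exists>x. mem v x d \<and> pin v x y f)))"

definition fin :: "'w \<Rightarrow> 'e \<Rightarrow> bool" where
  "fin w a \<longleftrightarrow> (\<exists>m d f. D w d \<and> D w f \<and> nat_in w m \<and> seg w d m \<and> surjection w f d a)"

text \<open>Each quantifier and implication contributes its own passage to a later world. This rule
  and the next ones merge these passages and absorb domain conditions implied by membership, which
  brings expanded forcing clauses into the form of the semantic definitions above.\<close>

lemma All_le_le [simp]:
  "(\<forall>v. w \<sqsubseteq> v \<longrightarrow> (\<forall>u. v \<sqsubseteq> u \<longrightarrow> P u)) \<longleftrightarrow> (\<forall>v. w \<sqsubseteq> v \<longrightarrow> P v)"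
  by (meson le_refl le_trans)

lemma All_D_le [simp]:
  "(\<forall>v. w \<sqsubseteq> v \<longrightarrow> (\<forall>x. D v x \<longrightarrow> (\<forall>u. v \<sqsubseteq> u \<longrightarrow> P u x))) \<longleftrightarrow>
   (\<forall>v. w \<sqsubseteq> v \<longrightarrow> (\<forall>x. D v x \<longrightarrow> P v x))"
  by (meson le_refl le_trans D_mono)

lemma All_mem_le [simp]:
  "(\<forall>v. w \<sqsubseteq> v \<longrightarrow> (\<forall>x. mem v x a \<longrightarrow> (\<forall>u. v \<sqsubseteq> u \<longrightarrow> P u x))) \<longleftrightarrow>
   (\<forall>v. w \<sqsubseteq> v \<longrightarrow> (\<forall>x. mem v x a \<longrightarrow> P v x))"
  by (meson le_refl le_trans mem_mono)

lemma D_imp_mem [simp]: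
  "(D v x \<longrightarrow> mem v x a \<longrightarrow> P) \<longleftrightarrow> (mem v x a \<longrightarrow> P)"
  "(D v x \<longrightarrow> mem v y x \<longrightarrow> P) \<longleftrightarrow> (mem v y x \<longrightarrow> P)"
  "(D v x \<longrightarrow> \<not> mem v x a) \<longleftrightarrow> \<not> mem v x a"
  using mem_D by blast+

lemma D_conj_mem [simp]:
  "(D v x \<and> mem v x a) \<longleftrightarrow> mem v x a"
  "(D v x \<and> mem v x a \<and> P) \<longleftrightarrow> (mem v x a \<and> P)"
  "(D v x \<and> P \<and> mem v x a) \<longleftrightarrow> (P \<and> mem v x a)"
  "(D v x \<and> P \<and> mem v x a \<and> Q) \<longleftrightarrow> (P \<and> mem v x a \<and> Q)"
  "(D v x \<and> P \<and> Q \<and> mem v x a) \<longleftrightarrow> (P \<and> Q \<and> mem v x a)"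
  "(D v x \<and> P \<and> mem v a x) \<longleftrightarrow> (P \<and> mem v a x)"
  "(D v x \<and> (\<exists>y. R y \<and> mem v x a \<and> S y)) \<longleftrightarrow> (\<exists>y. R y \<and> mem v x a \<and> S y)"
  using mem_D by blast+

lemma ext_mono: "ext w b P \<Longrightarrow> w \<sqsubseteq> v \<Longrightarrow> ext v b P"
  unfolding ext_def by (meson le_trans)

lemma sub_mono: "sub w a b \<Longrightarrow> w \<sqsubseteq> v \<Longrightarrow> sub v a b"
  unfolding sub_def by (meson le_trans)

lemma emp_mono: "emp w a \<Longrightarrow> w \<sqsubseteq> v \<Longrightarrow> emp v a"
  unfolding emp_def by (meson le_trans)

lemma upr_mono: "upr w q x y \<Longrightarrow> w \<sqsubseteq> v \<Longrightarrow> upr v q x y"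
  unfolding upr_def by (rule ext_mono)

lemma pr_mono: "pr w p x y \<Longrightarrow> w \<sqsubseteq> v \<Longrightarrow> pr v p x y"
  unfolding pr_def by (rule ext_mono)

lemma seg_mono: "seg w d m \<Longrightarrow> w \<sqsubseteq> v \<Longrightarrow> seg v d m"
  unfolding seg_def by (rule ext_mono)

lemma ind_mono: "ind w a \<Longrightarrow> w \<sqsubseteq> v \<Longrightarrow> ind v a"
  unfolding ind_def by (meson le_trans emp_mono mem_mono)

lemma func_mono: "func w f d a \<Longrightarrow> w \<sqsubseteq> v \<Longrightarrow> func v f d a"
  unfolding func_def by (meson le_trans)

lemma surjection_mono: "surjection w f d a \<Longrightarrow> w \<sqsubseteq> v \<Longrightarrow> surjection v f d a"
  unfolding surjection_def by (meson func_mono le_trans)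

lemma sat_is_subset [simp]:
  "x < length xs \<Longrightarrow> y < length xs \<Longrightarrow> sat w e xs (x \<^bold>\<subseteq> y) \<longleftrightarrow> sub w (xs ! x) (xs ! y)"
  by (simp add: is_subset_def sub_def nth_append)

lemma sat_is_empty [simp]:
  "x < length xs \<Longrightarrow> sat w e xs (is_empty x) \<longleftrightarrow> emp w (xs ! x)"
  by (simp add: is_empty_def emp_def nth_append)

lemma sat_is_succ [simp]:
  "x < length xs \<Longrightarrow> y < length xs \<Longrightarrow> sat w e xs (is_succ y x) \<longleftrightarrow> suc w (xs ! y) (xs ! x)"
  by (simp add: is_succ_def suc_def ext_def nth_append)

lemma sat_is_upair [simp]:
  "q < length xs \<Longrightarrow> x < length xs \<Longrightarrow> y < length xs \<Longrightarrow>
    sat w e xs (is_upair q x y) \<longleftrightarrow> upr w (xs ! q) (xs ! x) (xs ! y)"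
  by (simp add: is_upair_def upr_def ext_def nth_append)

lemma sat_is_pair [simp]:
  "p < length xs \<Longrightarrow> x < length xs \<Longrightarrow> y < length xs \<Longrightarrow>
    sat w e xs (is_pair p x y) \<longleftrightarrow> pr w (xs ! p) (xs ! x) (xs ! y)"
  by (simp add: is_pair_def pr_def ext_def nth_append)

lemma sat_pair_in [simp]:
  "r < length xs \<Longrightarrow> x < length xs \<Longrightarrow> y < length xs \<Longrightarrow>
    sat w e xs (pair_in x y r) \<longleftrightarrow> pin w (xs ! x) (xs ! y) (xs ! r)"
  by (simp add: pair_in_def pin_def nth_append)

lemma sat_is_inductive [simp]:
  "a < length xs \<Longrightarrow> sat w e xs (is_inductive a) \<longleftrightarrow> ind w (xs ! a)"
  by (simp add: is_inductive_def ind_def nth_append)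

lemma sat_is_omega [simp]:
  "a < length xs \<Longrightarrow> sat w e xs (is_omega a) \<longleftrightarrow> omega w (xs ! a)"
  by (simp add: is_omega_def omega_def nth_append)

lemma sat_is_nat [simp]:
  "a < length xs \<Longrightarrow> sat w e xs (is_nat a) \<longleftrightarrow> nat_in w (xs ! a)"
  by (simp add: is_nat_def nat_in_def nth_append)

lemma sat_is_segment [simp]:
  "d < length xs \<Longrightarrow> m < length xs \<Longrightarrow> sat w e xs (is_segment d m) \<longleftrightarrow> seg w (xs ! d) (xs ! m)"
  by (simp add: is_segment_def seg_def ext_def nth_append)

lemma sat_is_function [simp]:
  "f < length xs \<Longrightarrow> d < length xs \<Longrightarrow> a < length xs \<Longrightarrow>
    sat w e xs (is_function f d a) \<longleftrightarrow> func w (xs ! f) (xs ! d) (xs ! a)"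
  by (simp add: is_function_def func_def nth_append)

lemma sat_is_surjection [simp]:
  "f < length xs \<Longrightarrow> d < length xs \<Longrightarrow> a < length xs \<Longrightarrow>
    sat w e xs (is_surjection f d a) \<longleftrightarrow> surjection w (xs ! f) (xs ! d) (xs ! a)"
  by (simp add: is_surjection_def surjection_def nth_append)

lemma nat_in_D: "nat_in w m \<Longrightarrow> D w m"
  unfolding nat_in_def using mem_D by blast

lemma sat_is_finite [simp]:
  "a < length xs \<Longrightarrow> sat w e xs (is_finite a) \<longleftrightarrow> fin w (xs ! a)"
  using nat_in_D by (auto simp: is_finite_def fin_def nth_append)

section \<open>Semantic forms of SGA and finitary NID\<close>

definition set_gen :: "'w \<Rightarrow> ('w \<Rightarrow> 'e \<Rightarrow> bool) \<Rightarrow> bool" where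
  "set_gen w X \<longleftrightarrow> (\<exists>G. D w G \<and> (\<forall>v. w \<sqsubseteq> v \<longrightarrow> (\<forall>\<beta>. mem v \<beta> G \<longrightarrow> X v \<beta>)) \<and>
     (\<forall>v. w \<sqsubseteq> v \<longrightarrow> (\<forall>\<alpha>. D v \<alpha> \<longrightarrow> X v \<alpha> \<longrightarrow> (\<forall>u. v \<sqsubseteq> u \<longrightarrow> (\<forall>s. mem u s \<alpha> \<longrightarrow>
        (\<exists>\<beta>. mem u \<beta> G \<and> mem u s \<beta> \<and> sub u \<beta> \<alpha>))))))"

definition strong_set_gen :: "'w \<Rightarrow> ('w \<Rightarrow> 'e \<Rightarrow> bool) \<Rightarrow> bool" where
  "strong_set_gen w X \<longleftrightarrow> (\<exists>G. D w G \<and> (\<forall>v. w \<sqsubseteq> v \<longrightarrow> (\<forall>\<beta>. mem v \<beta> G \<longrightarrow> X v \<beta>)) \<and>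
     (\<forall>v. w \<sqsubseteq> v \<longrightarrow> (\<forall>\<alpha>. D v \<alpha> \<longrightarrow> X v \<alpha> \<longrightarrow> (\<forall>u. v \<sqsubseteq> u \<longrightarrow> (\<forall>\<sigma>. D u \<sigma> \<longrightarrow>
        fin u \<sigma> \<and> sub u \<sigma> \<alpha> \<longrightarrow> (\<exists>\<beta>. mem u \<beta> G \<and> sub u \<sigma> \<beta> \<and> sub u \<beta> \<alpha>))))))"

definition inM :: "'w \<Rightarrow> 'e \<Rightarrow> 'e \<Rightarrow> 'e \<Rightarrow> bool" where
  "inM w S Z \<alpha> \<longleftrightarrow> sub w \<alpha> S \<and> (\<forall>v. w \<sqsubseteq> v \<longrightarrow> (\<forall>\<sigma>. D v \<sigma> \<longrightarrow> (\<forall>\<Gamma>. D v \<Gamma> \<longrightarrow> pin v \<sigma> \<Gamma> Z \<longrightarrow>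
     (\<forall>u. v \<sqsubseteq> u \<longrightarrow> sub u \<sigma> \<alpha> \<longrightarrow> (\<exists>U. mem u U \<Gamma> \<and> sub u U \<alpha>)))))"

definition SGA_at :: "'w \<Rightarrow> bool" where
  "SGA_at w \<longleftrightarrow> (\<forall>v. w \<sqsubseteq> v \<longrightarrow> (\<forall>S. D v S \<longrightarrow> (\<forall>Z. D v Z \<longrightarrow>
     (\<forall>u. v \<sqsubseteq> u \<longrightarrow> (\<forall>p. mem u p Z \<longrightarrow> (\<exists>\<sigma>. D u \<sigma> \<and> (\<exists>\<Gamma>. D u \<Gamma> \<and> pr u p \<sigma> \<Gamma> \<and> fin u \<sigma> \<and> sub u \<sigma> S \<and>
        (\<forall>t. u \<sqsubseteq> t \<longrightarrow> (\<forall>U. mem t U \<Gamma> \<longrightarrow> sub t U S)))))) \<longrightarrow>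
     strong_set_gen v (\<lambda>v. inM v S Z))))"

definition finitary_rule :: "'w \<Rightarrow> 'e \<Rightarrow> 'e \<Rightarrow> bool" where
  "finitary_rule w X r \<longleftrightarrow>
     (\<exists>a. D w a \<and> (\<exists>b. D w b \<and> pr w r a b \<and> fin w a \<and> sub w a X \<and> sub w b X))"

definition closed :: "'w \<Rightarrow> 'e \<Rightarrow> 'e \<Rightarrow> bool" where
  "closed w Y r \<longleftrightarrow> (\<forall>v. w \<sqsubseteq> v \<longrightarrow> (\<forall>a. D v a \<longrightarrow> (\<forall>b. D v b \<longrightarrow> pr v r a b \<longrightarrow>
     (\<forall>u. v \<sqsubseteq> u \<longrightarrow> sub u a Y \<longrightarrow> (\<exists>z. mem u z b \<and> mem u z Y)))))"

definition closed_class :: "'w \<Rightarrow> 'e \<Rightarrow> 'e \<Rightarrow> 'e \<Rightarrow> bool" where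
  "closed_class w X R Y \<longleftrightarrow>
     sub w Y X \<and> (\<forall>v. w \<sqsubseteq> v \<longrightarrow> (\<forall>r. mem v r R \<longrightarrow> closed v Y r))"

definition NID_at :: "'w \<Rightarrow> bool" where
  "NID_at w \<longleftrightarrow> (\<forall>v. w \<sqsubseteq> v \<longrightarrow> (\<forall>X. D v X \<longrightarrow> (\<forall>R. D v R \<longrightarrow>
     (\<forall>u. v \<sqsubseteq> u \<longrightarrow> (\<forall>r. mem u r R \<longrightarrow> finitary_rule u X r)) \<longrightarrow>
     set_gen v (\<lambda>v. closed_class v X R))))"

text \<open>\<open>G\<close> occupies level \<open>length xs\<close>, so both uses of the class, for
  \<beta> and for \<alpha>, evaluate it at the next level. One equivalence for \<open>F\<close>
  therefore covers both.\<close>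

lemma sat_set_generated:
  assumes "\<And>v G x. sat v e (xs @ [G, x]) (F (Suc (length xs))) \<longleftrightarrow> X v x"
  shows "sat w e xs (set_generated F) \<longleftrightarrow> set_gen w X"
  by (simp add: set_generated_def set_gen_def nth_append assms)

lemma sat_strongly_set_generated:
  assumes "\<And>v G x. sat v e (xs @ [G, x]) (F (Suc (length xs))) \<longleftrightarrow> X v x"
  shows "sat w e xs (strongly_set_generated F) \<longleftrightarrow> strong_set_gen w X"
  by (simp add: strongly_set_generated_def strong_set_gen_def nth_append assms)

lemma sat_in_M [simp]:
  "S < length xs \<Longrightarrow> Z < length xs \<Longrightarrow> \<alpha> < length xs \<Longrightarrow>
    sat w e xs (in_M S Z \<alpha>) \<longleftrightarrow> inM w (xs ! S) (xs ! Z) (xs ! \<alpha>)"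
  by (simp add: in_M_def inM_def nth_append)

lemma sat_is_finitary_rule [simp]:
  "X < length xs \<Longrightarrow> r < length xs \<Longrightarrow>
    sat w e xs (is_finitary_rule X r) \<longleftrightarrow> finitary_rule w (xs ! X) (xs ! r)"
  by (simp add: is_finitary_rule_def finitary_rule_def nth_append)

lemma sat_closed_under [simp]:
  "Y < length xs \<Longrightarrow> r < length xs \<Longrightarrow>
    sat w e xs (closed_under Y r) \<longleftrightarrow> closed w (xs ! Y) (xs ! r)"
  by (simp add: closed_under_def closed_def nth_append)

lemma sat_SGA: "sat w e [] SGA \<longleftrightarrow> SGA_at w"
proof -
  have "sat v e [S, Z] (strongly_set_generated (in_M 0 (Suc 0))) \<longleftrightarrow> strong_set_gen v (\<lambda>v. inM v S Z)"
    for v S Z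
    by (rule sat_strongly_set_generated) simp
  then show ?thesis by (simp add: SGA_def SGA_at_def)
qed

lemma sat_finitary_NID: "sat w e [] finitary_NID \<longleftrightarrow> NID_at w"
proof -
  have "sat v e [X, R] (set_generated (\<lambda>Y. Y \<^bold>\<subseteq> 0 \<^bold>\<and> (\<^bold>\<forall>r. r \<^bold>\<in> Suc 0 \<^bold>\<longrightarrow> closed_under Y r)))
      \<longleftrightarrow> set_gen v (\<lambda>v. closed_class v X R)"
    for v X R
    by (rule sat_set_generated) (simp add: closed_class_def)
  then show ?thesis by (simp add: finitary_NID_def NID_at_def)
qed

end

section \<open>The axioms of CZF as existence principles in a model\<close>

locale czf_model = kripke le D mem eq
  for le :: "'w \<Rightarrow> 'w \<Rightarrow> bool" (infix "\<sqsubseteq>" 50)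
    and D :: "'w \<Rightarrow> 'e \<Rightarrow> bool"
    and mem eq :: "'w \<Rightarrow> 'e \<Rightarrow> 'e \<Rightarrow> bool" +
  assumes forces_CZF: "\<phi> \<in> CZF \<Longrightarrow> forces w e \<phi>"
begin

lemma free_vars_All_iterate: "free_vars ((All ^^ k) \<phi>) = {i. i + k \<in> free_vars \<phi>}"
  by (induction k) auto

text \<open>\<open>CZF\<close> contains closures of axioms. Enough quantifiers are put in front to
  bind all free variables, and they are then instantiated with the values of \<open>e\<close>
  itself.\<close>

lemma forces_czf_axiom:
  assumes "\<phi> \<in> czf_axioms" "\<forall>k. D w (e k)"
  shows "forces w e \<phi>"
proof -
  obtain k where k: "\<forall>i\<in>free_vars \<phi>. i < k"
    using finite_free_vars[of \<phi>] finite_nat_set_iff_bounded by blast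
  then have "free_vars ((All ^^ k) \<phi>) = {}"
    unfolding free_vars_All_iterate by fastforce
  then have "forces w e ((All ^^ k) \<phi>)"
    using assms(1) by (intro forces_CZF) (auto simp: CZF_def)
  then have "forces w (\<lambda>i. if i < k then e i else e (i - k)) \<phi>"
    using assms(2) by (intro forces_All_iterate) auto
  moreover have "forces w (\<lambda>i. if i < k then e i else e (i - k)) \<phi> \<longleftrightarrow> forces w e \<phi>"
    using k by (intro forces_cong_env) auto
  ultimately show ?thesis by simp
qed

lemma sat_czf_axiom:
  assumes "F 0 \<in> czf_axioms" "\<forall>k. D w (e k)"
  shows "sat w e [] F"
  using forces_czf_axiom[OF assms] by (simp add: sat_def assign_Nil)

lemma eq_of_ext:
  assumes "D w a" "D w b" "ext w a P" "ext w b P"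
  shows "eq w a b"
proof -
  have "sat w (\<lambda>_. a) [] extensionality"
    using assms by (intro sat_czf_axiom) (auto simp: czf_axioms_def)
  with assms show ?thesis
    by (auto simp: extensionality_def ext_def)
qed

lemma eq_of_sub: "D w a \<Longrightarrow> D w b \<Longrightarrow> sub w a b \<Longrightarrow> sub w b a \<Longrightarrow> eq w a b"
  by (rule eq_of_ext[of _ _ _ "\<lambda>v x. mem v x b"]) (auto simp: ext_def sub_def)

lemma ex_upr:
  assumes "D w x" "D w y"
  shows "\<exists>q. D w q \<and> upr w q x y"
proof -
  have "sat w (\<lambda>_. x) [] pairing"
    using assms by (intro sat_czf_axiom) (auto simp: czf_axioms_def)
  with assms show ?thesis
    by (fastforce simp: pairing_def upr_def ext_def)
qed

lemma ex_union:
  assumes "D w a"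
  shows "\<exists>b. D w b \<and> ext w b (\<lambda>v x. \<exists>y. mem v y a \<and> mem v x y)"
proof -
  have "sat w (\<lambda>_. a) [] union_axiom"
    using assms by (intro sat_czf_axiom) (auto simp: czf_axioms_def)
  with assms show ?thesis
    by (fastforce simp: union_axiom_def ext_def)
qed

lemma ex_omega: "D w a \<Longrightarrow> \<exists>z. D w z \<and> omega w z"
  using sat_czf_axiom[of infinity w "\<lambda>_. a"] by (simp add: czf_axioms_def infinity_def)

text \<open>The formula \<open>F\<close> certifies that \<open>P\<close> is definable, with the
  parameters listed in \<open>xs\<close>. The value \<open>a\<close> beyond the list keeps the whole
  assignment inside the domain.\<close>

lemma ex_separation:
  assumes "bounded (F (Suc (length xs)))" "D w a" "\<forall>z\<in>set xs. D w z"
    and sat: "\<And>v x. sat v (\<lambda>_. a) (xs @ [x]) F \<longleftrightarrow> P v x"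
  shows "\<exists>b. D w b \<and> ext w b (\<lambda>v x. mem v x a \<and> P v x)"
proof -
  have "sat w (assign xs (\<lambda>_. a)) [] (separation (F (length xs + 1)))"
    using assms(1-3) by (intro sat_czf_axiom) (auto simp: czf_axioms_def assign_def)
  then show ?thesis
    using assms(2)
    by (auto simp: separation_def sat_app sat ext_def)
qed

text \<open>In the schema \<open>x\<close> is variable \<open>0\<close> and \<open>y\<close> is
  variable \<open>1\<close>. As levels count from the outside, the values appear in the order
  \<open>[y, x]\<close>; likewise \<open>[u, y, x]\<close> for subset collection.\<close>

lemma ex_strong_collection:
  assumes "D w a" "\<forall>z\<in>set xs. D w z"
    and sat: "\<And>v x y. sat v (\<lambda>_. a) (xs @ [y, x]) F \<longleftrightarrow> P v x y"
    and total: "\<And>v x. w \<sqsubseteq> v \<Longrightarrow> mem v x a \<Longrightarrow> \<exists>y. D v y \<and> P v x y"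
  shows "\<exists>b. D w b \<and>
    (\<forall>v. w \<sqsubseteq> v \<longrightarrow> (\<forall>x. mem v x a \<longrightarrow> (\<exists>y. mem v y b \<and> P v x y))) \<and>
    (\<forall>v. w \<sqsubseteq> v \<longrightarrow> (\<forall>y. mem v y b \<longrightarrow> (\<exists>x. mem v x a \<and> P v x y)))"
proof -
  have "sat w (assign xs (\<lambda>_. a)) [] (strong_collection (F (length xs + 2)))"
    using assms(1,2) by (intro sat_czf_axiom) (auto simp: czf_axioms_def assign_def)
  then show ?thesis
    using assms(1) total
    by (simp add: strong_collection_def sat_app sat)
qed

lemma ex_subset_collection:
  assumes "D w a" "D w b" "\<forall>z\<in>set xs. D w z"
    and sat: "\<And>v x y u. sat v (\<lambda>_. a) (xs @ [u, y, x]) F \<longleftrightarrow> P v x y u"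
  shows "\<exists>c. D w c \<and> (\<forall>v. w \<sqsubseteq> v \<longrightarrow> (\<forall>u. D v u \<longrightarrow>
    (\<forall>t. v \<sqsubseteq> t \<longrightarrow> (\<forall>x. mem t x a \<longrightarrow> (\<exists>y. mem t y b \<and> P t x y u))) \<longrightarrow>
    (\<exists>d. mem v d c \<and>
      (\<forall>t. v \<sqsubseteq> t \<longrightarrow> (\<forall>x. mem t x a \<longrightarrow> (\<exists>y. mem t y d \<and> P t x y u))) \<and>
      (\<forall>t. v \<sqsubseteq> t \<longrightarrow> (\<forall>y. mem t y d \<longrightarrow> (\<exists>x. mem t x a \<and> P t x y u))))))"
proof -
  have "sat w (assign xs (\<lambda>_. a)) [] (subset_collection (F (length xs + 3)))"
    using assms(1,3) by (intro sat_czf_axiom) (auto simp: czf_axioms_def assign_def)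
  then show ?thesis
    using assms(1,2)
    by (simp add: subset_collection_def sat_app sat)
qed

lemma set_induct:
  assumes "D w a"
    and sat: "\<And>v x. sat v (\<lambda>_. a) [x] F \<longleftrightarrow> P v x"
    and step: "\<And>v x. w \<sqsubseteq> v \<Longrightarrow> D v x \<Longrightarrow> (\<And>u y. v \<sqsubseteq> u \<Longrightarrow> mem u y x \<Longrightarrow> P u y) \<Longrightarrow> P v x"
  shows "P w a"
proof -
  have "sat w (\<lambda>_. a) [] (set_induction (F 1))"
    using assms(1) by (intro sat_czf_axiom) (auto simp: czf_axioms_def)
  then have "sat w (assign [] (\<lambda>_. a)) [] (set_induction (F 1))"
    by (simp only: assign_Nil)
  then have "(\<forall>v. w \<sqsubseteq> v \<longrightarrow> (\<forall>x. D v x \<longrightarrow>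
      (\<forall>u. v \<sqsubseteq> u \<longrightarrow> (\<forall>y. mem u y x \<longrightarrow> P u y)) \<longrightarrow> P v x)) \<longrightarrow> P w a"
    using assms(1) by (auto simp: set_induction_def sat_app sat)
  then show ?thesis using step by blast
qed


section \<open>Pairs, finite sets and their collection\<close>

lemma ext_memD: "ext w b P \<Longrightarrow> w \<sqsubseteq> v \<Longrightarrow> mem v x b \<Longrightarrow> P v x"
  unfolding ext_def using mem_D by blast

lemma ext_memI: "ext w b P \<Longrightarrow> w \<sqsubseteq> v \<Longrightarrow> D v x \<Longrightarrow> P v x \<Longrightarrow> mem v x b"
  unfolding ext_def by blast

lemma mem_congL: "eq w x x' \<Longrightarrow> mem w x y \<Longrightarrow> mem w x' y"
  using mem_cong eq_refl mem_D by blast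

lemma mem_congR: "eq w y y' \<Longrightarrow> mem w x y \<Longrightarrow> mem w x y'"
  using mem_cong eq_refl mem_D by blast

lemma ext_cong:
  assumes "ext w a P" "eq w a b" "\<And>v x. w \<sqsubseteq> v \<Longrightarrow> D v x \<Longrightarrow> P v x \<longleftrightarrow> Q v x"
  shows "ext w b Q"
  unfolding ext_def
proof (intro allI impI)
  fix v x assume v: "w \<sqsubseteq> v" "D v x"
  have "mem v x a \<longleftrightarrow> mem v x b"
    using eq_mono[OF assms(2) v(1)] eq_sym mem_congR by blast
  then show "mem v x b \<longleftrightarrow> Q v x"
    using assms(1,3) v unfolding ext_def by blast
qed

lemma sub_trans: "sub w a b \<Longrightarrow> sub w b c \<Longrightarrow> sub w a c"
  unfolding sub_def by blast

lemma sub_memD: "sub w a b \<Longrightarrow> w \<sqsubseteq> v \<Longrightarrow> mem v x a \<Longrightarrow> mem v x b"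
  unfolding sub_def by blast

lemma sub_of_eq: "eq w a b \<Longrightarrow> sub w a b"
  unfolding sub_def using eq_mono mem_congR by blast

lemma upr_memD: "upr w q x y \<Longrightarrow> mem w z q \<Longrightarrow> eq w z x \<or> eq w z y"
  unfolding upr_def by (rule ext_memD[where P = "\<lambda>v z. eq v z x \<or> eq v z y"]) auto

lemma upr_memL: "upr w q x y \<Longrightarrow> D w x \<Longrightarrow> mem w x q"
  unfolding upr_def by (erule ext_memI) (auto intro: eq_refl)

lemma upr_memR: "upr w q x y \<Longrightarrow> D w y \<Longrightarrow> mem w y q"
  unfolding upr_def by (erule ext_memI) (auto intro: eq_refl)

lemma upr_cong:
  assumes "upr w q x y" "eq w q q'" "eq w x x'" "eq w y y'"
  shows "upr w q' x' y'"
  unfolding upr_def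
proof (rule ext_cong[OF assms(1)[unfolded upr_def] assms(2)])
  fix v z assume "w \<sqsubseteq> v"
  then have "eq v x x'" "eq v y y'" using assms(3,4) eq_mono by blast+
  then show "eq v z x \<or> eq v z y \<longleftrightarrow> eq v z x' \<or> eq v z y'"
    by (meson eq_sym eq_trans)
qed

lemma pr_cong:
  assumes "pr w p x y" "eq w p p'" "eq w x x'" "eq w y y'"
  shows "pr w p' x' y'"
  unfolding pr_def
proof (rule ext_cong[OF assms(1)[unfolded pr_def] assms(2)])
  fix v q assume v: "w \<sqsubseteq> v" "D v q"
  then have "eq v x x'" "eq v y y'" "eq v q q" using assms(3,4) eq_mono eq_refl by blast+
  then show "upr v q x x \<or> upr v q x y \<longleftrightarrow> upr v q x' x' \<or> upr v q x' y'"
    by (meson eq_sym upr_cong)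
qed

lemma upr_unique: "upr w q x y \<Longrightarrow> upr w q' x y \<Longrightarrow> D w q \<Longrightarrow> D w q' \<Longrightarrow> eq w q q'"
  unfolding upr_def by (rule eq_of_ext)

lemma pr_memD: "pr w p x y \<Longrightarrow> mem w q p \<Longrightarrow> upr w q x x \<or> upr w q x y"
  unfolding pr_def by (rule ext_memD[where P = "\<lambda>v q. upr v q x x \<or> upr v q x y"]) auto

lemma pr_memL: "pr w p x y \<Longrightarrow> D w q \<Longrightarrow> upr w q x x \<Longrightarrow> mem w q p"
  unfolding pr_def by (erule ext_memI) auto

lemma pr_memR: "pr w p x y \<Longrightarrow> D w q \<Longrightarrow> upr w q x y \<Longrightarrow> mem w q p"
  unfolding pr_def by (erule ext_memI) auto

lemma ex_pr:
  assumes "D w x" "D w y"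
  shows "\<exists>p. D w p \<and> pr w p x y"
proof -
  obtain q where q: "D w q" "upr w q x x" using ex_upr assms by blast
  obtain r where r: "D w r" "upr w r x y" using ex_upr assms by blast
  obtain p where p: "D w p" "upr w p q r" using ex_upr q r by blast
  have "pr w p x y"
    unfolding pr_def
  proof (rule ext_cong[OF p(2)[unfolded upr_def] eq_refl[OF p(1)]])
    fix v z assume v: "w \<sqsubseteq> v" "D v z"
    have *: "upr v q x x" "upr v r x y" "eq v x x" "eq v y y" "D v q" "D v r"
      using q r assms v upr_mono D_mono eq_refl by blast+
    show "eq v z q \<or> eq v z r \<longleftrightarrow> upr v z x x \<or> upr v z x y"
      using * v(2) upr_cong eq_sym upr_unique by meson
  qed
  with p show ?thesis by blast
qed

text \<open>After x = x', comparing \<open>{x, y}\<close> and \<open>{x', y'}\<close> as elements of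
  \<open>p\<close> gives y = x' or y = y', and also y' = x or y' = y. Every combination yields y =
  y'.\<close>

lemma pr_inj:
  assumes p: "pr w p x y" "pr w p x' y'" and D: "D w x" "D w y" "D w x'" "D w y'"
  shows "eq w x x'" "eq w y y'"
proof -
  obtain q where q: "D w q" "upr w q x x" using ex_upr D by blast
  have "upr w q x' x' \<or> upr w q x' y'"
    using p q pr_memL pr_memD by blast
  then have "mem w x' q" using D upr_memL by blast
  then show x: "eq w x x'" using q upr_memD eq_sym by blast
  obtain r where r: "D w r" "upr w r x y" using ex_upr D by blast
  obtain r' where r': "D w r'" "upr w r' x' y'" using ex_upr D by blast
  have "upr w r x' x' \<or> upr w r x' y'" "upr w r' x x \<or> upr w r' x y"
    using p r r' pr_memR pr_memD by blast+
  then have "(eq w y x' \<or> eq w y y')" "eq w y' x \<or> eq w y' y"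
    using r r' D upr_memD upr_memR by blast+
  with x show "eq w y y'" by (meson eq_sym eq_trans)
qed

lemma ex_binary_union:
  assumes "D w a" "D w b"
  shows "\<exists>c. D w c \<and> ext w c (\<lambda>v x. mem v x a \<or> mem v x b)"
proof -
  obtain q where q: "D w q" "upr w q a b" using ex_upr assms by blast
  obtain c where c: "D w c" "ext w c (\<lambda>v x. \<exists>y. mem v y q \<and> mem v x y)" using ex_union q by blast
  have "ext w c (\<lambda>v x. mem v x a \<or> mem v x b)"
  proof (rule ext_cong[OF c(2) eq_refl[OF c(1)]])
    fix v x assume v: "w \<sqsubseteq> v" "D v x"
    have "upr v q a b" "D v a" "D v b" using v q assms upr_mono D_mono by blast+
    then show "(\<exists>y. mem v y q \<and> mem v x y) \<longleftrightarrow> mem v x a \<or> mem v x b"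
      using upr_memD upr_memL upr_memR mem_congR by blast
  qed
  with c show ?thesis by blast
qed

lemma ex_suc:
  assumes "D w x"
  shows "\<exists>y. D w y \<and> suc w y x"
proof -
  obtain q where q: "D w q" "upr w q x x" using ex_upr assms by blast
  obtain y where y: "D w y" "ext w y (\<lambda>v z. mem v z x \<or> mem v z q)"
    using ex_binary_union assms q by blast
  have "suc w y x"
    unfolding suc_def
  proof (rule ext_cong[OF y(2) eq_refl[OF y(1)]])
    fix v z assume v: "w \<sqsubseteq> v" "D v z"
    have "upr v q x x" "D v x" using v q assms upr_mono D_mono by blast+
    then show "mem v z x \<or> mem v z q \<longleftrightarrow> mem v z x \<or> eq v z x"
      using upr_memD upr_memL mem_congL eq_sym by blast
  qed
  with y show ?thesis by blast
qed

text \<open>Set induction on \<open>x\<close>: given x \<in> y \<in> x, the induction hypothesis for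
  \<open>y\<close> is refuted by y \<in> x \<in> y. It is used to keep the tag \<open>{S, U}\<close>
  out of \<open>S\<close>.\<close>

lemma mem_asym:
  assumes "mem w x y" "mem w y x"
  shows False
proof -
  define P where "P v x \<longleftrightarrow> (\<forall>u. v \<sqsubseteq> u \<longrightarrow> (\<forall>y. mem u x y \<longrightarrow> (\<forall>t. u \<sqsubseteq> t \<longrightarrow> \<not> mem t y x)))" for v x
  have "P w x"
  proof (rule set_induct[where P = P and F = "\<^bold>\<forall>y. 0 \<^bold>\<in> y \<^bold>\<longrightarrow> (\<^bold>\<not> y \<^bold>\<in> 0)"])
    show "D w x" using assms mem_D by blast
    show "sat v (\<lambda>_. x) [z] (\<^bold>\<forall>y. 0 \<^bold>\<in> y \<^bold>\<longrightarrow> (\<^bold>\<not> y \<^bold>\<in> 0)) \<longleftrightarrow> P v z" for v z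
      by (simp add: P_def)
    show "P v z" if "\<And>u y. v \<sqsubseteq> u \<Longrightarrow> mem u y z \<Longrightarrow> P u y" for v z
      using that le_trans mem_mono unfolding P_def by (meson le_refl)
  qed
  with assms show False unfolding P_def by blast
qed

lemma emp_cong: "emp w x \<Longrightarrow> eq w x y \<Longrightarrow> emp w y"
  unfolding emp_def using eq_mono eq_sym mem_congR by blast

lemma ex_seg:
  assumes "D w m"
  shows "\<exists>d. D w d \<and> seg w d m"
proof -
  obtain s where s: "D w s" "suc w s m" using ex_suc assms by blast
  have "bounded ((\<^bold>\<not> is_empty 0) (Suc (length [])))"
    by (simp add: dNot_def is_empty_def dAll_def dMem_def bounded.intros)
  then obtain d where d: "D w d" "ext w d (\<lambda>v k. mem v k s \<and> (\<forall>u. v \<sqsubseteq> u \<longrightarrow> \<not> emp u k))"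
    using ex_separation[of "\<^bold>\<not> is_empty 0" "[]" w s "\<lambda>v k. \<forall>u. v \<sqsubseteq> u \<longrightarrow> \<not> emp u k"] s by auto
  have "seg w d m"
    unfolding seg_def by (rule ext_cong[OF d(2) eq_refl[OF d(1)]]) (use s in \<open>auto simp: suc_def ext_def\<close>)
  with d show ?thesis by blast
qed

lemma pin_cong: "pin w x y f \<Longrightarrow> eq w x x' \<Longrightarrow> eq w y y' \<Longrightarrow> pin w x' y' f"
  unfolding pin_def using pr_cong eq_refl mem_D by blast

text \<open>The witnesses are the numeral 1, its segment {1} and the function {(1, t)}.\<close>

lemma fin_singleton:
  assumes "D w t" "D w a" "upr w a t t"
  shows "fin w a"
proof -
  obtain \<omega> where \<omega>: "omega w \<omega>" using ex_omega assms(1) by blast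
  \<comment> \<open>\<open>z\<close> is 0 and \<open>m\<close> is 1 = {0}, both provided by the
    inductiveness of \<omega>.\<close>
  then obtain z m where zm: "emp w z" "mem w z \<omega>" "suc w m z" "mem w m \<omega>"
    unfolding omega_def ind_def by blast
  then have D: "D w z" "D w m" using mem_D by blast+
  obtain d where d: "D w d" "seg w d m" using ex_seg D by blast
  have zm': "mem v z m" if "w \<sqsubseteq> v" for v
    using zm(3) that D eq_refl D_mono unfolding suc_def ext_def by blast
  \<comment> \<open>A segment consists of the nonempty elements of m \<union> {m}, here {0, 1}; only
    1 remains.\<close>
  have dm: "mem v k d \<longleftrightarrow> eq v k m" if v: "w \<sqsubseteq> v" for v k
  proof
    assume k: "mem v k d"
    then have 1: "mem v k m \<or> eq v k m" "\<not> emp v k"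
      using d(2) v mem_D unfolding seg_def ext_def by blast+
    have "eq v k z" if "mem v k m"
      using that zm(1,3) v mem_D unfolding suc_def ext_def emp_def by blast
    then show "eq v k m"
      using 1 emp_cong emp_mono[OF zm(1) v] eq_sym by blast
  next
    assume k: "eq v k m"
    have "\<not> emp u k" if u: "v \<sqsubseteq> u" for u
    proof -
      have "mem u z k"
        using zm'[of u] le_trans[OF v u] eq_mono[OF k u] eq_sym mem_congR by blast
      then show ?thesis unfolding emp_def by blast
    qed
    then show "mem v k d"
      using d(2) v k eq_D unfolding seg_def ext_def by blast
  qed
  obtain p where p: "D w p" "pr w p m t" using ex_pr D assms by blast
  obtain f where f: "D w f" "upr w f p p" using ex_upr p by blast
  have md: "mem v m d" and ta: "mem v t a" and pf: "mem v p f" if "w \<sqsubseteq> v" for v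
    using that D_mono[OF D(2)] D_mono[OF assms(1)] D_mono[OF p(1)] dm eq_refl
      upr_mono[OF assms(3)] upr_mono[OF f(2)] upr_memL by blast+
  have fp: "eq v q p" if "w \<sqsubseteq> v" "mem v q f" for v q
    using that upr_mono[OF f(2)] upr_memD by blast
  have at: "eq v y t" if "w \<sqsubseteq> v" "mem v y a" for v y
    using that upr_mono[OF assms(3)] upr_memD by blast
  have pin: "pin v m t f" if "w \<sqsubseteq> v" for v
    using that pf pr_mono[OF p(2)] unfolding pin_def by blast
  have pin_unique: "eq v y t" if v: "w \<sqsubseteq> v" and y: "D v x" "D v y" "pin v x y f" for v x y
  proof -
    obtain q where q: "pr v q x y" "mem v q f" using y unfolding pin_def by blast
    then have "pr v p x y" using fp v pr_cong eq_refl y by blast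
    moreover have "pr v p m t" "D v m" "D v t" using v p D assms pr_mono D_mono by blast+
    ultimately show ?thesis using pr_inj y by blast
  qed
  have "func w f d a"
    unfolding func_def
  proof (intro conjI allI impI)
    fix v q assume v: "w \<sqsubseteq> v" "mem v q f"
    have "pr v q m t"
      using pr_cong[OF pr_mono[OF p(2) v(1)] eq_sym[OF fp[OF v]]] v(1) D assms(1) D_mono eq_refl by blast
    then show "\<exists>x y. pr v q x y \<and> mem v x d \<and> mem v y a"
      using md ta v by blast
  next
    fix v x assume v: "w \<sqsubseteq> v" "mem v x d"
    then have x: "eq v m x" using dm eq_sym by blast
    have "pin v x t f" using pin_cong[OF pin x eq_refl] v assms(1) D_mono by blast
    moreover have "eq u z t" if "v \<sqsubseteq> u" "D u z" "pin u x z f" for u z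
      using pin_unique[of u x z] that le_trans v(1) mem_D[OF v(2)] D_mono by blast
    ultimately show "\<exists>y. D v y \<and> pin v x y f \<and> (\<forall>u. v \<sqsubseteq> u \<longrightarrow> (\<forall>z. D u z \<longrightarrow> pin u x z f \<longrightarrow> eq u z y))"
      using v(1) assms(1) D_mono by blast
  qed
  moreover have "\<exists>x. mem v x d \<and> pin v x y f" if "w \<sqsubseteq> v" "mem v y a" for v y
    using pin_cong[OF pin eq_refl eq_sym[OF at]] that md mem_D by blast
  ultimately have "surjection w f d a" unfolding surjection_def by blast
  with d f \<omega> zm show ?thesis unfolding fin_def nat_in_def by blast
qed

section \<open>The set of finite subsets\<close>

lemma pin_func:
  assumes "func w f d a" "pin w x y f" "D w x" "D w y"
  shows "mem w x d" "mem w y a"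
proof -
  obtain p where p: "pr w p x y" "mem w p f" using assms unfolding pin_def by blast
  then obtain x' y' where *: "pr w p x' y'" "mem w x' d" "mem w y' a"
    using assms(1) unfolding func_def by blast
  then have "eq w x x'" "eq w y y'" using pr_inj[OF p(1) *(1)] assms mem_D by blast+
  with * show "mem w x d" "mem w y a" using eq_sym mem_congL by blast+
qed

text \<open>The segment \<open>d\<close> is quantified so that the notion depends on
  \<open>m\<close> and \<open>c\<close> only; strong collection over the numerals can then choose a
  \<open>c\<close> for each \<open>m\<close>.\<close>

definition covers :: "'w \<Rightarrow> 'e \<Rightarrow> 'e \<Rightarrow> 'e \<Rightarrow> bool" where
  "covers w S m c \<longleftrightarrow> (\<forall>v. w \<sqsubseteq> v \<longrightarrow> (\<forall>d. D v d \<longrightarrow> seg v d m \<longrightarrow>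
     (\<forall>u. v \<sqsubseteq> u \<longrightarrow> (\<forall>f. D u f \<longrightarrow> (\<forall>\<sigma>. D u \<sigma> \<longrightarrow> surjection u f d \<sigma> \<longrightarrow>
       (\<forall>t. u \<sqsubseteq> t \<longrightarrow> sub t \<sigma> S \<longrightarrow> mem t \<sigma> c))))))"

text \<open>Subset collection for the relation (x, y) \<in> u, with the function as the parameter
  \<open>u\<close>: a function from the segment onto a subset of \<open>S\<close> is total into
  \<open>S\<close>, so some member of \<open>c\<close> is exactly its image.\<close>

lemma ex_covers:
  assumes "D w S" "D w m"
  shows "\<exists>c. D w c \<and> covers w S m c"
proof -
  obtain d0 where d0: "D w d0" "seg w d0 m" using ex_seg assms by blast
  have sat: "sat v (\<lambda>_. d0) ([] @ [u, y, x]) (pair_in 2 1 0) \<longleftrightarrow> pin v x y u" for v u y x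
    by (simp add: numeral_2_eq_2)
  obtain c where c: "D w c" "\<And>v u. w \<sqsubseteq> v \<Longrightarrow> D v u \<Longrightarrow>
     (\<And>t x. v \<sqsubseteq> t \<Longrightarrow> mem t x d0 \<Longrightarrow> \<exists>y. mem t y S \<and> pin t x y u) \<Longrightarrow>
     \<exists>d. mem v d c \<and> (\<forall>t. v \<sqsubseteq> t \<longrightarrow> (\<forall>x. mem t x d0 \<longrightarrow> (\<exists>y. mem t y d \<and> pin t x y u))) \<and>
      (\<forall>t. v \<sqsubseteq> t \<longrightarrow> (\<forall>y. mem t y d \<longrightarrow> (\<exists>x. mem t x d0 \<and> pin t x y u)))"
    using ex_subset_collection[OF d0(1) assms(1) _ sat] by auto
  have "covers w S m c"
    unfolding covers_def
  proof (intro allI impI)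
    fix v d u f \<sigma> t
    assume a: "w \<sqsubseteq> v" "D v d" "seg v d m" "v \<sqsubseteq> u" "D u f" "D u \<sigma>" "surjection u f d \<sigma>"
      "u \<sqsubseteq> t" "sub t \<sigma> S"
    have le: "w \<sqsubseteq> t" "v \<sqsubseteq> t" using a le_trans by blast+
    have D: "D t f" "D t \<sigma>" "D t d" "D t d0" using a le d0 D_mono by blast+
    have sur: "surjection t f d \<sigma>" using a surjection_mono by blast
    then have fu: "func s f d \<sigma>" if "t \<sqsubseteq> s" for s using that func_mono unfolding surjection_def by blast
    \<comment> \<open>\<open>c\<close> was built from the segment \<open>d0\<close>, but
      \<open>covers\<close> allows any segment of \<open>m\<close>; extensionality identifies the
      two.\<close>
    have eq: "eq t d d0"
      using a(3) d0(2) le D seg_mono eq_of_ext unfolding seg_def by (meson ext_mono)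
    have val: "\<exists>y. mem s y \<sigma> \<and> pin s x y f \<and> (\<forall>z. D s z \<longrightarrow> pin s x z f \<longrightarrow> eq s z y)"
      if s: "t \<sqsubseteq> s" "mem s x d" for s x
    proof -
      obtain y where "D s y" "pin s x y f" "\<And>z. D s z \<Longrightarrow> pin s x z f \<Longrightarrow> eq s z y"
        using fu[OF s(1)] s(2) unfolding func_def by (meson le_refl)
      then show ?thesis using pin_func[OF fu[OF s(1)]] s mem_D by blast
    qed
    have dd0: "mem s x d \<longleftrightarrow> mem s x d0" if "t \<sqsubseteq> s" for s x
      using eq_mono[OF eq that] eq_sym mem_congR by blast
    have tot: "\<exists>y. mem s y S \<and> pin s x y f" if s: "t \<sqsubseteq> s" "mem s x d0" for s x
      using val[OF s(1)] dd0[OF s(1)] s(2) sub_memD[OF a(9) s(1)] by blast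
    obtain d' where d': "mem t d' c" "\<And>s x. t \<sqsubseteq> s \<Longrightarrow> mem s x d0 \<Longrightarrow> \<exists>y. mem s y d' \<and> pin s x y f"
        "\<And>s y. t \<sqsubseteq> s \<Longrightarrow> mem s y d' \<Longrightarrow> \<exists>x. mem s x d0 \<and> pin s x y f"
      using c(2)[OF le(1) D(1) tot] by blast
    \<comment> \<open>Both \<open>d'\<close> and \<sigma> consist of values of \<open>f\<close>.
      Uniqueness of values makes them equal, and so \<sigma> itself belongs to
      \<open>c\<close>.\<close>
    have "mem s y d'" if s: "t \<sqsubseteq> s" "mem s y \<sigma>" for s y
    proof -
      obtain x where x: "mem s x d" "pin s x y f" using sur s unfolding surjection_def by blast
      obtain y' where y': "mem s y' d'" "pin s x y' f" using d'(2) s(1) x(1) dd0 by blast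
      have "D s y" "D s y'" using s(2) y'(1) mem_D by blast+
      then have "eq s y' y" using val[OF s(1) x(1)] x(2) y'(2) eq_sym eq_trans by meson
      then show ?thesis using y' mem_congL by blast
    qed
    moreover have "mem s y \<sigma>" if s: "t \<sqsubseteq> s" "mem s y d'" for s y
      using d'(3)[OF s] pin_func(2)[OF fu[OF s(1)]] mem_D s(2) by blast
    ultimately have "eq t d' \<sigma>"
      using D(2) d'(1) mem_D by (intro eq_of_sub) (auto simp: sub_def)
    then show "mem t \<sigma> c" using d'(1) mem_congL by blast
  qed
  with c show ?thesis by blast
qed

text \<open>No recursion on the size is needed: subset collection yields the images of all functions on
  \<open>{1, \<dots>, m}\<close>, uniformly in \<open>m\<close>.\<close>

lemma ex_finite_subsets:
  assumes "D w S"
  shows "\<exists>C. D w C \<and> (\<forall>v. w \<sqsubseteq> v \<longrightarrow> (\<forall>\<tau>. mem v \<tau> C \<longrightarrow> sub v \<tau> S)) \<and>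
    (\<forall>v. w \<sqsubseteq> v \<longrightarrow> (\<forall>\<sigma>. D v \<sigma> \<longrightarrow> fin v \<sigma> \<longrightarrow> sub v \<sigma> S \<longrightarrow> mem v \<sigma> C))"
proof -
  obtain \<omega> where \<omega>: "D w \<omega>" "omega w \<omega>" using ex_omega assms by blast
  have sat: "sat v (\<lambda>_. \<omega>) ([S] @ [c, m]) (\<^bold>\<forall>d. is_segment d 2 \<^bold>\<longrightarrow> (\<^bold>\<forall>f. \<^bold>\<forall>\<sigma>. is_surjection f d \<sigma> \<^bold>\<longrightarrow>
      \<sigma> \<^bold>\<subseteq> 0 \<^bold>\<longrightarrow> \<sigma> \<^bold>\<in> 1)) \<longleftrightarrow> covers v S m c" for v c m
    by (simp add: covers_def numeral_2_eq_2)
  obtain b where b: "D w b" "\<And>v m. w \<sqsubseteq> v \<Longrightarrow> mem v m \<omega> \<Longrightarrow> \<exists>c. mem v c b \<and> covers v S m c"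
    using ex_strong_collection[OF \<omega>(1) _ sat] assms ex_covers D_mono mem_D by (auto 4 4)
  obtain C0 where C0: "D w C0" "ext w C0 (\<lambda>v x. \<exists>y. mem v y b \<and> mem v x y)" using ex_union b by blast
  \<comment> \<open>A set covering the images may also have members that are not subsets of
    \<open>S\<close>; these are separated out.\<close>
  have "bounded ((1 \<^bold>\<subseteq> 0) (Suc (length [S])))"
    by (simp add: is_subset_def dImp_def dAll_def dMem_def bounded.intros)
  then obtain C where C: "D w C" "ext w C (\<lambda>v x. mem v x C0 \<and> sub v x S)"
    using ex_separation[of "1 \<^bold>\<subseteq> 0" "[S]" w C0 "\<lambda>v x. sub v x S"] C0 assms by auto
  have "mem v \<sigma> C" if \<sigma>: "w \<sqsubseteq> v" "D v \<sigma>" "fin v \<sigma>" "sub v \<sigma> S" for v \<sigma>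
  proof -
    obtain m d f where *: "D v d" "D v f" "nat_in v m" "seg v d m" "surjection v f d \<sigma>"
      using \<sigma>(3) unfolding fin_def by blast
    \<comment> \<open>The set of numerals hidden in \<open>nat_in\<close> may be another
      representative; its minimality places it inside \<omega>.\<close>
    have "D v \<omega>" "ind v \<omega>" using \<omega> \<sigma>(1) D_mono ind_mono unfolding omega_def by blast+
    then have "mem v m \<omega>" using *(3) unfolding nat_in_def omega_def sub_def by blast
    then obtain c where c: "mem v c b" "covers v S m c" using b \<sigma>(1) by blast
    then have "mem v \<sigma> c" using * \<sigma> unfolding covers_def by blast
    then show ?thesis using c C C0 \<sigma> unfolding ext_def by blast
  qed
  moreover have "sub v \<tau> S" if "w \<sqsubseteq> v" "mem v \<tau> C" for v \<tau>
    using ext_memD[OF C(2) that] by blast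
  ultimately show ?thesis using C(1) by blast
qed


section \<open>From SGA to finitary NID\<close>

text \<open>Strong collection gives at least one value for each argument and nothing but values. If
  values are unique up to \<open>eq\<close>, all of them are present and the set is the exact
  image.\<close>

lemma ex_replacement:
  assumes "D w a" "\<forall>z\<in>set xs. D w z"
    and sat: "\<And>v x y. sat v (\<lambda>_. a) (xs @ [y, x]) F \<longleftrightarrow> P v x y"
    and total: "\<And>v x. w \<sqsubseteq> v \<Longrightarrow> mem v x a \<Longrightarrow> \<exists>y. D v y \<and> P v x y"
    and unique: "\<And>v x y y'. w \<sqsubseteq> v \<Longrightarrow> D v y \<Longrightarrow> D v y' \<Longrightarrow> P v x y \<Longrightarrow> P v x y' \<Longrightarrow> eq v y y'"
  shows "\<exists>b. D w b \<and> ext w b (\<lambda>v y. \<exists>x. mem v x a \<and> P v x y)"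
proof -
  obtain b where b: "D w b" "\<And>v x. w \<sqsubseteq> v \<Longrightarrow> mem v x a \<Longrightarrow> \<exists>y. mem v y b \<and> P v x y"
      "\<And>v y. w \<sqsubseteq> v \<Longrightarrow> mem v y b \<Longrightarrow> \<exists>x. mem v x a \<and> P v x y"
    using ex_strong_collection[OF assms(1,2) sat total] by blast
  have "mem v y b" if "w \<sqsubseteq> v" "D v y" "mem v x a" "P v x y" for v x y
    using b(2)[OF that(1,3)] unique that mem_D mem_congL by blast
  then show ?thesis using b(1,3) unfolding ext_def by blast
qed

text \<open>\<open>closed\<close> ranges over all decompositions of the rule; by injectivity of
  pairs any single one decides.\<close>

lemma closed_iff:
  assumes r: "pr v r a b" "D v a" "D v b"
  shows "closed v Y r \<longleftrightarrow> (\<forall>u. v \<sqsubseteq> u \<longrightarrow> sub u a Y \<longrightarrow> (\<exists>z. mem u z b \<and> mem u z Y))"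
proof
  assume "closed v Y r"
  with r show "\<forall>u. v \<sqsubseteq> u \<longrightarrow> sub u a Y \<longrightarrow> (\<exists>z. mem u z b \<and> mem u z Y)"
    unfolding closed_def using le_refl by blast
next
  assume c: "\<forall>u. v \<sqsubseteq> u \<longrightarrow> sub u a Y \<longrightarrow> (\<exists>z. mem u z b \<and> mem u z Y)"
  show "closed v Y r"
    unfolding closed_def
  proof (intro allI impI)
    fix s a' b' u
    assume a: "v \<sqsubseteq> s" "D s a'" "D s b'" "pr s r a' b'" "s \<sqsubseteq> u" "sub u a' Y"
    have s: "pr s r a b" "D s a" "D s b" using r a(1) pr_mono D_mono by blast+
    have "eq s a a'" "eq s b b'" using pr_inj[OF s(1) a(4) s(2,3) a(2,3)] by blast+
    then have e: "eq u a a'" "eq u b b'" using a(5) eq_mono by blast+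
    have "v \<sqsubseteq> u" using a le_trans by blast
    moreover have "sub u a Y" using sub_trans sub_of_eq e a(6) by blast
    ultimately obtain z where "mem u z b" "mem u z Y" using c by blast
    then show "\<exists>z. mem u z b' \<and> mem u z Y" using e mem_congR by blast
  qed
qed

lemma sub_singleton: "upr w a x x \<Longrightarrow> D w x \<Longrightarrow> sub w a Y \<longleftrightarrow> mem w x Y"
  unfolding sub_def using upr_memL[of w a x x] upr_memD upr_mono mem_mono mem_congL eq_sym le_refl
  by meson

definition singletons :: "'w \<Rightarrow> 'e \<Rightarrow> 'e \<Rightarrow> bool" where
  "singletons w b \<Gamma> \<longleftrightarrow> ext w \<Gamma> (\<lambda>v U. \<exists>y. mem v y b \<and> upr v U y y)"

lemma ex_singletons:
  assumes "D w b"
  shows "\<exists>\<Gamma>. D w \<Gamma> \<and> singletons w b \<Gamma>"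
proof -
  have sat: "sat v (\<lambda>_. b) ([] @ [U, y]) (is_upair 0 1 1) \<longleftrightarrow> upr v U y y" for v U y
    by simp
  show ?thesis
    unfolding singletons_def
    by (rule ex_replacement[OF assms _ sat]) (use ex_upr mem_D upr_unique in \<open>auto 4 4\<close>)
qed

text \<open>\<open>p = (a, {{y} | y \<in> b})\<close> where \<open>r = (a, b)\<close>\<close>

definition rule_translation :: "'w \<Rightarrow> 'e \<Rightarrow> 'e \<Rightarrow> bool" where
  "rule_translation w r p \<longleftrightarrow> (\<exists>a. D w a \<and> (\<exists>b. D w b \<and> (\<exists>\<Gamma>. D w \<Gamma> \<and>
     pr w r a b \<and> pr w p a \<Gamma> \<and> singletons w b \<Gamma>)))"

text \<open>Because {y} \<subseteq> Y means y \<in> Y, including some member of \<Gamma> is the same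
  as meeting \<open>b\<close>, and the two classes coincide. Strong generation at the finite set {s}
  is then generation at \<open>s\<close>.\<close>

lemma set_gen_of_SGA:
  assumes SGA: "SGA_at w" and D: "D w X" "D w R"
    and rules: "\<And>v r. w \<sqsubseteq> v \<Longrightarrow> mem v r R \<Longrightarrow> finitary_rule v X r"
  shows "set_gen w (\<lambda>v. closed_class v X R)"
proof -
  have sat: "sat v (\<lambda>_. R) ([] @ [p, r]) (\<^bold>\<exists>a. \<^bold>\<exists>b. \<^bold>\<exists>\<Gamma>. is_pair 1 a b \<^bold>\<and> is_pair 0 a \<Gamma> \<^bold>\<and>
      (\<^bold>\<forall>U. U \<^bold>\<in> \<Gamma> \<^bold>\<longleftrightarrow> (\<^bold>\<exists>y. y \<^bold>\<in> b \<^bold>\<and> is_upair U y y))) \<longleftrightarrow> rule_translation v r p" for v p r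
    by (simp add: rule_translation_def singletons_def ext_def numeral_2_eq_2)
  have total: "\<exists>p. D v p \<and> rule_translation v r p" if v: "w \<sqsubseteq> v" "mem v r R" for v r
  proof -
    obtain a b where "D v a" "D v b" "pr v r a b"
      using rules[OF v] unfolding finitary_rule_def by blast
    moreover then obtain \<Gamma> where "D v \<Gamma>" "singletons v b \<Gamma>" using ex_singletons by blast
    ultimately show ?thesis using ex_pr unfolding rule_translation_def by meson
  qed
  obtain Z where Z: "D w Z" "\<And>v r. w \<sqsubseteq> v \<Longrightarrow> mem v r R \<Longrightarrow> \<exists>p. mem v p Z \<and> rule_translation v r p"
      "\<And>v p. w \<sqsubseteq> v \<Longrightarrow> mem v p Z \<Longrightarrow> \<exists>r. mem v r R \<and> rule_translation v r p"
    using ex_strong_collection[OF D(2) _ sat total] by auto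
  have class_eq: "inM v X Z Y \<longleftrightarrow> closed_class v X R Y" if v: "w \<sqsubseteq> v" for v Y
  proof
    assume Y: "inM v X Z Y"
    have "closed u Y r" if u: "v \<sqsubseteq> u" "mem u r R" for u r
    proof -
      have wu: "w \<sqsubseteq> u" using v u le_trans by blast
      obtain p where p: "mem u p Z" "rule_translation u r p" using Z(2) wu u by blast
      obtain a b \<Gamma> where *: "D u a" "D u b" "D u \<Gamma>" "pr u r a b" "pr u p a \<Gamma>" "singletons u b \<Gamma>"
        using p(2) unfolding rule_translation_def by blast
      have "\<exists>z. mem t z b \<and> mem t z Y" if t: "u \<sqsubseteq> t" "sub t a Y" for t
      proof -
        have "pin u a \<Gamma> Z" using * p unfolding pin_def by blast
        then obtain U where U: "mem t U \<Gamma>" "sub t U Y"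
          using Y u * t unfolding inM_def by blast
        then obtain y where y: "mem t y b" "upr t U y y"
          using ext_memD[OF *(6)[unfolded singletons_def] t(1)] by blast
        then show ?thesis using U sub_singleton mem_D by blast
      qed
      then show ?thesis using closed_iff[OF *(4) *(1,2)] by blast
    qed
    with Y show "closed_class v X R Y" unfolding closed_class_def inM_def by blast
  next
    assume Y: "closed_class v X R Y"
    have "\<exists>U. mem t U \<Gamma>' \<and> sub t U Y"
      if u: "v \<sqsubseteq> u" "D u \<sigma>" "D u \<Gamma>'" "pin u \<sigma> \<Gamma>' Z" "u \<sqsubseteq> t" "sub t \<sigma> Y" for u \<sigma> \<Gamma>' t
    proof -
      have wu: "w \<sqsubseteq> u" using v u le_trans by blast
      obtain p where p: "pr u p \<sigma> \<Gamma>'" "mem u p Z" using u unfolding pin_def by blast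
      obtain r where r: "mem u r R" "rule_translation u r p" using Z(3) wu p by blast
      obtain a b \<Gamma> where *: "D u a" "D u b" "D u \<Gamma>" "pr u r a b" "pr u p a \<Gamma>" "singletons u b \<Gamma>"
        using r(2) unfolding rule_translation_def by blast
      have e: "eq u a \<sigma>" "eq u \<Gamma> \<Gamma>'" using pr_inj[OF *(5) p(1)] * u by blast+
      have "sub t a Y" using sub_trans sub_of_eq eq_mono[OF e(1) u(5)] u(6) by blast
      moreover have "closed u Y r" using Y u r unfolding closed_class_def by blast
      ultimately obtain z where z: "mem t z b" "mem t z Y"
        using closed_iff[OF *(4) *(1,2)] u(5) by blast
      then obtain U where U: "D t U" "upr t U z z" using ex_upr mem_D by blast
      then have "mem t U \<Gamma>"
        using *(6) u(5) z unfolding singletons_def ext_def by blast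
      then have "mem t U \<Gamma>'" using eq_mono[OF e(2) u(5)] mem_congR by blast
      moreover have "sub t U Y" using U z sub_singleton mem_D by blast
      ultimately show ?thesis by blast
    qed
    with Y show "inM v X Z Y" unfolding closed_class_def inM_def by blast
  qed
  have "\<exists>\<sigma>. D v \<sigma> \<and> (\<exists>\<Gamma>. D v \<Gamma> \<and> pr v p \<sigma> \<Gamma> \<and> fin v \<sigma> \<and> sub v \<sigma> X \<and>
      (\<forall>t. v \<sqsubseteq> t \<longrightarrow> (\<forall>U. mem t U \<Gamma> \<longrightarrow> sub t U X)))"
    if v: "w \<sqsubseteq> v" "mem v p Z" for v p
  proof -
    obtain r where r: "mem v r R" "rule_translation v r p" using Z(3) v by blast
    obtain a b \<Gamma> where *: "D v a" "D v b" "D v \<Gamma>" "pr v r a b" "pr v p a \<Gamma>" "singletons v b \<Gamma>"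
      using r(2) unfolding rule_translation_def by blast
    obtain a' b' where **: "D v a'" "D v b'" "pr v r a' b'" "fin v a'" "sub v a' X" "sub v b' X"
      using rules[OF v(1) r(1)] unfolding finitary_rule_def by blast
    have e: "eq v a a'" "eq v b b'" using pr_inj[OF *(4) **(3)] * ** by blast+
    \<comment> \<open>\<open>p\<close> was built from \<open>a\<close>, while finiteness is known
      for the component \<open>a'\<close> of another decomposition of \<open>r\<close>. Using
      \<open>a'\<close> as the first component of \<open>p\<close> transfers it.\<close>
    have "pr v p a' \<Gamma>" using pr_cong[OF *(5)] e * eq_refl mem_D v by blast
    moreover have "sub t U X" if t: "v \<sqsubseteq> t" "mem t U \<Gamma>" for t U
    proof -
      obtain y where y: "mem t y b" "upr t U y y"
        using ext_memD[OF *(6)[unfolded singletons_def] t] by blast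
      then have "mem t y X" using sub_memD[OF sub_trans[OF sub_of_eq[OF e(2)] **(6)] t(1)] by blast
      then show ?thesis using y sub_singleton mem_D by blast
    qed
    ultimately show ?thesis using * ** by blast
  qed
  then have "strong_set_gen w (\<lambda>v. inM v X Z)"
    using SGA D Z(1) unfolding SGA_at_def by blast
  then obtain G where G: "D w G" "\<And>v \<beta>. w \<sqsubseteq> v \<Longrightarrow> mem v \<beta> G \<Longrightarrow> inM v X Z \<beta>"
      "\<And>v \<alpha> u \<sigma>. w \<sqsubseteq> v \<Longrightarrow> D v \<alpha> \<Longrightarrow> inM v X Z \<alpha> \<Longrightarrow> v \<sqsubseteq> u \<Longrightarrow> D u \<sigma> \<Longrightarrow> fin u \<sigma> \<Longrightarrow> sub u \<sigma> \<alpha> \<Longrightarrow>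
        \<exists>\<beta>. mem u \<beta> G \<and> sub u \<sigma> \<beta> \<and> sub u \<beta> \<alpha>"
    unfolding strong_set_gen_def by blast
  have "\<exists>\<beta>. mem u \<beta> G \<and> mem u s \<beta> \<and> sub u \<beta> \<alpha>"
    if a: "w \<sqsubseteq> v" "D v \<alpha>" "closed_class v X R \<alpha>" "v \<sqsubseteq> u" "mem u s \<alpha>" for v \<alpha> u s
  proof -
    have s: "D u s" using a mem_D by blast
    then obtain \<sigma> where \<sigma>: "D u \<sigma>" "upr u \<sigma> s s" using ex_upr by blast
    then show ?thesis
      using G(3)[of v \<alpha> u \<sigma>] a class_eq fin_singleton[OF s] sub_singleton[OF \<sigma>(2) s] by blast
  qed
  with G(1,2) class_eq show ?thesis unfolding set_gen_def by blast
qed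

section \<open>From finitary NID to SGA\<close>

lemma ex_intersection:
  assumes "D w a" "D w b"
  shows "\<exists>c. D w c \<and> ext w c (\<lambda>v x. mem v x a \<and> mem v x b)"
proof (rule ex_separation)
  show "bounded ((1 \<^bold>\<in> 0) (Suc (length [b])))" by (simp add: dMem_def bounded.intros)
  show "\<And>v x. sat v (\<lambda>_. a) ([b] @ [x]) (1 \<^bold>\<in> 0) \<longleftrightarrow> mem v x b" by simp
qed (use assms in auto)

text \<open>\<open>{S, U}\<close> serves as a tag for \<open>U\<close>: it is not an element of \<open>S\<close> and determines \<open>U\<close>.\<close>

lemma tag_notin: "upr w t S U \<Longrightarrow> D w S \<Longrightarrow> \<not> mem w t S"
  using upr_memL mem_asym by blast

lemma tag_inj:
  assumes "upr w t S U" "upr w t S V" "D w U" "D w V"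
  shows "eq w U V"
proof -
  \<comment> \<open>Each of \<open>U\<close> and \<open>V\<close> lies in the common pair. If both
    equal \<open>S\<close>, they are equal as well.\<close>
  have "eq w U S \<or> eq w U V" "eq w V S \<or> eq w V U"
    using assms upr_memR upr_memD by blast+
  then show ?thesis by (meson eq_sym eq_trans)
qed

lemma ex_tags:
  assumes "D w S" "D w \<Gamma>"
  shows "\<exists>B. D w B \<and> ext w B (\<lambda>v t. \<exists>U. mem v U \<Gamma> \<and> upr v t S U)"
proof -
  have sat: "sat v (\<lambda>_. \<Gamma>) ([S] @ [t, U]) (is_upair 1 0 2) \<longleftrightarrow> upr v t S U" for v U t
    by (simp add: numeral_2_eq_2)
  show ?thesis
    by (rule ex_replacement[OF assms(2) _ sat]) (use assms ex_upr mem_D D_mono upr_unique in \<open>auto 4 4\<close>)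
qed

text \<open>\<open>r = (\<sigma>, {{S, U} | U \<in> \<Gamma>})\<close> where \<open>p = (\<sigma>, \<Gamma>)\<close>\<close>

definition choice_rule :: "'w \<Rightarrow> 'e \<Rightarrow> 'e \<Rightarrow> 'e \<Rightarrow> bool" where
  "choice_rule w S p r \<longleftrightarrow> (\<exists>\<sigma>. D w \<sigma> \<and> (\<exists>\<Gamma>. D w \<Gamma> \<and> (\<exists>B. D w B \<and> pr w p \<sigma> \<Gamma> \<and> pr w r \<sigma> B \<and>
     ext w B (\<lambda>v t. \<exists>U. mem v U \<Gamma> \<and> upr v t S U))))"

text \<open>\<open>r = ({{S, U}}, {s})\<close>\<close>

definition elem_rule :: "'w \<Rightarrow> 'e \<Rightarrow> 'e \<Rightarrow> 'e \<Rightarrow> 'e \<Rightarrow> bool" where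
  "elem_rule w S U s r \<longleftrightarrow> (\<exists>t. D w t \<and> (\<exists>a. D w a \<and> (\<exists>b. D w b \<and>
     upr w t S U \<and> upr w a t t \<and> upr w b s s \<and> pr w r a b)))"

lemma closed_choice_rule:
  assumes r: "choice_rule w S p r" and p: "pr w p \<sigma> \<Gamma>" "D w \<sigma>" "D w \<Gamma>"
  shows "closed w Y r \<longleftrightarrow>
    (\<forall>v. w \<sqsubseteq> v \<longrightarrow> sub v \<sigma> Y \<longrightarrow> (\<exists>U t. mem v U \<Gamma> \<and> upr v t S U \<and> mem v t Y))"
proof -
  obtain \<sigma>' \<Gamma>' B where *: "D w \<sigma>'" "D w \<Gamma>'" "D w B" "pr w p \<sigma>' \<Gamma>'" "pr w r \<sigma>' B"
      "ext w B (\<lambda>v t. \<exists>U. mem v U \<Gamma>' \<and> upr v t S U)"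
    using r unfolding choice_rule_def by blast
  have e: "eq w \<sigma> \<sigma>'" "eq w \<Gamma> \<Gamma>'" using pr_inj[OF p(1) *(4)] p * by blast+
  have e\<sigma>: "sub v \<sigma> Y \<longleftrightarrow> sub v \<sigma>' Y" if "w \<sqsubseteq> v" for v
    using eq_mono[OF e(1) that] eq_sym sub_of_eq sub_trans by blast
  have eB: "mem v t B \<longleftrightarrow> (\<exists>U. mem v U \<Gamma> \<and> upr v t S U)" if "w \<sqsubseteq> v" "D v t" for v t
    using eq_mono[OF e(2) that(1)] *(6) that eq_sym mem_congR unfolding ext_def by blast
  show ?thesis
    unfolding closed_iff[OF *(5,1,3)] using e\<sigma> eB mem_D by blast
qed

lemma closed_elem_rule:
  assumes r: "elem_rule w S U s r" and D: "D w S" "D w U" "D w s"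
  shows "closed w Y r \<longleftrightarrow> (\<forall>v. w \<sqsubseteq> v \<longrightarrow> (\<forall>t. upr v t S U \<longrightarrow> mem v t Y \<longrightarrow> mem v s Y))"
proof -
  obtain t a b where *: "D w t" "D w a" "D w b" "upr w t S U" "upr w a t t" "upr w b s s" "pr w r a b"
    using r unfolding elem_rule_def by blast
  have a: "sub v a Y \<longleftrightarrow> mem v t Y" if "w \<sqsubseteq> v" for v
    using that upr_mono[OF *(5)] D_mono[OF *(1)] sub_singleton by blast
  have b: "(\<exists>z. mem v z b \<and> mem v z Y) \<longleftrightarrow> mem v s Y" if "w \<sqsubseteq> v" for v
    using upr_mono[OF *(6) that] D_mono[OF D(3) that] upr_memD upr_memL mem_congL by blast
  have t: "eq v t' t" if "w \<sqsubseteq> v" "upr v t' S U" "mem v t' Y" for v t'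
    using that upr_unique[of v t' S U t] upr_mono[OF *(4)] D_mono[OF *(1)] mem_D by blast
  show ?thesis
    unfolding closed_iff[OF *(7,2,3)] using a b t upr_mono[OF *(4)] mem_congL by blast
qed

section \<open>Sets of choice rules and element rules\<close>

lemma ex_choice_rules:
  assumes D: "D w S" "D w Z"
    and Z: "\<And>v p. w \<sqsubseteq> v \<Longrightarrow> mem v p Z \<Longrightarrow> \<exists>\<sigma> \<Gamma>. D v \<sigma> \<and> D v \<Gamma> \<and> pr v p \<sigma> \<Gamma>"
  shows "\<exists>R. D w R \<and> (\<forall>v. w \<sqsubseteq> v \<longrightarrow> (\<forall>p. mem v p Z \<longrightarrow> (\<exists>r. mem v r R \<and> choice_rule v S p r))) \<and>
    (\<forall>v. w \<sqsubseteq> v \<longrightarrow> (\<forall>r. mem v r R \<longrightarrow> (\<exists>p. mem v p Z \<and> choice_rule v S p r)))"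
proof (rule ex_strong_collection[OF D(2)])
  show "\<forall>z\<in>set [S]. D w z" using D by simp
  show "sat v (\<lambda>_. Z) ([S] @ [r, p]) (\<^bold>\<exists>\<sigma>. \<^bold>\<exists>\<Gamma>. \<^bold>\<exists>B. is_pair 2 \<sigma> \<Gamma> \<^bold>\<and> is_pair 1 \<sigma> B \<^bold>\<and>
      (\<^bold>\<forall>t. t \<^bold>\<in> B \<^bold>\<longleftrightarrow> (\<^bold>\<exists>U. U \<^bold>\<in> \<Gamma> \<^bold>\<and> is_upair t 0 U))) \<longleftrightarrow> choice_rule v S p r" for v r p
    by (simp add: choice_rule_def ext_def numeral_2_eq_2)
  fix v p assume v: "w \<sqsubseteq> v" "mem v p Z"
  then obtain \<sigma> \<Gamma> where p: "D v \<sigma>" "D v \<Gamma>" "pr v p \<sigma> \<Gamma>" using Z by blast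
  obtain B where "D v B" "ext v B (\<lambda>v t. \<exists>U. mem v U \<Gamma> \<and> upr v t S U)"
    using ex_tags p D v D_mono by blast
  then show "\<exists>r. D v r \<and> choice_rule v S p r"
    using p ex_pr unfolding choice_rule_def by meson
qed

text \<open>A set of rules for one fixed \<open>U\<close>, as delivered by collection over its
  elements. A second collection over \<open>C\<close>, followed by a union, then produces the rules
  for all s \<in> U \<in> C.\<close>

definition elem_rules :: "'w \<Rightarrow> 'e \<Rightarrow> 'e \<Rightarrow> 'e \<Rightarrow> bool" where
  "elem_rules w S U q \<longleftrightarrow>
     (\<forall>v. w \<sqsubseteq> v \<longrightarrow> (\<forall>s. mem v s U \<longrightarrow> (\<exists>r. mem v r q \<and> elem_rule v S U s r))) \<and>
     (\<forall>v. w \<sqsubseteq> v \<longrightarrow> (\<forall>r. mem v r q \<longrightarrow> (\<exists>s. mem v s U \<and> elem_rule v S U s r)))"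

lemma ex_elem_rules:
  assumes D: "D w S" "D w C"
  shows "\<exists>R. D w R \<and>
    (\<forall>v. w \<sqsubseteq> v \<longrightarrow> (\<forall>U s. mem v U C \<longrightarrow> mem v s U \<longrightarrow> (\<exists>r. mem v r R \<and> elem_rule v S U s r))) \<and>
    (\<forall>v. w \<sqsubseteq> v \<longrightarrow> (\<forall>r. mem v r R \<longrightarrow> (\<exists>U s. mem v U C \<and> mem v s U \<and> elem_rule v S U s r)))"
proof -
  have inner: "\<exists>q. D v q \<and> elem_rules v S U q" if v: "w \<sqsubseteq> v" "mem v U C" for v U
    unfolding elem_rules_def
  proof (rule ex_strong_collection)
    show DU: "D v U" using v mem_D by blast
    show "\<forall>z\<in>set [S, U]. D v z" using DU D v D_mono by auto
    show "sat u (\<lambda>_. U) ([S, U] @ [r, s]) (\<^bold>\<exists>t. \<^bold>\<exists>a. \<^bold>\<exists>b. is_upair t 0 1 \<^bold>\<and> is_upair a t t \<^bold>\<and>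
        is_upair b 3 3 \<^bold>\<and> is_pair 2 a b) \<longleftrightarrow> elem_rule u S U s r" for u r s
      by (simp add: elem_rule_def numeral_2_eq_2 numeral_3_eq_3)
    fix u s assume u: "v \<sqsubseteq> u" "mem u s U"
    then have Du: "D u S" "D u U" "D u s" using D v D_mono mem_D by blast+
    obtain t where t: "D u t" "upr u t S U" using ex_upr Du by blast
    obtain a b where "D u a" "upr u a t t" "D u b" "upr u b s s" using ex_upr Du t by meson
    then show "\<exists>r. D u r \<and> elem_rule u S U s r"
      using t ex_pr unfolding elem_rule_def by meson
  qed
  have sat: "sat v (\<lambda>_. C) ([S] @ [q, U])
      ((\<^bold>\<forall>s. s \<^bold>\<in> 2 \<^bold>\<longrightarrow> (\<^bold>\<exists>r. r \<^bold>\<in> 1 \<^bold>\<and> (\<^bold>\<exists>t. \<^bold>\<exists>a. \<^bold>\<exists>b. is_upair t 0 2 \<^bold>\<and> is_upair a t t \<^bold>\<and>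
          is_upair b s s \<^bold>\<and> is_pair r a b))) \<^bold>\<and>
       (\<^bold>\<forall>r. r \<^bold>\<in> 1 \<^bold>\<longrightarrow> (\<^bold>\<exists>s. s \<^bold>\<in> 2 \<^bold>\<and> (\<^bold>\<exists>t. \<^bold>\<exists>a. \<^bold>\<exists>b. is_upair t 0 2 \<^bold>\<and> is_upair a t t \<^bold>\<and>
          is_upair b s s \<^bold>\<and> is_pair r a b))))
      \<longleftrightarrow> elem_rules v S U q" for v q U
    by (simp add: elem_rules_def elem_rule_def numeral_2_eq_2)
  obtain b where b: "D w b" "\<And>v U. w \<sqsubseteq> v \<Longrightarrow> mem v U C \<Longrightarrow> \<exists>q. mem v q b \<and> elem_rules v S U q"
      "\<And>v q. w \<sqsubseteq> v \<Longrightarrow> mem v q b \<Longrightarrow> \<exists>U. mem v U C \<and> elem_rules v S U q"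
    using ex_strong_collection[OF D(2) _ sat inner] D by auto
  obtain R where R: "D w R" "ext w R (\<lambda>v r. \<exists>q. mem v q b \<and> mem v r q)"
    using ex_union b by blast
  have "\<exists>r. mem v r R \<and> elem_rule v S U s r" if v: "w \<sqsubseteq> v" "mem v U C" "mem v s U" for v U s
  proof -
    obtain q where "mem v q b" "elem_rules v S U q" using b(2) v by blast
    then show ?thesis using R(2) v mem_D unfolding elem_rules_def ext_def by (meson le_refl)
  qed
  moreover have "\<exists>U s. mem v U C \<and> mem v s U \<and> elem_rule v S U s r" if v: "w \<sqsubseteq> v" "mem v r R" for v r
  proof -
    obtain q where q: "mem v q b" "mem v r q" using ext_memD[OF R(2) v] by blast
    then obtain U where "mem v U C" "elem_rules v S U q" using b(3) v by blast
    then show ?thesis using q unfolding elem_rules_def by (meson le_refl)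
  qed
  ultimately show ?thesis using R(1) by blast
qed

definition bounded_rules :: "'w \<Rightarrow> 'e \<Rightarrow> 'e \<Rightarrow> bool" where
  "bounded_rules w S Z \<longleftrightarrow> (\<forall>u. w \<sqsubseteq> u \<longrightarrow> (\<forall>p. mem u p Z \<longrightarrow> (\<exists>\<sigma>. D u \<sigma> \<and> (\<exists>\<Gamma>. D u \<Gamma> \<and>
     pr u p \<sigma> \<Gamma> \<and> fin u \<sigma> \<and> sub u \<sigma> S \<and> (\<forall>t. u \<sqsubseteq> t \<longrightarrow> (\<forall>U. mem t U \<Gamma> \<longrightarrow> sub t U S))))))"

lemma bounded_rulesD:
  assumes "bounded_rules w S Z" "w \<sqsubseteq> u" "mem u p Z"
  shows "\<exists>\<sigma> \<Gamma>. D u \<sigma> \<and> D u \<Gamma> \<and> pr u p \<sigma> \<Gamma> \<and> fin u \<sigma> \<and> sub u \<sigma> S \<and>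
    (\<forall>t U. u \<sqsubseteq> t \<longrightarrow> mem t U \<Gamma> \<longrightarrow> sub t U S)"
  using assms unfolding bounded_rules_def by blast

text \<open>Collection over \<open>Z\<close> of the second components, with the first one quantified
  away, and then a union. Injectivity of pairs makes \<Gamma> depend on \<open>p\<close> alone, so
  no member of \<Gamma> is lost and the bound by \<open>S\<close> applies to every
  decomposition.\<close>

lemma ex_relevant_subsets:
  assumes D: "D w S" "D w Z" and Z: "bounded_rules w S Z"
  shows "\<exists>C. D w C \<and> (\<forall>v. w \<sqsubseteq> v \<longrightarrow> (\<forall>U. mem v U C \<longrightarrow> sub v U S)) \<and>
    (\<forall>v. w \<sqsubseteq> v \<longrightarrow> (\<forall>\<sigma>. D v \<sigma> \<longrightarrow> fin v \<sigma> \<longrightarrow> sub v \<sigma> S \<longrightarrow> mem v \<sigma> C)) \<and>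
    (\<forall>v. w \<sqsubseteq> v \<longrightarrow> (\<forall>p \<sigma> \<Gamma> U. mem v p Z \<longrightarrow> D v \<sigma> \<longrightarrow> pr v p \<sigma> \<Gamma> \<longrightarrow> mem v U \<Gamma> \<longrightarrow> mem v U C))"
proof -
  obtain C0 where C0: "D w C0" "\<And>v U. w \<sqsubseteq> v \<Longrightarrow> mem v U C0 \<Longrightarrow> sub v U S"
      "\<And>v \<sigma>. w \<sqsubseteq> v \<Longrightarrow> D v \<sigma> \<Longrightarrow> fin v \<sigma> \<Longrightarrow> sub v \<sigma> S \<Longrightarrow> mem v \<sigma> C0"
    using ex_finite_subsets[OF D(1)] by blast
  have sat: "sat v (\<lambda>_. Z) ([] @ [\<Gamma>, p]) (\<^bold>\<exists>\<sigma>. is_pair 1 \<sigma> 0) \<longleftrightarrow> (\<exists>\<sigma>. D v \<sigma> \<and> pr v p \<sigma> \<Gamma>)" for v \<Gamma> p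
    by simp
  have total: "\<exists>\<Gamma>. D v \<Gamma> \<and> (\<exists>\<sigma>. D v \<sigma> \<and> pr v p \<sigma> \<Gamma>)" if "w \<sqsubseteq> v" "mem v p Z" for v p
    using bounded_rulesD[OF Z that] by blast
  obtain b where b: "D w b" "\<And>v p. w \<sqsubseteq> v \<Longrightarrow> mem v p Z \<Longrightarrow> \<exists>\<Gamma>. mem v \<Gamma> b \<and> (\<exists>\<sigma>. D v \<sigma> \<and> pr v p \<sigma> \<Gamma>)"
      "\<And>v \<Gamma>. w \<sqsubseteq> v \<Longrightarrow> mem v \<Gamma> b \<Longrightarrow> \<exists>p. mem v p Z \<and> (\<exists>\<sigma>. D v \<sigma> \<and> pr v p \<sigma> \<Gamma>)"
    using ex_strong_collection[OF D(2) _ sat total] by auto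
  obtain W where W: "D w W" "ext w W (\<lambda>v U. \<exists>\<Gamma>. mem v \<Gamma> b \<and> mem v U \<Gamma>)"
    using ex_union[OF b(1)] by blast
  obtain C where C: "D w C" "ext w C (\<lambda>v U. mem v U C0 \<or> mem v U W)"
    using ex_binary_union[OF C0(1) W(1)] by blast
  have \<Gamma>_unique: "eq v \<Gamma> \<Gamma>'" if "pr v p \<sigma> \<Gamma>" "pr v p \<sigma>' \<Gamma>'" "D v \<sigma>" "D v \<sigma>'" "D v \<Gamma>" "D v \<Gamma>'"
    for v p \<sigma> \<sigma>' \<Gamma> \<Gamma>'
    using pr_inj(2)[OF that(1,2)] that by blast
  have "sub v U S" if v: "w \<sqsubseteq> v" "mem v U C" for v U
  proof (cases "mem v U C0")
    case True
    then show ?thesis using C0 v by blast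
  next
    case False
    then obtain \<Gamma> where \<Gamma>: "mem v \<Gamma> b" "mem v U \<Gamma>"
      using ext_memD[OF C(2) v] ext_memD[OF W(2) v(1)] by blast
    then obtain p \<sigma> where p: "mem v p Z" "D v \<sigma>" "pr v p \<sigma> \<Gamma>" using b(3) v by blast
    obtain \<sigma>' \<Gamma>' where *: "D v \<sigma>'" "D v \<Gamma>'" "pr v p \<sigma>' \<Gamma>'" "\<And>t U. v \<sqsubseteq> t \<Longrightarrow> mem t U \<Gamma>' \<Longrightarrow> sub t U S"
      using bounded_rulesD[OF Z v(1) p(1)] by blast
    have "eq v \<Gamma> \<Gamma>'" using \<Gamma>_unique p * \<Gamma> mem_D by blast
    then have "mem v U \<Gamma>'" using \<Gamma> mem_congR by blast
    then show ?thesis using * by blast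
  qed
  moreover have "mem v U C" if v: "w \<sqsubseteq> v" "mem v p Z" "D v \<sigma>" "pr v p \<sigma> \<Gamma>" "mem v U \<Gamma>" for v p \<sigma> \<Gamma> U
  proof -
    obtain \<Gamma>' \<sigma>' where *: "mem v \<Gamma>' b" "D v \<sigma>'" "pr v p \<sigma>' \<Gamma>'" using b(2) v by blast
    then have "eq v \<Gamma> \<Gamma>'" using \<Gamma>_unique v mem_D by blast
    then have "mem v U \<Gamma>'" using v mem_congR by blast
    then show ?thesis using * v C(2) W(2) mem_D unfolding ext_def by blast
  qed
  moreover have "mem v \<sigma> C" if "w \<sqsubseteq> v" "D v \<sigma>" "fin v \<sigma>" "sub v \<sigma> S" for v \<sigma>
    using C0(3) C(2) that unfolding ext_def by blast
  ultimately show ?thesis using C(1) by blast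
qed

lemma finitary_choice_rule:
  assumes Z: "bounded_rules w S Z" "mem w p Z" "choice_rule w S p r" "D w r"
    and X: "sub w S X" "\<And>v p \<sigma> \<Gamma> U t. w \<sqsubseteq> v \<Longrightarrow> mem v p Z \<Longrightarrow> D v \<sigma> \<Longrightarrow> pr v p \<sigma> \<Gamma> \<Longrightarrow> mem v U \<Gamma> \<Longrightarrow>
      D v t \<Longrightarrow> upr v t S U \<Longrightarrow> mem v t X"
  shows "finitary_rule w X r"
proof -
  obtain \<sigma> \<Gamma> B where *: "D w \<sigma>" "D w \<Gamma>" "D w B" "pr w p \<sigma> \<Gamma>" "pr w r \<sigma> B"
      "ext w B (\<lambda>v t. \<exists>U. mem v U \<Gamma> \<and> upr v t S U)"
    using Z(3) unfolding choice_rule_def by blast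
  obtain \<sigma>' \<Gamma>' where **: "D w \<sigma>'" "D w \<Gamma>'" "pr w p \<sigma>' \<Gamma>'" "fin w \<sigma>'" "sub w \<sigma>' S"
    using bounded_rulesD[OF Z(1) le_refl Z(2)] by blast
  have "eq w \<sigma> \<sigma>'"
    using pr_inj(1)[OF *(4) **(3)] * ** by blast
  then have "pr w r \<sigma>' B"
    using pr_cong[OF *(5)] eq_refl Z(4) *(3) by blast
  moreover have "sub w \<sigma>' X"
    using sub_trans X(1) **(5) by blast
  moreover have "sub w B X"
    unfolding sub_def
  proof (intro allI impI)
    fix v t assume v: "w \<sqsubseteq> v" "mem v t B"
    obtain U where U: "mem v U \<Gamma>" "upr v t S U" using ext_memD[OF *(6) v] by blast
    show "mem v t X"
      by (rule X(2)[OF v(1) mem_mono[OF Z(2) v(1)] D_mono[OF *(1) v(1)] pr_mono[OF *(4) v(1)] U(1) _ U(2)])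
        (use mem_D v in blast)
  qed
  ultimately show ?thesis
    using **(1,4) *(3) unfolding finitary_rule_def by blast
qed

lemma finitary_elem_rule:
  assumes "elem_rule w S U s r" "D w s" "\<And>t. D w t \<Longrightarrow> upr w t S U \<Longrightarrow> mem w t X" "mem w s X"
  shows "finitary_rule w X r"
proof -
  obtain t a b where *: "D w t" "D w a" "D w b" "upr w t S U" "upr w a t t" "upr w b s s" "pr w r a b"
    using assms(1) unfolding elem_rule_def by blast
  then have "fin w a" "sub w a X" "sub w b X"
    using fin_singleton sub_singleton assms by blast+
  with * show ?thesis unfolding finitary_rule_def by blast
qed

text \<open>Finitary NID is applied to the carrier of \<open>S\<close> and the tags, with choice
  rules from \<open>Z\<close> and element rules from \<open>C\<close>. Intersecting the resulting
  generators with \<open>S\<close> gives those for M(Z).\<close>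

lemma strong_set_gen_of_NID:
  assumes NID: "NID_at w" and D: "D w S" "D w Z" and Z: "bounded_rules w S Z"
  shows "strong_set_gen w (\<lambda>v. inM v S Z)"
proof -
  obtain C where C: "D w C" "\<And>v U. w \<sqsubseteq> v \<Longrightarrow> mem v U C \<Longrightarrow> sub v U S"
      "\<And>v \<sigma>. w \<sqsubseteq> v \<Longrightarrow> D v \<sigma> \<Longrightarrow> fin v \<sigma> \<Longrightarrow> sub v \<sigma> S \<Longrightarrow> mem v \<sigma> C"
      "\<And>v p \<sigma> \<Gamma> U. w \<sqsubseteq> v \<Longrightarrow> mem v p Z \<Longrightarrow> D v \<sigma> \<Longrightarrow> pr v p \<sigma> \<Gamma> \<Longrightarrow> mem v U \<Gamma> \<Longrightarrow> mem v U C"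
    using ex_relevant_subsets[OF D Z] by blast
  obtain T where T: "D w T" "ext w T (\<lambda>v t. \<exists>U. mem v U C \<and> upr v t S U)"
    using ex_tags[OF D(1) C(1)] by blast
  obtain X where X: "D w X" "ext w X (\<lambda>v x. mem v x S \<or> mem v x T)"
    using ex_binary_union[OF D(1) T(1)] by blast
  have DS: "D v S" if "w \<sqsubseteq> v" for v using D that D_mono by blast
  have SX: "mem v x X" if "w \<sqsubseteq> v" "mem v x S" for v x
    using X that mem_D unfolding ext_def by blast
  have TX: "mem v t X" if "w \<sqsubseteq> v" "D v t" "mem v U C" "upr v t S U" for v t U
    using X T that unfolding ext_def by blast
  have pZ: "\<exists>\<sigma> \<Gamma>. D v \<sigma> \<and> D v \<Gamma> \<and> pr v p \<sigma> \<Gamma>" if "w \<sqsubseteq> v" "mem v p Z" for v p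
    using bounded_rulesD[OF Z that] by blast
  obtain R1 where R1: "D w R1" "\<And>v p. w \<sqsubseteq> v \<Longrightarrow> mem v p Z \<Longrightarrow> \<exists>r. mem v r R1 \<and> choice_rule v S p r"
      "\<And>v r. w \<sqsubseteq> v \<Longrightarrow> mem v r R1 \<Longrightarrow> \<exists>p. mem v p Z \<and> choice_rule v S p r"
    using ex_choice_rules[OF D pZ] by blast
  obtain R2 where R2: "D w R2"
      "\<And>v U s. w \<sqsubseteq> v \<Longrightarrow> mem v U C \<Longrightarrow> mem v s U \<Longrightarrow> \<exists>r. mem v r R2 \<and> elem_rule v S U s r"
      "\<And>v r. w \<sqsubseteq> v \<Longrightarrow> mem v r R2 \<Longrightarrow> \<exists>U s. mem v U C \<and> mem v s U \<and> elem_rule v S U s r"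
    using ex_elem_rules[OF D(1) C(1)] by blast
  obtain R where R: "D w R" "ext w R (\<lambda>v r. mem v r R1 \<or> mem v r R2)"
    using ex_binary_union[OF R1(1) R2(1)] by blast
  have R_cases: "mem v r R1 \<or> mem v r R2" if "w \<sqsubseteq> v" "mem v r R" for v r
    using ext_memD[OF R(2) that] .
  have R_mem: "mem v r R" if "w \<sqsubseteq> v" "mem v r R1 \<or> mem v r R2" for v r
    using R(2) that mem_D unfolding ext_def by blast
  \<comment> \<open>This fact and the next two translate closedness under \<open>R\<close> into
    conditions on \<open>Z\<close> and \<open>C\<close>; after finitary NID has been applied, the
    rules enter through them only.\<close>
  have choiceD: "\<exists>U t. mem v U \<Gamma> \<and> upr v t S U \<and> mem v t Y"
    if v: "w \<sqsubseteq> v" and Y: "closed_class v X R Y"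
      and p: "mem v p Z" "pr v p \<sigma> \<Gamma>" "D v \<sigma>" "D v \<Gamma>" "sub v \<sigma> Y" for v p \<sigma> \<Gamma> Y
  proof -
    obtain r where "mem v r R1" "choice_rule v S p r" using R1(2) v p by blast
    then show ?thesis
      using Y R_mem[OF v] closed_choice_rule[OF _ p(2-4)] p(5) unfolding closed_class_def by blast
  qed
  have elemD: "mem v s Y"
    if v: "w \<sqsubseteq> v" and Y: "closed_class v X R Y"
      and U: "mem v U C" "mem v s U" "upr v t S U" "mem v t Y" for v U s t Y
  proof -
    obtain r where "mem v r R2" "elem_rule v S U s r" using R2(2) v U by blast
    then show ?thesis
      using Y R_mem[OF v] closed_elem_rule[OF _ DS[OF v], of U s r Y] U mem_D
      unfolding closed_class_def by blast
  qed
  \<comment> \<open>The condition for choice rules may assume \<sigma> \<subseteq> S, because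
    \<open>Z\<close> guarantees this for its premises; it is needed to exclude tags from
    \<sigma>.\<close>
  have closedI: "closed_class v X R Y"
    if v: "w \<sqsubseteq> v" and Y: "sub v Y X"
      and choice: "\<And>u p \<sigma> \<Gamma>. v \<sqsubseteq> u \<Longrightarrow> mem u p Z \<Longrightarrow> pr u p \<sigma> \<Gamma> \<Longrightarrow> D u \<sigma> \<Longrightarrow> D u \<Gamma> \<Longrightarrow> sub u \<sigma> S \<Longrightarrow>
        sub u \<sigma> Y \<Longrightarrow> \<exists>U t. mem u U \<Gamma> \<and> upr u t S U \<and> mem u t Y"
      and elem: "\<And>u U s t. v \<sqsubseteq> u \<Longrightarrow> mem u U C \<Longrightarrow> mem u s U \<Longrightarrow> upr u t S U \<Longrightarrow> mem u t Y \<Longrightarrow> mem u s Y"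
    for v Y
  proof -
    have "closed u Y r" if u: "v \<sqsubseteq> u" "mem u r R" for u r
    proof -
      have wu: "w \<sqsubseteq> u" using v u le_trans by blast
      from R_cases[OF wu u(2)] show ?thesis
      proof
        assume "mem u r R1"
        then obtain p where p: "mem u p Z" "choice_rule u S p r" using R1(3) wu by blast
        obtain \<sigma> \<Gamma> where *: "D u \<sigma>" "D u \<Gamma>" "pr u p \<sigma> \<Gamma>" "sub u \<sigma> S"
          using bounded_rulesD[OF Z wu p(1)] by blast
        show ?thesis
          unfolding closed_choice_rule[OF p(2) *(3,1,2)]
        proof (intro allI impI)
          fix t assume t: "u \<sqsubseteq> t" "sub t \<sigma> Y"
          show "\<exists>U x. mem t U \<Gamma> \<and> upr t x S U \<and> mem t x Y"
            by (rule choice[of t p \<sigma>])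
              (use le_trans[OF u(1) t(1)] t p(1) * mem_mono pr_mono D_mono sub_mono in blast)+
        qed
      next
        assume "mem u r R2"
        then obtain U s where U: "mem u U C" "mem u s U" "elem_rule u S U s r" using R2(3) wu by blast
        then have "D u U" "D u s" using mem_D by blast+
        then show ?thesis
          unfolding closed_elem_rule[OF U(3) DS[OF wu] \<open>D u U\<close> \<open>D u s\<close>]
          using elem le_trans[OF u(1)] U mem_mono by blast
      qed
    qed
    with Y show ?thesis unfolding closed_class_def by blast
  qed
  have "finitary_rule v X r" if v: "w \<sqsubseteq> v" "mem v r R" for v r
    using R_cases[OF v]
  proof
    assume "mem v r R1"
    then obtain p where p: "mem v p Z" "choice_rule v S p r" using R1(3) v by blast
    have le: "w \<sqsubseteq> u" if "v \<sqsubseteq> u" for u using that v le_trans by blast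
    have "bounded_rules v S Z" using Z le unfolding bounded_rules_def by blast
    moreover have "sub v S X" using SX le unfolding sub_def by blast
    moreover have "D v r" using \<open>mem v r R1\<close> mem_D by blast
    moreover have "mem u t X" if "v \<sqsubseteq> u" "mem u p' Z" "D u \<sigma>" "pr u p' \<sigma> \<Gamma>" "mem u U \<Gamma>" "D u t" "upr u t S U"
      for u p' \<sigma> \<Gamma> U t
      using TX[OF le[OF that(1)] that(6) C(4)[OF le[OF that(1)] that(2-5)] that(7)] .
    ultimately show ?thesis
      using finitary_choice_rule[of v S Z p r X] p by blast
  next
    assume "mem v r R2"
    then obtain U s where U: "mem v U C" "mem v s U" "elem_rule v S U s r" using R2(3) v by blast
    have "mem v s S" using sub_memD[OF C(2)[OF v(1) U(1)] le_refl U(2)] .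
    then show ?thesis
      using finitary_elem_rule[OF U(3)] TX[OF v(1) _ U(1)] SX v(1) mem_D by blast
  qed
  then have "set_gen w (\<lambda>v. closed_class v X R)"
    using NID X(1) R(1) unfolding NID_at_def by blast
  then obtain G where G: "D w G" "\<And>v \<beta>. w \<sqsubseteq> v \<Longrightarrow> mem v \<beta> G \<Longrightarrow> closed_class v X R \<beta>"
      "\<And>v \<alpha> s. w \<sqsubseteq> v \<Longrightarrow> D v \<alpha> \<Longrightarrow> closed_class v X R \<alpha> \<Longrightarrow> mem v s \<alpha> \<Longrightarrow>
        \<exists>\<beta>. mem v \<beta> G \<and> mem v s \<beta> \<and> sub v \<beta> \<alpha>"
    unfolding set_gen_def by (metis (no_types, lifting) le_refl)
  \<comment> \<open>The generators are the sets \<beta> \<inter> S for \<beta> in \<open>G\<close>;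
    the formula describes such an intersection \<gamma>.\<close>
  have sat: "sat v (\<lambda>_. G) ([S] @ [\<gamma>, \<beta>]) (\<^bold>\<forall>x. x \<^bold>\<in> 1 \<^bold>\<longleftrightarrow> x \<^bold>\<in> 2 \<^bold>\<and> x \<^bold>\<in> 0) \<longleftrightarrow>
      ext v \<gamma> (\<lambda>v x. mem v x \<beta> \<and> mem v x S)" for v \<gamma> \<beta>
    by (simp add: ext_def numeral_2_eq_2)
  obtain H where H: "D w H" "\<And>v \<beta>. w \<sqsubseteq> v \<Longrightarrow> mem v \<beta> G \<Longrightarrow>
        \<exists>\<gamma>. mem v \<gamma> H \<and> ext v \<gamma> (\<lambda>v x. mem v x \<beta> \<and> mem v x S)"
      "\<And>v \<gamma>. w \<sqsubseteq> v \<Longrightarrow> mem v \<gamma> H \<Longrightarrow> \<exists>\<beta>. mem v \<beta> G \<and> ext v \<gamma> (\<lambda>v x. mem v x \<beta> \<and> mem v x S)"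
    using ex_strong_collection[OF G(1) _ sat] D ex_intersection DS mem_D by auto
  \<comment> \<open>A premise \<sigma> \<subseteq> \<gamma> lies in \<beta>, so a choice rule puts
    the tag of some U \<in> \<Gamma> into \<beta>. As \<open>U\<close> belongs to \<open>C\<close>,
    element rules then put all of \<open>U\<close> into \<beta>, and \<open>U\<close> lies in
    \<open>S\<close>.\<close>
  have H_inM: "inM v S Z \<gamma>" if v: "w \<sqsubseteq> v" "mem v \<gamma> H" for v \<gamma>
  proof -
    obtain \<beta> where \<beta>: "mem v \<beta> G" "ext v \<gamma> (\<lambda>v x. mem v x \<beta> \<and> mem v x S)"
      using H(3)[OF v] by blast
    have mem\<gamma>: "mem u x \<gamma> \<longleftrightarrow> mem u x \<beta> \<and> mem u x S" if "v \<sqsubseteq> u" for u x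
      using \<beta>(2) that mem_D unfolding ext_def by blast
    have cl: "closed_class u X R \<beta>" if "v \<sqsubseteq> u" for u
      using G(2) le_trans[OF v(1) that] mem_mono[OF \<beta>(1) that] by blast
    have "\<exists>U. mem t U \<Gamma> \<and> sub t U \<gamma>"
      if u: "v \<sqsubseteq> u" "D u \<sigma>" "D u \<Gamma>" "pin u \<sigma> \<Gamma> Z" "u \<sqsubseteq> t" "sub t \<sigma> \<gamma>" for u \<sigma> \<Gamma> t
    proof -
      have vt: "v \<sqsubseteq> t" and wt: "w \<sqsubseteq> t" using u v le_trans by blast+
      obtain p where "pr u p \<sigma> \<Gamma>" "mem u p Z" using u(4) unfolding pin_def by blast
      then have p: "pr t p \<sigma> \<Gamma>" "mem t p Z" "D t \<sigma>" "D t \<Gamma>" using u pr_mono mem_mono D_mono by blast+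
      have "sub t \<sigma> \<beta>" using u(6) mem\<gamma> le_trans[OF vt] unfolding sub_def by blast
      then obtain U x where U: "mem t U \<Gamma>" "upr t x S U" "mem t x \<beta>"
        using choiceD[OF wt cl[OF vt] p(2,1,3,4)] by blast
      have UC: "mem t U C" using C(4)[OF wt p(2,3,1) U(1)] .
      have "mem s y \<gamma>" if s: "t \<sqsubseteq> s" "mem s y U" for s y
      proof -
        have vs: "v \<sqsubseteq> s" and ws: "w \<sqsubseteq> s" using s vt wt le_trans by blast+
        have "mem s y S" using sub_memD[OF C(2)[OF wt UC] s] .
        moreover have "mem s y \<beta>"
          using elemD[OF ws cl[OF vs] mem_mono[OF UC s(1)] s(2) upr_mono[OF U(2) s(1)] mem_mono[OF U(3) s(1)]] .
        ultimately show ?thesis using mem\<gamma>[OF vs] by blast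
      qed
      with U(1) show ?thesis unfolding sub_def by blast
    qed
    moreover have "sub v \<gamma> S" using mem\<gamma> unfolding sub_def by blast
    ultimately show ?thesis unfolding inM_def by blast
  qed
  have "\<exists>\<gamma>. mem u \<gamma> H \<and> sub u \<sigma> \<gamma> \<and> sub u \<gamma> \<alpha>"
    if "w \<sqsubseteq> u" "D u \<alpha>" "inM u S Z \<alpha>" "D u \<sigma>" "fin u \<sigma>" "sub u \<sigma> \<alpha>" for u \<alpha> \<sigma>
  proof -
    note u = that
    have \<alpha>S: "sub u \<alpha> S" using u(3) unfolding inM_def by blast
    have wle: "w \<sqsubseteq> t" if "u \<sqsubseteq> t" for t using that u(1) le_trans by blast
    have DuC: "D u C" using C(1) u(1) D_mono by blast
    have "bounded ((1 \<^bold>\<subseteq> 0) (Suc (length [\<alpha>])))"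
      by (simp add: is_subset_def dImp_def dAll_def dMem_def bounded.intros)
    \<comment> \<open>The subsets of \<alpha> among the tagged sets; \<open>Y\<close> will be
      \<alpha> together with their tags. This is a set because \<open>C\<close> is one and inclusion
      is bounded.\<close>
    then obtain C1 where C1: "D u C1" "ext u C1 (\<lambda>v x. mem v x C \<and> sub v x \<alpha>)"
      using ex_separation[of "1 \<^bold>\<subseteq> 0" "[\<alpha>]" u C "\<lambda>v x. sub v x \<alpha>"] u(2) DuC by auto
    obtain T1 where T1: "D u T1" "ext u T1 (\<lambda>v t. \<exists>U. mem v U C1 \<and> upr v t S U)"
      using ex_tags[OF DS[OF u(1)] C1(1)] by blast
    obtain Y where Y: "D u Y" "ext u Y (\<lambda>v x. mem v x \<alpha> \<or> mem v x T1)"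
      using ex_binary_union[OF u(2) T1(1)] by blast
    have T1_cases: "\<exists>U. mem t U C \<and> sub t U \<alpha> \<and> upr t x S U" if t: "u \<sqsubseteq> t" "mem t x T1" for t x
      using ext_memD[OF T1(2) t] ext_memD[OF C1(2) t(1)] by blast
    have Y_cases: "mem t x \<alpha> \<or> (\<exists>U. mem t U C \<and> sub t U \<alpha> \<and> upr t x S U)"
      if t: "u \<sqsubseteq> t" "mem t x Y" for t x
      using ext_memD[OF Y(2) t] T1_cases[OF t(1)] by blast
    have \<alpha>Y: "mem t x Y" if "u \<sqsubseteq> t" "mem t x \<alpha>" for t x
      using Y(2) that mem_D unfolding ext_def by blast
    have tagY: "\<exists>x. upr t x S U \<and> mem t x Y" if t: "u \<sqsubseteq> t" "mem t U C" "sub t U \<alpha>" for t U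
    proof -
      have DU: "D t U" using t mem_D by blast
      obtain x where x: "D t x" "upr t x S U" using ex_upr[OF DS[OF wle[OF t(1)]] DU] by blast
      have "mem t U C1" using C1(2) t DU unfolding ext_def by blast
      then have "mem t x T1" using T1(2) t(1) x unfolding ext_def by blast
      then have "mem t x Y" using Y(2) t(1) x unfolding ext_def by blast
      with x show ?thesis by blast
    qed
    \<comment> \<open>Whatever \<open>Y\<close> adds to \<alpha> is a tag and hence not in
      \<open>S\<close>. This serves twice: a premise \<sigma> \<subseteq> S inside \<open>Y\<close>
      lies in \<alpha>, and a generator below \<open>Y\<close> is cut down to a subset of
      \<alpha>.\<close>
    have YS: "mem t x \<alpha>" if t: "u \<sqsubseteq> t" "mem t x Y" "mem t x S" for t x
      using Y_cases[OF t(1,2)] tag_notin DS[OF wle[OF t(1)]] t(3) by blast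
    have clY: "closed_class u X R Y"
    proof (rule closedI[OF u(1)])
      have "mem t x X" if t: "u \<sqsubseteq> t" "mem t x Y" for t x
      proof -
        have "D t x" using t mem_D by blast
        then show ?thesis
          using Y_cases[OF t] SX[OF wle[OF t(1)] sub_memD[OF \<alpha>S t(1)]] TX[OF wle[OF t(1)]] by blast
      qed
      then show "sub u Y X" unfolding sub_def by blast
    next
      fix t p \<sigma> \<Gamma>
      assume t: "u \<sqsubseteq> t" "mem t p Z" "pr t p \<sigma> \<Gamma>" "D t \<sigma>" "D t \<Gamma>" "sub t \<sigma> S" "sub t \<sigma> Y"
      have "sub t \<sigma> \<alpha>"
        using YS le_trans[OF t(1)] t(6,7) unfolding sub_def by blast
      moreover have "pin t \<sigma> \<Gamma> Z" using t unfolding pin_def by blast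
      ultimately obtain U where U: "mem t U \<Gamma>" "sub t U \<alpha>"
        using u(3) t(1,4,5) le_refl unfolding inM_def by blast
      then show "\<exists>U x. mem t U \<Gamma> \<and> upr t x S U \<and> mem t x Y"
        using tagY[OF t(1) C(4)[OF wle[OF t(1)] t(2,4,3) U(1)] U(2)] by blast
    next
      fix t U s x
      assume t: "u \<sqsubseteq> t" "mem t U C" "mem t s U" "upr t x S U" "mem t x Y"
      \<comment> \<open>The tag \<open>x\<close> of \<open>U\<close> is not in \<alpha>, so it
        entered \<open>Y\<close> as the tag of some V \<subseteq> \<alpha>. Tags being injective, U
        = V, and therefore s \<in> \<alpha>.\<close>
      have "\<not> mem t x \<alpha>"
        using tag_notin[OF t(4) DS[OF wle[OF t(1)]]] sub_memD[OF \<alpha>S t(1)] by blast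
      then obtain V where V: "mem t V C" "sub t V \<alpha>" "upr t x S V"
        using Y_cases[OF t(1,5)] by blast
      have "eq t U V" using tag_inj[OF t(4) V(3)] t(2) V(1) mem_D by blast
      then have "mem t s V" using t(3) mem_congR by blast
      then show "mem t s Y" using \<alpha>Y[OF t(1)] sub_memD[OF V(2) le_refl] by blast
    qed
    \<comment> \<open>Since \<sigma> is finite, it has been tagged; its tag \<open>x\<close> is the
      single point at which generation is applied.\<close>
    have \<sigma>C: "mem u \<sigma> C" using C(3)[OF u(1,4,5)] sub_trans[OF u(6) \<alpha>S] by blast
    then obtain x where x: "upr u x S \<sigma>" "mem u x Y" using tagY[OF le_refl _ u(6)] by blast
    obtain \<beta> where \<beta>: "mem u \<beta> G" "mem u x \<beta>" "sub u \<beta> Y"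
      using G(3)[OF u(1) Y(1) clY x(2)] by blast
    obtain \<gamma> where \<gamma>: "mem u \<gamma> H" "ext u \<gamma> (\<lambda>v x. mem v x \<beta> \<and> mem v x S)"
      using H(2)[OF u(1) \<beta>(1)] by blast
    have "mem t s \<gamma>" if t: "u \<sqsubseteq> t" "mem t s \<sigma>" for t s
    proof -
      have "closed_class t X R \<beta>" using G(2)[OF wle[OF t(1)] mem_mono[OF \<beta>(1) t(1)]] .
      then have "mem t s \<beta>"
        by (rule elemD[OF wle[OF t(1)] _ mem_mono[OF \<sigma>C t(1)] t(2) upr_mono[OF x(1) t(1)] mem_mono[OF \<beta>(2) t(1)]])
      moreover have "mem t s S" using sub_memD[OF \<alpha>S t(1) sub_memD[OF u(6) t]] .
      ultimately show ?thesis using \<gamma>(2) t mem_D unfolding ext_def by blast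
    qed
    moreover have "mem t s \<alpha>" if t: "u \<sqsubseteq> t" "mem t s \<gamma>" for t s
      using ext_memD[OF \<gamma>(2) t] sub_memD[OF \<beta>(3) t(1)] YS[OF t(1)] by blast
    ultimately show ?thesis using \<gamma>(1) unfolding sub_def by blast
  qed
  \<comment> \<open>Membership in M(Z) persists, so a later world \<open>u\<close> at which \<sigma>
    appears can serve as the starting world for \<alpha> too.\<close>
  moreover have "inM u S Z \<alpha>" if "inM v S Z \<alpha>" "v \<sqsubseteq> u" for v u \<alpha>
    using that(1) sub_mono[OF _ that(2)] le_trans[OF that(2)] unfolding inM_def by blast
  ultimately have "\<exists>\<gamma>. mem u \<gamma> H \<and> sub u \<sigma> \<gamma> \<and> sub u \<gamma> \<alpha>"
    if "w \<sqsubseteq> v" "D v \<alpha>" "inM v S Z \<alpha>" "v \<sqsubseteq> u" "D u \<sigma>" "fin u \<sigma>" "sub u \<sigma> \<alpha>" for v u \<alpha> \<sigma>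
    using that le_trans D_mono by blast
  with H(1) H_inM show ?thesis
    unfolding strong_set_gen_def by blast
qed

text \<open>The equivalence holds at each world separately. Each side quantifies over later worlds,
  where the other side is still available because it persists.\<close>

lemma SGA_iff_NID: "SGA_at w \<longleftrightarrow> NID_at w"
proof
  have mono: "SGA_at v" if "SGA_at w" "w \<sqsubseteq> v" for v
    using that le_trans unfolding SGA_at_def by blast
  assume SGA: "SGA_at w"
  show "NID_at w"
    unfolding NID_at_def using set_gen_of_SGA[OF mono[OF SGA]] by blast
next
  have mono: "NID_at v" if "NID_at w" "w \<sqsubseteq> v" for v
    using that le_trans unfolding NID_at_def by blast
  assume NID: "NID_at w"
  show "SGA_at w"
    unfolding SGA_at_def using strong_set_gen_of_NID[OF mono[OF NID]] unfolding bounded_rules_def by blast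
qed

end

lemma free_vars_equivalence: "free_vars ((SGA \<^bold>\<longleftrightarrow> finitary_NID) 0) = {}"
  by (simp add: SGA_def finitary_NID_def strongly_set_generated_def set_generated_def in_M_def
      is_finitary_rule_def closed_under_def is_finite_def is_surjection_def is_function_def
      is_segment_def is_nat_def is_omega_def is_inductive_def pair_in_def is_pair_def is_upair_def
      is_succ_def is_empty_def is_subset_def dIff_def dNot_def dAll_def dEx_def dImp_def dConj_def
      dDisj_def dMem_def dEq_def)

theorem theorem7p3: "CZF \<turnstile> (SGA \<^bold>\<longleftrightarrow> finitary_NID) 0"
proof (cases "CZF \<turnstile> Falsum")
  case True
  then show ?thesis by (rule derives.FalsumE)
next
  case False
  \<comment> \<open>Consistency is what puts \<open>CZF\<close> into the theory of every world, so
    that the canonical structure is a model of it.\<close>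
  interpret canonical: czf_model world_le "\<lambda>w x. x \<in> vars (level w)"
    "\<lambda>w x y. Mem x y \<in> theory_of w" "\<lambda>w x y. Eq x y \<in> theory_of w"
    by unfold_locales (rule canonical_forces_CZF[OF False])
  have "canonical.sat w (\<lambda>_. 0) [] (SGA \<^bold>\<longleftrightarrow> finitary_NID)" for w
    by (simp add: canonical.sat_SGA canonical.sat_finitary_NID canonical.SGA_iff_NID)
  then have "canonical.forces w (\<lambda>_. 0) ((SGA \<^bold>\<longleftrightarrow> finitary_NID) 0)" for w
    by (simp add: canonical.sat_def canonical.assign_Nil)
  then show ?thesis
    by (rule canonical_completeness[OF free_vars_equivalence])
qed

end
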